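(* Let $c=2\pi\sqrt{5/12}$. Uniformly for all integers $m,n>0$, $$\pi(m,n)\sim \frac{5}{2^4\cdot 3}\,\frac{e^{c\sqrt{\min(m,n)}}}{[\min(m,n)]^{3/2}}\left(1+e^{-\frac{c|n-m|}{2\sqrt{\min(m,n)}}}\right)^{-1}$$ as $\min(m,n)\to\infty$. That is, for every $\varepsilon>0$ there is $N$ such that for all integers $m,n>0$ with $\min(m,n)\ge N$, the ratio of the left-hand side to the right-hand side differs from $1$ by at most $\varepsilon$. In particular, $$\pi(n,n)\sim \frac{5}{2^5\cdot 3}\,\frac{e^{c\sqrt{n}}}{n^{3/2}}$$ as $n\to\infty$.
   Context: An integer partition is a non-increasing sequence $\lambda=(\lambda_1,\lambda_2,\dots)$ of non-negative integers; it is a partition of $n$ if $\lambda_1+\lambda_2+\cdots=n$ (so all but finitely many $\lambda_j$ are $0$). For partitions $\alpha=(\alpha_1,\alpha_2,\dots)$ and $\beta=(\beta_1,\beta_2,\dots)$, the pair $(\alpha,\beta)$ is a pair of partitions with steadily decreasing parts if $\min(\alpha_i,\beta_i)\ge \max(\alpha_{i+1},\beta_{i+1})$ for all integers $i\ge 1$. For integers $m,n\ge 0$, $\pi(m,n)$ is the number of pairs $(\alpha,\beta)$ with steadily decreasing parts such that $\alpha_1+\alpha_2+\cdots=m$ and $\beta_1+\beta_2+\cdots=n$. (In the claim, $\pi$ without arguments, as in $c=2\pi\sqrt{5/12}$, is the usual constant.) *)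

theory Defs
  imports Complex_Main "HOL-Library.Landau_Symbols"
begin

text \<open>Sequences are indexed from 0, so \<open>a i\<close> is the part with mathematical index \<open>i + 1\<close>.\<close>

definition partition_of :: "nat \<Rightarrow> (nat \<Rightarrow> nat) \<Rightarrow> bool" where
  "partition_of n a \<longleftrightarrow> antimono a \<and> finite {i. a i \<noteq> 0} \<and> (\<Sum>i | a i \<noteq> 0. a i) = n"

definition steadily_decreasing :: "(nat \<Rightarrow> nat) \<Rightarrow> (nat \<Rightarrow> nat) \<Rightarrow> bool" where
  "steadily_decreasing a b \<longleftrightarrow> (\<forall>i. min (a i) (b i) \<ge> max (a (Suc i)) (b (Suc i)))"

definition steady_pairs :: "nat \<Rightarrow> nat \<Rightarrow> ((nat \<Rightarrow> nat) \<times> (nat \<Rightarrow> nat)) set" where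
  "steady_pairs m n = {(a, b). partition_of m a \<and> partition_of n b \<and> steadily_decreasing a b}"

definition num_steady_pairs :: "nat \<Rightarrow> nat \<Rightarrow> nat" where
  "num_steady_pairs m n = card (steady_pairs m n)"

definition steady_const :: real where
  "steady_const = 2 * pi * sqrt (5 / 12)"

definition steady_main_term :: "nat \<Rightarrow> nat \<Rightarrow> real" where
  "steady_main_term m n =
     5 / (2 ^ 4 * 3) *
     (exp (steady_const * sqrt (real (min m n))) / real (min m n) powr (3 / 2)) *
     inverse (1 + exp (- (steady_const * \<bar>real n - real m\<bar> / (2 * sqrt (real (min m n))))))"

text \<open>The sets counted above are finite, so \<open>card\<close> is a genuine count.\<close>

lemma finite_partitions_of: "finite {a. partition_of n a}"
proof -
  have "a \<in> {f. \<forall>i. (i \<in> {..<n} \<longrightarrow> f i \<in> {..n}) \<and> (i \<notin> {..<n} \<longrightarrow> f i = 0)}"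
    if "partition_of n a" for a
  proof -
    from that have mono: "antimono a" and fin: "finite {i. a i \<noteq> 0}"
      and sum: "(\<Sum>i | a i \<noteq> 0. a i) = n"
      by (auto simp: partition_of_def)
    have le: "a i \<le> n" for i
      using member_le_sum[of i "{i. a i \<noteq> 0}" a] fin sum by (cases "a i = 0") auto
    have zero: "a i = 0" if "n \<le> i" for i
    proof (rule ccontr)
      assume "a i \<noteq> 0"
      hence sub: "{..i} \<subseteq> {i. a i \<noteq> 0}"
        using mono by (auto simp: antimono_def intro: less_le_trans)
      have "Suc i \<le> card {i. a i \<noteq> 0}"
        using card_mono[OF fin sub] by simp
      also have "\<dots> \<le> (\<Sum>i | a i \<noteq> 0. a i)"
        using sum_mono[of "{i. a i \<noteq> 0}" "\<lambda>_. 1" a] by auto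
      finally show False using that sum by simp
    qed
    show ?thesis using le zero by auto
  qed
  thus ?thesis
    by (intro finite_subset[OF _ finite_set_of_finite_funs[of "{..<n}" "{..n}" 0]]) auto
qed

lemma finite_steady_pairs: "finite (steady_pairs m n)"
  by (rule finite_subset[of _ "{a. partition_of m a} \<times> {b. partition_of n b}"])
    (auto simp: steady_pairs_def finite_partitions_of)

end

theory Submission
  imports Defs "HOL-Probability.Probability" "HOL-Real_Asymp.Real_Asymp"
begin

text \<open>
  Reading off the columns of the partition \<open>max a\<^sub>0 b\<^sub>0 \<ge> min a\<^sub>0 b\<^sub>0 \<ge> max a\<^sub>1 b\<^sub>1 \<ge> \<dots>\<close> turns a steady pair
  into multiplicities of the parts \<open>x^(l+1) y^l\<close>, \<open>x^l y^(l+1)\<close>, \<open>(x y)^(2 l + 2)\<close> (Carlitz).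
  The multiplicity of the part \<open>x\<close> is determined by the others and by \<open>m - n\<close>; forgetting it shows that
  \<open>\<pi>(n + k, n) + \<pi>(n, n - k - 1)\<close> does not depend on \<open>k\<close> and equals the coefficient \<open>Q(n)\<close> of \<open>q^n\<close> in
  \<open>F(q) = 1 / ((q;q)^2 (q^2;q^2))\<close>.

  The asymptotics of \<open>Q\<close> come from Cauchy's integral on the circle of radius \<open>exp (-1/M)\<close>, where \<open>M\<close> is an
  integer next to the saddle point. After the scaling \<open>\<theta> = x M^(-3/2)\<close> the integrand converges to a Gaussian
  and is dominated by a multiple of \<open>1 / (1 + c x^2)\<close>; the value \<open>F(exp (-1/M))\<close> is found by the trapezoidal rule
  for \<open>- ln (1 - exp (- j t))\<close>.

  Given \<open>Q\<close>, the ratio \<open>\<rho>(n, k) = \<pi>(n + k, n) / Q(n)\<close> satisfies \<open>\<rho>(n, k) = 1 - \<rho>(n - k - 1, k + 1) Q(n - k - 1) / Q(n)\<close>.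
  For \<open>k \<approx> x \<surd>n\<close> the quotient of the \<open>Q\<close> tends to \<open>e = exp (- c x / 2)\<close>, so \<open>\<rho>\<close> tends to the fixed point
  \<open>1 / (1 + e)\<close>; monotonicity of \<open>\<rho>\<close> in \<open>k\<close> covers \<open>x = 0\<close> and \<open>x = \<infinity>\<close>, and compactness gives uniformity.
\<close>

section \<open>Steady pairs and multiplicities of parts\<close>

text \<open>The count depends on two indices, but the recurrence replaces a bivariate saddle point
  analysis: only the one-variable sequence \<open>Q\<close> is treated analytically, and the
  dependence on \<open>m - n\<close> comes out of a real-variable argument. The price is a fixed
  point whose contraction factor tends to 1 as \<open>x\<close> goes to 0, which is why that case
  needs its own argument. For \<open>Q\<close> the circle is not cut into arcs. With
  \<open>u = Re t\<close>, the quotient \<open>F(exp (- t)) / F(exp (- u))\<close> is needed only up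
  to o(1) in its logarithm and only for \<open>\<theta>\<close> of order \<open>u^(3/2)\<close>, so
  the pole \<open>1 / z\<close> of \<open>1 / (exp z - 1)\<close> and a crude error bound are
  enough; constants and powers of \<open>u\<close> matter on the real axis alone. An integer
  \<open>M\<close> can serve as a number of factors in the domination bound, and moving it off the
  exact saddle point by at most 1 leaves a phase that vanishes in the limit.\<close>

lemma partition_of_eq_0:
  assumes "partition_of n a" "n \<le> i"
  shows "a i = 0"
proof (rule ccontr)
  assume "a i \<noteq> 0"
  have fin: "finite {i. a i \<noteq> 0}" and sum: "(\<Sum>i | a i \<noteq> 0. a i) = n" and mono: "antimono a"
    using assms by (auto simp: partition_of_def)
  have sub: "{..i} \<subseteq> {i. a i \<noteq> 0}"
    using mono \<open>a i \<noteq> 0\<close> by (auto simp: antimono_def intro: less_le_trans)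
  have "Suc i \<le> card {i. a i \<noteq> 0}"
    using card_mono[OF fin sub] by simp
  also have "\<dots> \<le> (\<Sum>i | a i \<noteq> 0. a i)"
    using sum_mono[of "{i. a i \<noteq> 0}" "\<lambda>_. 1" a] by auto
  finally show False using assms(2) sum by simp
qed

text \<open>One cutoff \<open>K > n\<close> serves both sequences, whatever \<open>m\<close> is:
  \<open>b\<close> vanishes from index \<open>n\<close> on, and steadiness gives
  \<open>a (j + 1) \<le> b j\<close>, so \<open>a\<close> vanishes from \<open>n + 1\<close>
  on.\<close>

lemma steady_pairs_iff:
  assumes "n < K"
  shows "(a, b) \<in> steady_pairs m n \<longleftrightarrow>
    (\<forall>i\<ge>K. a i = 0 \<and> b i = 0) \<and> steadily_decreasing a b \<and> sum a {..<K} = m \<and> sum b {..<K} = n"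
proof
  assume *: "(a, b) \<in> steady_pairs m n"
  have sd: "steadily_decreasing a b" and pa: "partition_of m a" and pb: "partition_of n b"
    using * by (auto simp: steady_pairs_def)
  have b0: "b i = 0" if "i \<ge> n" for i using partition_of_eq_0[OF pb that] .
  have a0: "a i = 0" if "i > n" for i
  proof -
    obtain j where "i = Suc j" "j \<ge> n" using \<open>n < i\<close> by (cases i) auto
    moreover have "max (a (Suc j)) (b (Suc j)) \<le> min (a j) (b j)"
      using sd by (auto simp: steadily_decreasing_def)
    ultimately show ?thesis using b0[of j] by simp
  qed
  have zero: "\<forall>i\<ge>K. a i = 0 \<and> b i = 0" using a0 b0 assms by auto
  have "sum a {..<K} = (\<Sum>i | a i \<noteq> 0. a i)" "sum b {..<K} = (\<Sum>i | b i \<noteq> 0. b i)"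
    using zero by (auto intro!: sum.mono_neutral_right simp: not_less[symmetric])
  thus "(\<forall>i\<ge>K. a i = 0 \<and> b i = 0) \<and> steadily_decreasing a b \<and> sum a {..<K} = m \<and> sum b {..<K} = n"
    using zero sd pa pb by (auto simp: partition_of_def)
next
  assume *: "(\<forall>i\<ge>K. a i = 0 \<and> b i = 0) \<and> steadily_decreasing a b \<and> sum a {..<K} = m \<and> sum b {..<K} = n"
  have fin: "finite {i. a i \<noteq> 0}" "finite {i. b i \<noteq> 0}"
    using * by (auto intro!: finite_subset[of _ "{..<K}"] simp: not_less[symmetric])
  have sums: "sum a {..<K} = (\<Sum>i | a i \<noteq> 0. a i)" "sum b {..<K} = (\<Sum>i | b i \<noteq> 0. b i)"
    using * by (auto intro!: sum.mono_neutral_right simp: not_less[symmetric])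
  have "antimono a" "antimono b"
    using * by (auto simp: antimono_iff_le_Suc steadily_decreasing_def)
  thus "(a, b) \<in> steady_pairs m n"
    using * fin sums by (auto simp: partition_of_def steady_pairs_def)
qed

text \<open>In terms of a steady pair \<open>(a, b)\<close>: \<open>u\<close> and \<open>v\<close> are the truncated differences \<open>a - b\<close> and \<open>b - a\<close>, and
  \<open>e i = min (a i) (b i) - max (a (i + 1)) (b (i + 1))\<close>.\<close>

definition excess_data :: "nat \<Rightarrow> nat \<Rightarrow> nat \<Rightarrow> ((nat \<Rightarrow> nat) \<times> (nat \<Rightarrow> nat) \<times> (nat \<Rightarrow> nat)) set" where
  "excess_data K m n = {(u, v, e). (\<forall>i\<ge>K. u i = 0 \<and> v i = 0 \<and> e i = 0) \<and> (\<forall>i. u i = 0 \<or> v i = 0) \<and>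
     (\<Sum>l<K. Suc l * (e l + u l + v l)) = m + sum v {..<K} \<and>
     (\<Sum>l<K. Suc l * (e l + u l + v l)) = n + sum u {..<K}}"

text \<open>Interchange of summation: \<open>d l\<close> lies in the tails starting at 0, ...,
  \<open>l\<close>.\<close>

lemma sum_tails:
  fixes d :: "nat \<Rightarrow> nat"
  shows "(\<Sum>i<K. sum d {i..<K}) = (\<Sum>l<K. Suc l * d l)"
proof (induction K)
  case (Suc K)
  have "(\<Sum>i<Suc K. sum d {i..<Suc K}) = (\<Sum>i<Suc K. sum d {i..<K} + d K)"
    by (intro sum.cong) (auto simp: sum.atLeastLessThan_Suc)
  thus ?case using Suc by (simp add: sum.distrib)
qed auto

text \<open>Since \<open>max (a i) (b i) - max (a (i+1)) (b (i+1)) = e i + u i + v i\<close>, the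
  maxima are tail sums, and adding \<open>e i + u i\<close> or \<open>e i + v i\<close> to the next
  maximum restores \<open>a i\<close> or \<open>b i\<close>. The two equations in
  \<open>excess_data\<close> hold because the sum of the maxima is both \<open>m\<close> plus the
  total of \<open>v\<close> and \<open>n\<close> plus the total of \<open>u\<close>.\<close>

lemma card_steady_pairs_excess_data:
  assumes "n < K"
  shows "card (steady_pairs m n) = card (excess_data K m n)"
proof (rule bij_betw_same_card)
  let ?f = "\<lambda>(a::nat\<Rightarrow>nat, b::nat\<Rightarrow>nat). (\<lambda>i. a i - b i, \<lambda>i. b i - a i,
              \<lambda>i. min (a i) (b i) - max (a (Suc i)) (b (Suc i)))"
  let ?T = "\<lambda>u v e i. (\<Sum>l\<in>{i..<K}. (e l::nat) + u l + v l)"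
  let ?g = "\<lambda>(u, v, e). (\<lambda>i. e i + u i + ?T u v e (Suc i), \<lambda>i. e i + v i + ?T u v e (Suc i))"
  have T: "?T (\<lambda>i. a i - b i) (\<lambda>i. b i - a i) (\<lambda>i. min (a i) (b i) - max (a (Suc i)) (b (Suc i))) i
      = max (a i) (b i)" if "(a, b) \<in> steady_pairs m n" for a b i
  proof -
    have sd: "max (a (Suc i)) (b (Suc i)) \<le> min (a i) (b i)" for i
      using that by (auto simp: steady_pairs_iff[OF assms] steadily_decreasing_def)
    have z: "a i = 0" "b i = 0" if "i \<ge> K" for i
      using \<open>(a, b) \<in> _\<close> that by (auto simp: steady_pairs_iff[OF assms])
    show ?thesis
    proof (cases "i \<le> K")
      case True
      thus ?thesis
      proof (induction i rule: inc_induct)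
        case base thus ?case by (simp add: z)
      next
        case (step i)
        show ?case
          unfolding sum.atLeast_Suc_lessThan[OF step(2)] step(3)
          using sd[of i] by linarith
      qed
    qed (simp add: z)
  qed
  have Tstep: "?T u v e i = e i + u i + v i + ?T u v e (Suc i)" if "(u, v, e) \<in> excess_data K m n" for u v e i
    using that by (cases "i < K") (auto simp: sum.atLeast_Suc_lessThan excess_data_def)
  show "bij_betw ?f (steady_pairs m n) (excess_data K m n)"
  proof (rule bij_betw_byWitness[where f' = ?g])
    show "\<forall>x\<in>steady_pairs m n. ?g (?f x) = x"
    proof
      fix t assume "t \<in> steady_pairs m n"
      then obtain a b where t: "t = (a, b)" and ab: "(a, b) \<in> steady_pairs m n" by (cases t) auto
      have sd: "max (a (Suc i)) (b (Suc i)) \<le> min (a i) (b i)" for i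
        using ab by (auto simp: steady_pairs_iff[OF assms] steadily_decreasing_def)
      have "min (a i) (b i) - max (a (Suc i)) (b (Suc i)) + (a i - b i) + max (a (Suc i)) (b (Suc i)) = a i"
           "min (a i) (b i) - max (a (Suc i)) (b (Suc i)) + (b i - a i) + max (a (Suc i)) (b (Suc i)) = b i" for i
        using sd[of i] by linarith+
      thus "?g (?f t) = t" unfolding t prod.case T[OF ab] by simp
    qed
    show "\<forall>x\<in>excess_data K m n. ?f (?g x) = x"
    proof
      fix t assume "t \<in> excess_data K m n"
      then obtain u v e where t: "t = (u, v, e)" and x: "(u, v, e) \<in> excess_data K m n" by (cases t) auto
      have uv: "u i = 0 \<or> v i = 0" for i using x by (auto simp: excess_data_def)
      have *: "max (e i + u i + ?T u v e (Suc i)) (e i + v i + ?T u v e (Suc i)) = ?T u v e i" for i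
        unfolding Tstep[OF x, of i] using uv[of i] by auto
      have **: "min (e i + u i + ?T u v e (Suc i)) (e i + v i + ?T u v e (Suc i)) = e i + ?T u v e (Suc i)" for i
        using uv[of i] by auto
      have "u i - v i = u i" "v i - u i = v i" for i using uv[of i] by auto
      thus "?f (?g t) = t" unfolding t prod.case * ** by (auto simp: fun_eq_iff)
    qed
    show "?f ` steady_pairs m n \<subseteq> excess_data K m n"
    proof (rule image_subsetI)
      fix t assume "t \<in> steady_pairs m n"
      then obtain a b where t: "t = (a, b)" and ab: "(a, b) \<in> steady_pairs m n" by (cases t) auto
      have s: "sum a {..<K} = m" "sum b {..<K} = n" and z: "\<forall>i\<ge>K. a i = 0 \<and> b i = 0"
        using ab by (auto simp: steady_pairs_iff[OF assms])
      have "(\<Sum>l<K. Suc l * (min (a l) (b l) - max (a (Suc l)) (b (Suc l)) + (a l - b l) + (b l - a l)))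
          = (\<Sum>i<K. max (a i) (b i))"
        unfolding sum_tails[symmetric] T[OF ab] ..
      moreover have "(\<Sum>i<K. max (a i) (b i)) = (\<Sum>i<K. a i + (b i - a i))"
         "(\<Sum>i<K. max (a i) (b i)) = (\<Sum>i<K. b i + (a i - b i))"
        by (auto intro!: sum.cong)
      ultimately show "?f t \<in> excess_data K m n" unfolding t
        using s z by (simp add: excess_data_def sum.distrib nat_le_linear)
    qed
    show "?g ` excess_data K m n \<subseteq> steady_pairs m n"
    proof (rule image_subsetI)
      fix t assume "t \<in> excess_data K m n"
      then obtain u v e where t: "t = (u, v, e)" and x: "(u, v, e) \<in> excess_data K m n" by (cases t) auto
      have uv: "u i = 0 \<or> v i = 0" for i using x by (auto simp: excess_data_def)
      have sd: "steadily_decreasing (\<lambda>i. e i + u i + ?T u v e (Suc i)) (\<lambda>i. e i + v i + ?T u v e (Suc i))"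
        unfolding steadily_decreasing_def
      proof
        fix i
        show "max (e (Suc i) + u (Suc i) + ?T u v e (Suc (Suc i))) (e (Suc i) + v (Suc i) + ?T u v e (Suc (Suc i)))
          \<le> min (e i + u i + ?T u v e (Suc i)) (e i + v i + ?T u v e (Suc i))"
          using Tstep[OF x, of "Suc i"] by linarith
      qed
      have "(\<Sum>i<K. e i + u i + ?T u v e (Suc i)) + sum v {..<K} = (\<Sum>i<K. ?T u v e i)"
        unfolding sum.distrib[symmetric]
      proof (intro sum.cong refl)
        fix i show "e i + u i + ?T u v e (Suc i) + v i = ?T u v e i" using Tstep[OF x, of i] by linarith
      qed
      moreover have "(\<Sum>i<K. e i + v i + ?T u v e (Suc i)) + sum u {..<K} = (\<Sum>i<K. ?T u v e i)"
        unfolding sum.distrib[symmetric]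
      proof (intro sum.cong refl)
        fix i show "e i + v i + ?T u v e (Suc i) + u i = ?T u v e i" using Tstep[OF x, of i] by linarith
      qed
      ultimately show "?g t \<in> steady_pairs m n" unfolding t
        using x sd unfolding prod.case steady_pairs_iff[OF assms] sum_tails by (auto simp: excess_data_def)
    qed
  qed
qed

text \<open>Here \<open>a l\<close>, \<open>b l\<close>, \<open>f l\<close> count the parts \<open>x^(l+1) y^l\<close>, \<open>x^l y^(l+1)\<close>, \<open>(x y)^(2 l + 2)\<close>. Since the first two multiply to
  \<open>(x y)^(2 l + 1)\<close>, the excess \<open>e (2 l)\<close> can be absorbed into both \<open>a l\<close> and \<open>b l\<close>.\<close>

definition mult_data :: "nat \<Rightarrow> nat \<Rightarrow> nat \<Rightarrow> ((nat \<Rightarrow> nat) \<times> (nat \<Rightarrow> nat) \<times> (nat \<Rightarrow> nat)) set" where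
  "mult_data K m n = {(a, b, f). (\<forall>l\<ge>K. a l = 0 \<and> b l = 0 \<and> f l = 0) \<and>
     (\<Sum>l<K. l * a l + Suc l * b l + 2 * Suc l * f l) = n \<and> sum a {..<K} + n = m + sum b {..<K}}"

lemma sum_even_odd:
  fixes e :: "nat \<Rightarrow> nat"
  assumes "\<forall>i\<ge>K. e i = 0"
  shows "(\<Sum>l<K. Suc l * e l) = (\<Sum>l<K. Suc (2 * l) * e (2 * l) + 2 * Suc l * e (Suc (2 * l)))"
proof -
  \<comment> \<open>Doubling the range adds only zeros and makes the split by parity exact.\<close>
  have "(\<Sum>l<K. Suc l * e l) = (\<Sum>l<2 * K. Suc l * e l)"
    using assms by (intro sum.mono_neutral_left) auto
  also have "\<dots> = (\<Sum>l<K. Suc (2 * l) * e (2 * l) + 2 * Suc l * e (Suc (2 * l)))"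
    by (induction K) auto
  finally show ?thesis .
qed

text \<open>The absorption is reversible because \<open>u l\<close> and \<open>v l\<close> are never
  both positive: the common part \<open>min (a l) (b l)\<close> is exactly \<open>e (2 * l)\<close>,
  and the truncated differences are \<open>u l\<close> and \<open>v l\<close>.\<close>

lemma card_excess_data_mult_data:
  assumes "n < K"
  shows "card (excess_data K m n) = card (mult_data K m n)"
proof (rule bij_betw_same_card)
  let ?f = "\<lambda>(u, v, e). (\<lambda>l. e (2 * l) + u l :: nat, \<lambda>l. e (2 * l) + v l :: nat, \<lambda>l. e (Suc (2 * l)))"
  let ?e = "\<lambda>a b f i. if even i then min (a (i div 2)) (b (i div 2)) else f (i div 2) :: nat"
  let ?g = "\<lambda>(a, b, f). (\<lambda>l. a l - b l :: nat, \<lambda>l. b l - a l :: nat, ?e a b f)"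
  show "bij_betw ?f (excess_data K m n) (mult_data K m n)"
  proof (rule bij_betw_byWitness[where f' = ?g])
    show "\<forall>x\<in>excess_data K m n. ?g (?f x) = x"
    proof
      fix t assume "t \<in> excess_data K m n"
      then obtain u v e where t: "t = (u, v, e)" and x: "(u, v, e) \<in> excess_data K m n" by (cases t) auto
      have uv: "u i = 0 \<or> v i = 0" for i using x by (auto simp: excess_data_def)
      have "min (e i + u (i div 2)) (e i + v (i div 2)) = e i" for i
        using uv[of "i div 2"] by auto
      moreover have "u i - v i = u i" "v i - u i = v i" for i using uv[of i] by auto
      ultimately show "?g (?f t) = t" unfolding t by (auto simp: fun_eq_iff)
    qed
    show "\<forall>x\<in>mult_data K m n. ?f (?g x) = x"
      by (auto simp: fun_eq_iff)
    show "?f ` excess_data K m n \<subseteq> mult_data K m n"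
    proof (rule image_subsetI)
      fix t assume "t \<in> excess_data K m n"
      then obtain u v e where t: "t = (u, v, e)" and x: "(u, v, e) \<in> excess_data K m n" by (cases t) auto
      have z: "\<forall>i\<ge>K. u i = 0 \<and> v i = 0 \<and> e i = 0" and
        w: "(\<Sum>l<K. Suc l * (e l + u l + v l)) = m + sum v {..<K}"
           "(\<Sum>l<K. Suc l * (e l + u l + v l)) = n + sum u {..<K}"
        using x by (auto simp: excess_data_def)
      have "(\<Sum>l<K. Suc l * (e l + u l + v l)) = (\<Sum>l<K. Suc l * e l) + (\<Sum>l<K. Suc l * (u l + v l))"
        by (simp add: sum.distrib[symmetric] algebra_simps)
      also have "(\<Sum>l<K. Suc l * e l) = (\<Sum>l<K. Suc (2 * l) * e (2 * l) + 2 * Suc l * e (Suc (2 * l)))"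
        using z by (intro sum_even_odd) auto
      also have "\<dots> + (\<Sum>l<K. Suc l * (u l + v l)) =
         (\<Sum>l<K. l * (e (2 * l) + u l) + Suc l * (e (2 * l) + v l) + 2 * Suc l * e (Suc (2 * l))) + sum u {..<K}"
        unfolding sum.distrib[symmetric] by (intro sum.cong) (auto simp: algebra_simps)
      finally have *: "(\<Sum>l<K. l * (e (2 * l) + u l) + Suc l * (e (2 * l) + v l) + 2 * Suc l * e (Suc (2 * l))) = n"
        using w by simp
      have "sum (\<lambda>l. e (2 * l) + u l) {..<K} + n = m + sum (\<lambda>l. e (2 * l) + v l) {..<K}"
        using w by (simp add: sum.distrib)
      thus "?f t \<in> mult_data K m n" unfolding t using * z by (auto simp: mult_data_def)
    qed
    show "?g ` mult_data K m n \<subseteq> excess_data K m n"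
    proof (rule image_subsetI)
      fix t assume "t \<in> mult_data K m n"
      then obtain a b f where t: "t = (a, b, f)" and x: "(a, b, f) \<in> mult_data K m n" by (cases t) auto
      have z: "\<forall>l\<ge>K. a l = 0 \<and> b l = 0 \<and> f l = 0" and
        w: "(\<Sum>l<K. l * a l + Suc l * b l + 2 * Suc l * f l) = n"
           "sum a {..<K} + n = m + sum b {..<K}"
        using x by (auto simp: mult_data_def)
      have term_le: "l * a l + Suc l * b l + 2 * Suc l * f l \<le> n" for l
      proof (cases "l < K")
        case True
        thus ?thesis unfolding w(1)[symmetric]
          by (intro member_le_sum[of l "{..<K}" "\<lambda>l. l * a l + Suc l * b l + 2 * Suc l * f l"]) auto
      qed (use z in auto)
      \<comment> \<open>Halving the index only yields vanishing from \<open>2 * K\<close> on. Below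
        that the weight decides: a positive entry at \<open>i\<close> uses up weight at least
        \<open>i + 1\<close>, and \<open>n < K\<close>.\<close>
      have e0: "?e a b f i = 0" if "i \<ge> K" for i
      proof (rule ccontr)
        assume *: "?e a b f i \<noteq> 0"
        let ?l = "i div 2"
        show False
        proof (cases "even i")
          case True
          hence "a ?l \<ge> 1" "b ?l \<ge> 1" using * by auto
          hence "?l * 1 + Suc ?l * 1 \<le> ?l * a ?l + Suc ?l * b ?l"
            by (intro add_mono mult_le_mono) simp_all
          also have "\<dots> \<le> n" by (rule order.trans[OF le_add1 term_le])
          finally have "?l + Suc ?l \<le> n" by simp
          thus False using that assms True by (auto elim!: evenE)
        next
          case False
          hence "f ?l \<ge> 1" using * by auto
          hence "2 * Suc ?l * 1 \<le> 2 * Suc ?l * f ?l" by (intro mult_le_mono) simp_all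
          also have "\<dots> \<le> n" by (rule order.trans[OF le_add2 term_le])
          finally have "2 * Suc ?l \<le> n" by simp
          thus False using that assms False by (auto elim!: oddE)
        qed
      qed
      have "(\<Sum>l<K. Suc l * (?e a b f l + (a l - b l) + (b l - a l))) =
            (\<Sum>l<K. Suc l * ?e a b f l) + (\<Sum>l<K. Suc l * ((a l - b l) + (b l - a l)))"
        unfolding sum.distrib[symmetric] by (intro sum.cong refl) (simp add: algebra_simps)
      also have "(\<Sum>l<K. Suc l * ?e a b f l) =
          (\<Sum>l<K. Suc (2 * l) * ?e a b f (2 * l) + 2 * Suc l * ?e a b f (Suc (2 * l)))"
        using e0 by (intro sum_even_odd) blast
      also have "\<dots> = (\<Sum>l<K. Suc (2 * l) * min (a l) (b l) + 2 * Suc l * f l)"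
        by simp
      finally have *: "(\<Sum>l<K. Suc l * (?e a b f l + (a l - b l) + (b l - a l))) =
          (\<Sum>l<K. Suc (2 * l) * min (a l) (b l) + 2 * Suc l * f l + Suc l * ((a l - b l) + (b l - a l)))"
        by (simp only: sum.distrib[symmetric])
      also have "\<dots> = (\<Sum>l<K. l * a l + Suc l * b l + 2 * Suc l * f l) + sum (\<lambda>l. a l - b l) {..<K}"
        unfolding sum.distrib[symmetric]
      proof (intro sum.cong refl)
        fix l
        obtain d where "a l = b l + d \<or> b l = a l + d" by (metis le_Suc_ex nat_le_linear)
        thus "Suc (2 * l) * min (a l) (b l) + 2 * Suc l * f l + Suc l * ((a l - b l) + (b l - a l))
            = l * a l + Suc l * b l + 2 * Suc l * f l + (a l - b l)"
          by (auto simp: algebra_simps)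
      qed
      finally have s1: "(\<Sum>l<K. Suc l * (?e a b f l + (a l - b l) + (b l - a l))) = n + sum (\<lambda>l. a l - b l) {..<K}"
        using w by simp
      have "sum (\<lambda>l. a l - b l) {..<K} + sum b {..<K} = sum (\<lambda>l. b l - a l) {..<K} + sum a {..<K}"
        unfolding sum.distrib[symmetric] by (intro sum.cong) auto
      hence s2: "n + sum (\<lambda>l. a l - b l) {..<K} = m + sum (\<lambda>l. b l - a l) {..<K}" using w by linarith
      show "?g t \<in> excess_data K m n" unfolding t
        using z e0 s1 s2 by (auto simp: excess_data_def)
    qed
  qed
qed

text \<open>The objects counted by \<open>Q\<close>: partitions of \<open>n\<close> into parts of
  two colours of any size and a third colour of even size, given by their multiplicities, with
  \<open>K\<close> available sizes per colour.\<close>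

definition triples :: "nat \<Rightarrow> nat \<Rightarrow> ((nat \<Rightarrow> nat) \<times> (nat \<Rightarrow> nat) \<times> (nat \<Rightarrow> nat)) set" where
  "triples K n = {(a, b, f). (\<forall>l\<ge>K. a l = 0 \<and> b l = 0 \<and> f l = 0) \<and>
     (\<Sum>l<K. Suc l * (a l + b l + 2 * f l)) = n}"

lemma triples_eq_0:
  assumes "(a, b, f) \<in> triples K n" "l \<ge> n"
  shows "a l = 0 \<and> b l = 0 \<and> f l = 0"
proof (cases "l < K")
  case True
  have "Suc l * (a l + b l + 2 * f l) \<le> n"
    using assms True member_le_sum[of l "{..<K}" "\<lambda>l. Suc l * (a l + b l + 2 * f l)"] by (auto simp: triples_def)
  thus ?thesis using assms(2) by (cases "a l + b l + 2 * f l") auto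
qed (use assms in \<open>auto simp: triples_def\<close>)

lemma triples_cong:
  assumes "n \<le> K"
  shows "triples K n = triples n n"
proof -
  have s: "(\<Sum>l<K. Suc l * (a l + b l + 2 * f l)) = (\<Sum>l<n. Suc l * (a l + b l + 2 * f l))"
    if "\<forall>l\<ge>n. a l = 0 \<and> b l = 0 \<and> f l = 0" for a b f :: "nat \<Rightarrow> nat"
    using that assms by (intro sum.mono_neutral_right) auto
  have "(a, b, f) \<in> triples K n \<longleftrightarrow> (a, b, f) \<in> triples n n" for a b f
  proof (cases "\<forall>l\<ge>n. a l = 0 \<and> b l = 0 \<and> f l = 0")
    case True
    hence "\<forall>l\<ge>K. a l = 0 \<and> b l = 0 \<and> f l = 0" using assms order.trans by blast
    thus ?thesis unfolding triples_def mem_Collect_eq prod.case s[OF True] using True by blast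
  next
    case False
    thus ?thesis using triples_eq_0[of a b f] by blast
  qed
  thus ?thesis by auto
qed

lemma finite_triples: "finite (triples K n)"
proof -
  define G where "G = {f :: nat \<Rightarrow> nat. \<forall>i. (i \<in> {..<K} \<longrightarrow> f i \<in> {..n}) \<and> (i \<notin> {..<K} \<longrightarrow> f i = 0)}"
  have "triples K n \<subseteq> G \<times> G \<times> G"
  proof
    fix t assume "t \<in> triples K n"
    then obtain a b f where t: "t = (a, b, f)" and x: "(a, b, f) \<in> triples K n" by (cases t) auto
    have "a l + b l + 2 * f l \<le> n" if "l < K" for l
    proof -
      have "a l + b l + 2 * f l \<le> Suc l * (a l + b l + 2 * f l)" by simp
      also have "\<dots> \<le> n"
        using x that member_le_sum[of l "{..<K}" "\<lambda>l. Suc l * (a l + b l + 2 * f l)"]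
        by (auto simp: triples_def)
      finally show ?thesis .
    qed
    hence "a l \<le> n \<and> b l \<le> n \<and> f l \<le> n" if "l < K" for l
      using that by (metis add_leD1 add_leD2 mult_2)
    thus "t \<in> G \<times> G \<times> G" using x by (auto simp: t G_def triples_def)
  qed
  thus ?thesis unfolding G_def
    by (rule finite_subset) (intro finite_cartesian_product finite_set_of_finite_funs; simp)
qed

text \<open>Dropping \<open>a 0\<close> (which has weight \<open>0\<close> in \<open>n\<close>) from multiplicity data leaves a triple; \<open>a 0 \<ge> 0\<close> becomes the bound \<open>d\<close>.\<close>

definition lower_triples :: "nat \<Rightarrow> nat \<Rightarrow> int \<Rightarrow> ((nat \<Rightarrow> nat) \<times> (nat \<Rightarrow> nat) \<times> (nat \<Rightarrow> nat)) set" where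
  "lower_triples K n d = {(a, b, f) \<in> triples K n. int (sum a {..<K}) - int (sum b {..<K}) \<le> d}"

lemma finite_lower_triples: "finite (lower_triples K n d)"
  by (rule finite_subset[OF _ finite_triples[of K n]]) (auto simp: lower_triples_def)

lemma sum_weights_cong:
  fixes a a' b f :: "nat \<Rightarrow> nat"
  assumes "(\<Sum>l<K. l * a l) = (\<Sum>l<K. Suc l * a' l)"
  shows "(\<Sum>l<K. l * a l + Suc l * b l + 2 * Suc l * f l) = (\<Sum>l<K. Suc l * (a' l + b l + 2 * f l))"
proof -
  have "(\<Sum>l<K. Suc l * (a' l + b l + 2 * f l)) = (\<Sum>l<K. Suc l * a' l + Suc l * b l + 2 * Suc l * f l)"
    by (intro sum.cong refl) (simp add: algebra_simps)
  thus ?thesis unfolding sum.distrib assms by simp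
qed

lemma card_mult_data_lower_triples:
  assumes "n < K"
  shows "card (mult_data K m n) = card (lower_triples K n (int m - int n))"
proof (rule bij_betw_same_card)
  let ?f = "\<lambda>(a, b, f). (\<lambda>l. a (Suc l) :: nat, b :: nat \<Rightarrow> nat, f :: nat \<Rightarrow> nat)"
  let ?g = "\<lambda>(a, b, f). (case_nat (m + sum b {..<K} - n - sum a {..<K}) a, b, f)"
  obtain K' where K': "K = Suc K'" using assms by (cases K) auto
  show "bij_betw ?f (mult_data K m n) (lower_triples K n (int m - int n))"
  proof (rule bij_betw_byWitness[where f' = ?g])
    have shift: "sum a {..<K} = a 0 + sum (\<lambda>l. a (Suc l)) {..<K}"
      if "(a, b, f) \<in> mult_data K m n" for a b f
    proof -
      have "a K = 0" using that by (auto simp: mult_data_def)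
      hence "sum a {..<K} = sum a {..<Suc K}" by simp
      also have "\<dots> = a 0 + sum (\<lambda>l. a (Suc l)) {..<K}" by (rule sum.lessThan_Suc_shift)
      finally show ?thesis .
    qed
    show "\<forall>x\<in>mult_data K m n. ?g (?f x) = x"
    proof
      fix t assume "t \<in> mult_data K m n"
      then obtain a b f where t: "t = (a, b, f)" and x: "(a, b, f) \<in> mult_data K m n" by (cases t) auto
      have "m + sum b {..<K} - n - sum (\<lambda>l. a (Suc l)) {..<K} = a 0"
        using shift[OF x] x by (auto simp: mult_data_def)
      thus "?g (?f t) = t" unfolding t by (auto simp: fun_eq_iff split: nat.splits)
    qed
    show "\<forall>x\<in>lower_triples K n (int m - int n). ?f (?g x) = x" by auto
    show "?f ` mult_data K m n \<subseteq> lower_triples K n (int m - int n)"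
    proof (rule image_subsetI)
      fix t assume "t \<in> mult_data K m n"
      then obtain a b f where t: "t = (a, b, f)" and x: "(a, b, f) \<in> mult_data K m n" by (cases t) auto
      have "a K = 0" using x by (auto simp: mult_data_def)
      hence "(\<Sum>l<K. l * a l) = (\<Sum>l<Suc K. l * a l)" by simp
      also have "\<dots> = (\<Sum>l<K. Suc l * a (Suc l))" by (subst sum.lessThan_Suc_shift) simp
      finally have "(\<Sum>l<K. l * a l + Suc l * b l + 2 * Suc l * f l) =
          (\<Sum>l<K. Suc l * (a (Suc l) + b l + 2 * f l))"
        by (rule sum_weights_cong)
      moreover have z: "\<forall>l\<ge>K. a l = 0 \<and> b l = 0 \<and> f l = 0" and
        w: "(\<Sum>l<K. l * a l + Suc l * b l + 2 * Suc l * f l) = n" "sum a {..<K} + n = m + sum b {..<K}"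
        using x unfolding mult_data_def mem_Collect_eq prod.case by blast+
      moreover have "int (sum (\<lambda>l. a (Suc l)) {..<K}) - int (sum b {..<K}) \<le> int m - int n"
        using w(2) shift[OF x] by linarith
      moreover have "\<forall>l\<ge>K. a (Suc l) = 0 \<and> b l = 0 \<and> f l = 0"
        using z le_SucI by blast
      ultimately show "?f t \<in> lower_triples K n (int m - int n)"
        unfolding t prod.case lower_triples_def triples_def mem_Collect_eq by metis
    qed
    show "?g ` lower_triples K n (int m - int n) \<subseteq> mult_data K m n"
    proof (rule image_subsetI)
      fix t assume "t \<in> lower_triples K n (int m - int n)"
      then obtain a b f where t: "t = (a, b, f)" and x: "(a, b, f) \<in> lower_triples K n (int m - int n)" by (cases t) auto
      hence tr: "(a, b, f) \<in> triples K n" by (auto simp: lower_triples_def)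
      have d: "int (sum a {..<K}) - int (sum b {..<K}) \<le> int m - int n"
        using x unfolding lower_triples_def by blast
      have z: "a l = 0" if "l \<ge> n" for l using triples_eq_0[OF tr that] by simp
      define c where "c = m + sum b {..<K} - n - sum a {..<K}"
      let ?a = "case_nat c a"
      \<comment> \<open>Prepending the recovered multiplicity moves \<open>a\<close> up by one
        place, so its last slot has to be empty; it is, since \<open>n \<le> K'\<close>.\<close>
      have "a K' = 0" using z[of K'] assms by (simp add: K')
      hence "sum a {..<K} = sum a {..<K'}" by (simp add: K')
      moreover have "sum ?a {..<K} = c + sum a {..<K'}"
        by (simp only: K' sum.lessThan_Suc_shift nat.case)
      ultimately have s: "sum ?a {..<K} + n = m + sum b {..<K}"
        using d by (simp only: c_def)
      have "(\<Sum>l<K. l * ?a l) = (\<Sum>l<K'. Suc l * a l)"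
        by (simp only: K' sum.lessThan_Suc_shift nat.case mult_0 add_0)
      also have "\<dots> = (\<Sum>l<K. Suc l * a l)"
        using \<open>a K' = 0\<close> by (simp only: K' sum.lessThan_Suc mult_0_right add_0_right)
      finally have "(\<Sum>l<K. l * ?a l + Suc l * b l + 2 * Suc l * f l) = (\<Sum>l<K. Suc l * (a l + b l + 2 * f l))"
        by (rule sum_weights_cong)
      hence w: "(\<Sum>l<K. l * ?a l + Suc l * b l + 2 * Suc l * f l) = n"
        using tr by (simp only: triples_def mem_Collect_eq prod.case)
      have "(?a, b, f) \<in> mult_data K m n"
        unfolding mult_data_def mem_Collect_eq prod.case
      proof (intro conjI allI impI)
        fix l assume l: "K \<le> l"
        show "?a l = 0" using z[of "l - 1"] assms l by (cases l) simp_all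
        show "b l = 0" "f l = 0" using tr l unfolding triples_def by blast+
      qed (rule w s)+
      thus "?g t \<in> mult_data K m n" unfolding t prod.case c_def .
    qed
  qed
qed

lemma num_steady_pairs_eq:
  assumes "n < K"
  shows "num_steady_pairs m n = card (lower_triples K n (int m - int n))"
  unfolding num_steady_pairs_def
  using card_steady_pairs_excess_data[OF assms] card_excess_data_mult_data[OF assms]
    card_mult_data_lower_triples[OF assms] by simp

lemma num_steady_pairs_commute: "num_steady_pairs m n = num_steady_pairs n m"
  unfolding num_steady_pairs_def
  by (rule bij_betw_same_card[of prod.swap], rule bij_betw_byWitness[where f' = prod.swap])
     (auto simp: steady_pairs_def steadily_decreasing_def min.commute max.commute)

section \<open>The reflection recurrence for the number of steady pairs\<close>

definition num_triples :: "nat \<Rightarrow> nat" where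
  "num_triples n = card (triples n n)"

lemma num_steady_pairs_mono:
  assumes "k \<le> k'"
  shows "num_steady_pairs (n + k) n \<le> num_steady_pairs (n + k') n"
  unfolding num_steady_pairs_eq[OF lessI]
  using assms by (intro card_mono finite_lower_triples) (auto simp: lower_triples_def)

lemma num_steady_pairs_le: "num_steady_pairs (n + k) n \<le> num_triples n"
  unfolding num_steady_pairs_eq[OF lessI] num_triples_def triples_cong[of n "Suc n", OF le_SucI[OF order.refl], symmetric]
  by (intro card_mono finite_triples) (auto simp: lower_triples_def)

text \<open>By the symmetry of the pair, the second count is a \<open>lower_triples\<close> count
  for the same \<open>n\<close> with bound \<open>-(k + 1)\<close>. Exchanging the colours
  \<open>a\<close> and \<open>b\<close> turns this bound into a difference of at least
  \<open>k + 1\<close>, the exact complement of the bound \<open>k\<close> in the first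
  count.\<close>

lemma num_steady_pairs_recurrence:
  assumes "k < n"
  shows "num_steady_pairs (n + k) n + num_steady_pairs n (n - Suc k) = num_triples n"
proof -
  let ?K = "Suc n"
  define X where "X = {(a, b, f) \<in> triples ?K n. int (sum a {..<?K}) - int (sum b {..<?K}) \<ge> int (Suc k)}"
  have "num_steady_pairs n (n - Suc k) = num_steady_pairs (n - Suc k) n"
    by (rule num_steady_pairs_commute)
  also have "\<dots> = card (lower_triples ?K n (int (n - Suc k) - int n))"
    by (rule num_steady_pairs_eq) simp
  also have "int (n - Suc k) - int n = - int (Suc k)" using assms by simp
  also have "card (lower_triples ?K n (- int (Suc k))) = card X"
  proof (rule bij_betw_same_card)
    let ?s = "\<lambda>(a :: nat \<Rightarrow> nat, b :: nat \<Rightarrow> nat, f :: nat \<Rightarrow> nat). (b, a, f)"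
    show "bij_betw ?s (lower_triples ?K n (- int (Suc k))) X"
      by (rule bij_betw_byWitness[where f' = ?s])
         (auto simp: X_def lower_triples_def triples_def add.commute add.left_commute)
  qed
  finally have 1: "num_steady_pairs n (n - Suc k) = card X" .
  have 2: "num_steady_pairs (n + k) n = card (lower_triples ?K n (int k))"
    by (subst num_steady_pairs_eq[OF lessI]) simp
  have un: "lower_triples ?K n (int k) \<union> X = triples ?K n" and disj: "lower_triples ?K n (int k) \<inter> X = {}"
    by (auto simp: lower_triples_def X_def)
  have fin: "finite (lower_triples ?K n (int k))" "finite X"
    using un finite_triples[of ?K n] by (auto intro: finite_subset)
  show ?thesis
    unfolding 1 2 num_triples_def card_Un_disjoint[OF fin disj, symmetric] un
    by (simp add: triples_cong[of n ?K])
qed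

section \<open>Generating function and Cauchy integral\<close>

lemma has_sum_times:
  fixes f :: "'a \<Rightarrow> complex" and g :: "'b \<Rightarrow> complex"
  assumes "(f has_sum S) A" "(\<lambda>x. norm (f x)) summable_on A" "(g has_sum T) B" "(\<lambda>x. norm (g x)) summable_on B"
  shows "((\<lambda>(x, y). f x * g y) has_sum S * T) (A \<times> B)" "(\<lambda>x. norm (case x of (x, y) \<Rightarrow> f x * g y)) summable_on (A \<times> B)"
proof -
  show *: "(\<lambda>x. norm (case x of (x, y) \<Rightarrow> f x * g y)) summable_on (A \<times> B)"
    unfolding Infinite_Sum.abs_summable_on_Sigma_iff
    using assms(2,4) by (auto simp: norm_mult abs_mult infsum_cmult_right intro!: summable_on_cmult_right summable_on_cmult_left)
  show "((\<lambda>(x, y). f x * g y) has_sum S * T) (A \<times> B)"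
    by (rule has_sum_SigmaI[where g = "\<lambda>x. f x * T"])
       (use assms * in \<open>auto intro!: has_sum_cmult_right has_sum_cmult_left abs_summable_summable\<close>)
qed

definition supported_below :: "nat \<Rightarrow> (nat \<Rightarrow> nat) set" where
  "supported_below J = {a. \<forall>l\<ge>J. a l = 0}"

definition partition_product :: "nat \<Rightarrow> complex \<Rightarrow> complex" where
  "partition_product J z = (\<Prod>j<J. inverse (1 - z ^ Suc j))"

text \<open>Induction on \<open>J\<close>: the multiplicity of the new part \<open>J + 1\<close> is
  an independent coordinate and contributes a geometric series. Absolute summability is carried
  along because the product of two sums requires it.\<close>

lemma has_sum_partition_product:
  fixes z :: complex
  assumes z: "norm z < 1"
  shows "((\<lambda>a. z ^ (\<Sum>l<J. Suc l * a l)) has_sum partition_product J z) (supported_below J)"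
    and "(\<lambda>a. norm (z ^ (\<Sum>l<J. Suc l * a l))) summable_on supported_below J"
proof (induction J)
  case 0
  have eq: "supported_below 0 = {\<lambda>_. 0}" by (auto simp: supported_below_def)
  case 1 show ?case unfolding eq by (intro has_sum_finiteI) (auto simp: partition_product_def)
  case 2 show ?case unfolding eq by simp
next
  case (Suc J)
  have zz: "norm (z ^ Suc J) < 1" using power_less_one_iff[of "norm z" "Suc J"] z by (simp only: norm_power norm_ge_zero simp_thms zero_less_Suc)
  have geo: "(\<lambda>k. norm ((z ^ Suc J) ^ k)) summable_on UNIV" "((\<lambda>k. (z ^ Suc J) ^ k) has_sum inverse (1 - z ^ Suc J)) UNIV"
  proof -
    have "summable (\<lambda>k. norm ((z ^ Suc J) ^ k))" using zz by (subst norm_power) (intro summable_geometric, simp only: real_norm_def abs_norm_cancel)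
    thus "((\<lambda>k. (z ^ Suc J) ^ k) has_sum inverse (1 - z ^ Suc J)) UNIV"
      using geometric_sums[OF zz] by (intro norm_summable_imp_has_sum) (simp_all add: field_simps)
    show "(\<lambda>k. norm ((z ^ Suc J) ^ k)) summable_on UNIV"
      by (rule norm_summable_imp_summable_on) (use \<open>summable _\<close> in simp)
  qed
  let ?h = "\<lambda>(a :: nat \<Rightarrow> nat, k :: nat). a(J := k)"
  have bij: "bij_betw ?h (supported_below J \<times> UNIV) (supported_below (Suc J))"
    by (rule bij_betw_byWitness[where f' = "\<lambda>a. (a(J := 0), a J)"])
       (auto simp: supported_below_def fun_eq_iff)
  have eq: "z ^ (\<Sum>l<Suc J. Suc l * (?h x) l) = (\<lambda>(a, k). z ^ (\<Sum>l<J. Suc l * a l) * (z ^ Suc J) ^ k) x" for x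
    by (cases x) (simp add: power_add power_mult del: power_Suc mult_Suc)
  note prod = has_sum_times[OF Suc geo(2,1)]
  case 1
  show ?case
    unfolding has_sum_reindex_bij_betw[OF bij, symmetric] eq using prod(1) by (simp add: partition_product_def)
  case 2
  show ?case
    unfolding summable_on_reindex_bij_betw[OF bij, symmetric] eq using prod(2) by simp
qed

lemma sums_card_triples:
  fixes z :: complex
  assumes z: "norm z < 1"
  shows "(\<lambda>n. of_nat (card (triples J n)) * z ^ n) sums (partition_product J z ^ 2 * partition_product J (z\<^sup>2))"
    and "summable (\<lambda>n. norm (of_nat (card (triples J n)) * z ^ n))"
proof -
  have z2: "norm (z\<^sup>2) < 1" using z by (simp add: norm_power power_less_one_iff abs_square_less_1)
  let ?T = "supported_below J \<times> (supported_below J \<times> supported_below J)"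
  let ?w = "\<lambda>a. \<Sum>l<J. Suc l * a l"
  note h1 = has_sum_partition_product[OF z, of J]
  note h2 = has_sum_partition_product[OF z2, of J]
  note hs = has_sum_times[OF h1 has_sum_times[OF h1 h2]]
  have eq: "(\<lambda>(a, y). z ^ ?w a * (case y of (b, f) \<Rightarrow> z ^ ?w b * (z\<^sup>2) ^ ?w f)) t = (\<lambda>(a, b, f). z ^ (\<Sum>l<J. Suc l * (a l + b l + 2 * f l))) t" for t
  proof (cases t)
    case (fields a b f)
    have "(\<Sum>l<J. Suc l * (a l + b l + 2 * f l)) = ?w a + ?w b + 2 * ?w f"
      by (simp only: sum.distrib[symmetric] sum_distrib_left) (intro sum.cong refl, simp add: algebra_simps)
    thus ?thesis by (simp only: fields prod.case power_add power_mult mult.assoc)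
  qed
  \<comment> \<open>The weight is a function of the triple, so all triples form the disjoint union
    of the sets \<open>triples J n\<close>.\<close>
  have bij: "bij_betw snd (Sigma UNIV (triples J)) ?T"
    by (rule bij_betw_byWitness[where f' = "\<lambda>(a, b, f). (\<Sum>l<J. Suc l * (a l + b l + 2 * f l), (a, b, f))"])
       (auto simp: triples_def supported_below_def)
  have *: "(\<lambda>(a, b, f). z ^ (\<Sum>l<J. Suc l * (a l + b l + 2 * f l))) (snd x) = z ^ fst x" if "x \<in> Sigma UNIV (triples J)" for x
    using that by (auto simp: triples_def)
  have A: "((\<lambda>x. z ^ fst x) has_sum (partition_product J z * (partition_product J z * partition_product J (z\<^sup>2)))) (Sigma UNIV (triples J))"
    using hs(1) unfolding eq has_sum_reindex_bij_betw[OF bij, symmetric] by (simp only: * cong: has_sum_cong)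
  have B: "(\<lambda>x. norm (z ^ fst x)) summable_on (Sigma UNIV (triples J))"
    using hs(2) unfolding eq summable_on_reindex_bij_betw[OF bij, symmetric] by (simp only: * cong: summable_on_cong)
  have "((\<lambda>n. of_nat (card (triples J n)) * z ^ n) has_sum (partition_product J z * (partition_product J z * partition_product J (z\<^sup>2)))) UNIV"
    by (rule has_sum_SigmaD[OF A]) (auto intro!: has_sum_finiteI finite_triples)
  thus "(\<lambda>n. of_nat (card (triples J n)) * z ^ n) sums (partition_product J z ^ 2 * partition_product J (z\<^sup>2))"
    by (auto dest!: has_sum_imp_sums simp: power2_eq_square mult.assoc)
  have "(\<lambda>n. norm (infsum (\<lambda>t. norm (z ^ fst (n, t))) (triples J n))) summable_on UNIV"
    using B unfolding Infinite_Sum.abs_summable_on_Sigma_iff by blast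
  hence "(\<lambda>n. norm (of_nat (card (triples J n)) * z ^ n)) summable_on UNIV"
    by (simp add: finite_triples norm_mult norm_power)
  thus "summable (\<lambda>n. norm (of_nat (card (triples J n)) * z ^ n))"
    by (rule summable_on_imp_summable)
qed

lemma integral_exp_circle:
  fixes m :: int
  shows "(\<integral>\<theta>. indicator {-pi..pi} \<theta> *\<^sub>R exp (\<i> * of_int m * of_real \<theta>) \<partial>lborel) = (if m = 0 then 2 * of_real pi else 0)"
proof (cases "m = 0")
  case True
  thus ?thesis by (simp add: scaleR_conv_of_real)
next
  case False
  let ?F = "\<lambda>\<theta>::real. exp (\<i> * of_int m * of_real \<theta>) / (\<i> * of_int m)"
  have "(\<integral>\<theta>. indicator {-pi..pi} \<theta> *\<^sub>R exp (\<i> * of_int m * of_real \<theta>) \<partial>lborel) = ?F pi - ?F (-pi)"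
  proof (rule integral_FTC_Icc)
    fix x :: real
    have "((\<lambda>z. exp (\<i> * of_int m * z) / (\<i> * of_int m)) has_field_derivative exp (\<i> * of_int m * of_real x)) (at (of_real x))"
      using False by (auto intro!: derivative_eq_intros)
    thus "(?F has_vector_derivative exp (\<i> * of_int m * of_real x)) (at x within {-pi..pi})"
      by (rule has_vector_derivative_real_field)
  qed (auto intro!: continuous_intros)
  also have "exp (\<i> * of_int m * of_real (-pi)) = exp (\<i> * of_int m * of_real pi)"
    unfolding exp_eq by (intro exI[of _ "- m"]) (simp add: algebra_simps)
  finally show ?thesis using False by simp
qed

text \<open>Cauchy's coefficient formula. The coefficients times \<open>r^k\<close> are absolutely
  summable for \<open>r < 1\<close>, which permits integration term by term; orthogonality leaves
  the term \<open>k = n\<close>.\<close>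

lemma integral_card_triples:
  assumes r: "0 < r" "r < 1"
  defines "w \<equiv> \<lambda>\<theta>. of_real r * exp (\<i> * of_real \<theta>)"
  shows "(\<integral>\<theta>. indicator {-pi..pi} \<theta> *\<^sub>R (partition_product J (w \<theta>) ^ 2 * partition_product J ((w \<theta>)\<^sup>2) * exp (- (\<i> * of_nat n * of_real \<theta>))) \<partial>lborel)
      = 2 * of_real pi * of_nat (card (triples J n)) * of_real (r ^ n)"
proof -
  let ?F = "\<lambda>\<theta>. partition_product J (w \<theta>) ^ 2 * partition_product J ((w \<theta>)\<^sup>2)"
  let ?e = "\<lambda>\<theta>. exp (- (\<i> * of_nat n * of_real \<theta>)) :: complex"
  define c where "c = (\<lambda>k. of_nat (card (triples J k)) * complex_of_real (r ^ k))"
  define f where "f = (\<lambda>k \<theta>. indicator {-pi..pi} \<theta> *\<^sub>R (c k * exp (\<i> * of_int (int k - int n) * of_real \<theta>)))"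
  have norm_w: "norm (w \<theta>) = r" for \<theta> using r by (simp add: w_def norm_mult)
  have sum_c: "summable (\<lambda>k. norm (c k))"
    using sums_card_triples(2)[of "of_real r" J] r by (simp add: c_def)
  have int_exp: "integrable lborel (\<lambda>\<theta>. indicator {-pi..pi} \<theta> *\<^sub>R exp (\<i> * of_int m * of_real \<theta>) :: complex)" for m
    by (rule borel_integrable_compact) (auto intro!: continuous_intros)
  have f_alt: "f k = (\<lambda>\<theta>. c k * (indicator {-pi..pi} \<theta> *\<^sub>R exp (\<i> * of_int (int k - int n) * of_real \<theta>)))" for k
    by (simp add: f_def fun_eq_iff)
  have int_f: "integrable lborel (f k)" for k
    unfolding f_alt by (intro integrable_mult_right int_exp)
  have norm_f: "norm (f k \<theta>) = indicator {-pi..pi} \<theta> * norm (c k)" for k \<theta>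
    by (simp add: f_def norm_mult)
  have int_norm_f: "(\<integral>\<theta>. norm (f k \<theta>) \<partial>lborel) = 2 * pi * norm (c k)" for k
    unfolding norm_f by simp
  have "(\<lambda>k. \<integral>\<theta>. f k \<theta> \<partial>lborel) sums (\<integral>\<theta>. (\<Sum>k. f k \<theta>) \<partial>lborel)"
  proof (rule sums_integral[OF int_f])
    show "AE \<theta> in lborel. summable (\<lambda>k. norm (f k \<theta>))"
      unfolding norm_f by (intro AE_I2 summable_mult sum_c)
    show "summable (\<lambda>k. \<integral>\<theta>. norm (f k \<theta>) \<partial>lborel)"
      unfolding int_norm_f by (intro summable_mult sum_c)
  qed
  moreover have "(\<integral>\<theta>. f k \<theta> \<partial>lborel) = (if k = n then 2 * of_real pi * c n else 0)" for k
    unfolding f_alt integral_mult_right_zero integral_exp_circle by auto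
  hence "(\<lambda>k. \<integral>\<theta>. f k \<theta> \<partial>lborel) sums (2 * of_real pi * c n)"
    using sums_single[of n "\<lambda>k. 2 * of_real pi * c n"] by (simp add: eq_commute)
  ultimately have "(\<integral>\<theta>. (\<Sum>k. f k \<theta>) \<partial>lborel) = 2 * of_real pi * c n"
    using sums_unique2 by blast
  moreover have "(\<Sum>k. f k \<theta>) = indicator {-pi..pi} \<theta> *\<^sub>R (?F \<theta> * ?e \<theta>)" for \<theta>
  proof -
    have "(\<lambda>k. of_nat (card (triples J k)) * w \<theta> ^ k) sums (?F \<theta>)"
      by (rule sums_card_triples) (use norm_w r in auto)
    hence "(\<lambda>k. indicator {-pi..pi} \<theta> *\<^sub>R (of_nat (card (triples J k)) * w \<theta> ^ k * ?e \<theta>)) sums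
       (indicator {-pi..pi} \<theta> *\<^sub>R (?F \<theta> * ?e \<theta>))"
      by (intro sums_scaleR_right sums_mult2)
    moreover have "of_nat (card (triples J k)) * w \<theta> ^ k * ?e \<theta> = c k * exp (\<i> * of_int (int k - int n) * of_real \<theta>)" for k
      by (simp add: w_def c_def power_mult_distrib exp_of_nat_mult[symmetric] mult_exp_exp algebra_simps)
    ultimately show ?thesis by (simp add: f_def sums_iff)
  qed
  ultimately show ?thesis by (simp add: c_def)
qed

section \<open>The logarithm of the partition product\<close>

text \<open>The term of index \<open>k\<close> is the sum over \<open>j\<close> of the \<open>(k+1)\<close>-st terms in the series of \<open>- Ln (1 - exp (- j t))\<close>.\<close>

definition partition_log :: "complex \<Rightarrow> complex" where
  "partition_log t = (\<Sum>k. 1 / (of_nat (Suc k) * (exp (of_nat (Suc k) * t) - 1)))"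

text \<open>With \<open>r = exp (- Re t)\<close> and \<open>n = k + 1\<close>, the modulus of
  \<open>exp (n t) - 1\<close> is at least \<open>r^(-n) - 1\<close>, hence at least
  \<open>(1 - r) / r^n\<close>.\<close>

lemma norm_partition_log_term_le:
  assumes "Re t > 0"
  shows "norm (1 / (of_nat (Suc k) * (exp (of_nat (Suc k) * t) - 1))) \<le> exp (- Re t) ^ Suc k / (1 - exp (- Re t))"
proof -
  define r where "r = exp (- Re t)"
  have r: "0 < r" "r < 1" using assms by (auto simp: r_def)
  have rk: "exp (real (Suc k) * Re t) = inverse (r ^ Suc k)"
    unfolding r_def exp_of_nat_mult[symmetric] exp_minus[symmetric] by (simp add: algebra_simps)
  have rk1: "r ^ Suc k \<le> r" using r by (intro power_Suc_le_self) auto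
  have rk0: "r ^ Suc k > 0" using r by simp
  have "inverse (r ^ Suc k) - 1 \<le> norm (exp (of_nat (Suc k) * t)) - norm (1 :: complex)"
    using rk by (simp add: norm_exp_eq_Re)
  also have "\<dots> \<le> norm (exp (of_nat (Suc k) * t) - 1)" by (rule norm_triangle_ineq2)
  also have "\<dots> \<le> real (Suc k) * norm (exp (of_nat (Suc k) * t) - 1)"
    by (simp add: mult_le_cancel_right1)
  finally have *: "inverse (r ^ Suc k) - 1 \<le> norm (of_nat (Suc k) * (exp (of_nat (Suc k) * t) - 1))"
    by (simp only: norm_mult norm_of_nat)
  have "inverse (r ^ Suc k) - 1 = (1 - r ^ Suc k) / r ^ Suc k" using rk0 r by (simp add: diff_divide_distrib inverse_eq_divide del: power_Suc)
  moreover have "(1 - r) / r ^ Suc k \<le> (1 - r ^ Suc k) / r ^ Suc k"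
    using rk1 rk0 by (intro divide_right_mono) auto
  ultimately have "(1 - r) / r ^ Suc k \<le> norm (of_nat (Suc k) * (exp (of_nat (Suc k) * t) - 1))" using * by linarith
  moreover have "(1 - r) / r ^ Suc k > 0" using r by simp
  ultimately have "norm (1 / (of_nat (Suc k) * (exp (of_nat (Suc k) * t) - 1))) \<le> 1 / ((1 - r) / r ^ Suc k)"
    unfolding norm_divide norm_one by (intro divide_left_mono mult_pos_pos) auto
  thus ?thesis by (simp only: r_def[symmetric] divide_divide_eq_right mult_1)
qed

lemma summable_partition_log:
  assumes "Re t > 0"
  shows "summable (\<lambda>k. norm (1 / (of_nat (Suc k) * (exp (of_nat (Suc k) * t) - 1))))"
proof (rule summable_comparison_test')
  show "summable (\<lambda>k. exp (- Re t) ^ Suc k / (1 - exp (- Re t)))"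
    using assms by (intro summable_divide) (simp add: summable_Suc_iff summable_geometric)
  show "norm (norm (1 / (of_nat (Suc k) * (exp (of_nat (Suc k) * t) - 1)))) \<le> exp (- Re t) ^ Suc k / (1 - exp (- Re t))" for k
    using norm_partition_log_term_le[OF assms, of k] by simp
qed

text \<open>For finite \<open>J\<close> the logarithms may be expanded and the sums over
  \<open>j\<close> and \<open>k\<close> exchanged freely; the sum over \<open>j\<close> is then a
  finite geometric sum. Only the exponential of a sum of \<open>Ln\<close> is taken, so no branch
  question arises.\<close>

lemma partition_product_eq_exp:
  assumes w: "norm w < 1"
  shows "partition_product J w = exp (\<Sum>k. w ^ Suc k * (1 - (w ^ Suc k) ^ J) / (1 - w ^ Suc k) / of_nat (Suc k))"
proof -
  have lt: "norm (w ^ Suc j) < 1" for j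
    using w power_less_one_iff[of "norm w" "Suc j"] by (simp only: norm_power norm_ge_zero simp_thms zero_less_Suc)
  have ln: "(\<lambda>k. v ^ Suc k / of_nat (Suc k)) sums - Ln (1 - v)" if "norm v < 1" for v
  proof -
    have "(\<lambda>n. - ((- (- v)) ^ n) / of_nat n) sums ln (1 + (- v))" using that by (intro Ln_series') simp
    hence "(\<lambda>n. v ^ n / of_nat n) sums - Ln (1 - v)" using sums_minus by fastforce
    thus ?thesis by (subst sums_Suc_iff) simp
  qed
  have "(\<lambda>k. \<Sum>j<J. (w ^ Suc j) ^ Suc k / of_nat (Suc k)) sums (\<Sum>j<J. - Ln (1 - w ^ Suc j))"
    by (intro sums_sum ln lt)
  moreover have "(\<Sum>j<J. (w ^ Suc j) ^ Suc k / of_nat (Suc k)) = w ^ Suc k * (1 - (w ^ Suc k) ^ J) / (1 - w ^ Suc k) / of_nat (Suc k)" for k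
  proof -
    have ne: "w ^ Suc k \<noteq> 1" using lt[of k] by auto
    have "(\<Sum>j<J. (w ^ Suc j) ^ Suc k) = (\<Sum>j<J. w ^ Suc k * (w ^ Suc k) ^ j)"
      by (intro sum.cong refl) (simp only: power_mult[symmetric] power_add[symmetric], simp add: algebra_simps)
    also have "\<dots> = w ^ Suc k * (1 - (w ^ Suc k) ^ J) / (1 - w ^ Suc k)"
      using ne by (simp only: sum_distrib_left[symmetric] sum_gp_strict if_False times_divide_eq_right)
    finally show ?thesis by (simp only: sum_divide_distrib[symmetric])
  qed
  ultimately have "(\<Sum>k. w ^ Suc k * (1 - (w ^ Suc k) ^ J) / (1 - w ^ Suc k) / of_nat (Suc k)) = (\<Sum>j<J. - Ln (1 - w ^ Suc j))"
    by (simp only: sums_iff)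
  also have "exp \<dots> = (\<Prod>j<J. exp (- Ln (1 - w ^ Suc j)))" by (rule exp_sum) simp
  also have "\<dots> = partition_product J w"
    unfolding partition_product_def
  proof (intro prod.cong refl)
    fix j
    have "1 - w ^ Suc j \<noteq> 0" using lt[of j] by auto
    thus "exp (- Ln (1 - w ^ Suc j)) = inverse (1 - w ^ Suc j)" by (simp add: exp_minus del: power_Suc)
  qed
  finally show ?thesis ..
qed

lemma partition_product_tendsto:
  assumes t: "Re t > 0"
  shows "(\<lambda>J. partition_product J (exp (- t))) \<longlonglongrightarrow> exp (partition_log t)"
proof -
  define w where "w = exp (- t)"
  let ?b = "\<lambda>k. w ^ Suc k * (1 - 0) / (1 - w ^ Suc k) / of_nat (Suc k)"
  let ?a = "\<lambda>k J. w ^ Suc k * (1 - (w ^ Suc k) ^ J) / (1 - w ^ Suc k) / of_nat (Suc k)"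
  define r where "r = exp (- Re t)"
  have r: "0 < r" "r < 1" using t by (auto simp: r_def)
  have nw: "norm w = r" by (simp add: w_def r_def norm_exp_eq_Re)
  have rk: "r ^ Suc k \<le> r" for k using r by (intro power_Suc_le_self) auto
  have lt: "norm (w ^ Suc k) < 1" for k using rk[of k] r by (simp only: norm_power nw)
  have w0: "w \<noteq> 0" by (simp add: w_def)
  have term_eq: "w ^ Suc k / (1 - w ^ Suc k) / of_nat (Suc k) = 1 / (of_nat (Suc k) * (exp (of_nat (Suc k) * t) - 1))" for k
  proof -
    have "exp (of_nat (Suc k) * t) = inverse (w ^ Suc k)"
      unfolding w_def exp_of_nat_mult[symmetric] exp_minus[symmetric] by (simp add: algebra_simps)
    moreover have "w ^ Suc k \<noteq> 0" using w0 by simp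
    moreover have "w ^ Suc k \<noteq> 1" using lt[of k] by auto
    ultimately show ?thesis by (simp only:) (simp add: field_simps del: power_Suc of_nat_Suc)
  qed
  \<comment> \<open>Tannery's theorem, with the bound 2 for the factor
    \<open>1 - (w ^ Suc k) ^ J\<close>.\<close>
  have "((\<lambda>J. \<Sum>k. ?a k J) \<longlongrightarrow>
     (\<Sum>k. ?b k)) sequentially"
  proof (rule tannerys_theorem[THEN conjunct2, THEN conjunct2])
    show "((\<lambda>J. ?a k J) \<longlongrightarrow>
         ?b k) sequentially" for k
      using lt[of k] by (intro tendsto_intros LIMSEQ_power_zero) (auto simp del: of_nat_Suc power_Suc)
    have "norm (?a k J) \<le> 2 * (r ^ Suc k / (1 - r))" for k J
    proof -
      have "norm ((w ^ Suc k) ^ J) \<le> 1" using lt[of k] by (subst norm_power) (intro power_le_one; simp)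
      hence "norm (1 - (w ^ Suc k) ^ J) \<le> 2" using norm_triangle_ineq4[of 1 "(w ^ Suc k) ^ J"] by simp
      moreover have "norm (w ^ Suc k / (1 - w ^ Suc k) / of_nat (Suc k)) \<le> r ^ Suc k / (1 - r)"
        unfolding term_eq r_def by (rule norm_partition_log_term_le[OF t])
      ultimately have "norm (1 - (w ^ Suc k) ^ J) * norm (w ^ Suc k / (1 - w ^ Suc k) / of_nat (Suc k)) \<le> 2 * (r ^ Suc k / (1 - r))"
        by (intro mult_mono) auto
      thus ?thesis by (simp only: norm_mult[symmetric]) (simp only: times_divide_eq_right mult.commute)
    qed
    thus "\<forall>\<^sub>F (k, J) in sequentially \<times>\<^sub>F sequentially. norm (?a k J) \<le> 2 * (r ^ Suc k / (1 - r))"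
      by (intro always_eventually) auto
    show "summable (\<lambda>k. 2 * (r ^ Suc k / (1 - r)))"
      using r by (intro summable_mult summable_divide) (simp add: summable_Suc_iff summable_geometric)
  qed auto
  hence "(\<lambda>J. exp (\<Sum>k. ?a k J)) \<longlonglongrightarrow>
     exp (\<Sum>k. ?b k)"
    by (rule tendsto_exp)
  moreover have "norm w < 1" using nw r by simp
  ultimately have "(\<lambda>J. partition_product J w) \<longlonglongrightarrow> exp (\<Sum>k. ?b k)"
    by (simp only: partition_product_eq_exp)
  thus ?thesis unfolding partition_log_def w_def[symmetric] by (simp only: diff_zero mult_1_right term_eq)
qed

section \<open>The derivative of 1 / (exp z - 1) - 1 / z\<close>

lemma exp_quotient_le:
  fixes u :: real
  assumes "u > 0"
  shows "exp u / (exp u - 1)\<^sup>2 \<le> 2 / u\<^sup>2"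
proof -
  \<comment> \<open>The quotient is \<open>1 / (4 sinh^2 (u / 2))\<close>, hence even below
    \<open>1 / u^2\<close>; with the factor 2 it suffices to multiply two elementary lower bounds of
    \<open>exp u - 1\<close>.\<close>
  have e1: "exp u - 1 \<ge> u + u\<^sup>2 / 2" using exp_lower_Taylor_quadratic[of u] assms by simp
  have "exp (- u) \<le> 1 / (1 + u)"
    using exp_ge_add_one_self[of u] assms by (simp add: exp_minus field_simps)
  hence "exp u * exp (-u) \<le> exp u * (1 / (1 + u))" by (intro mult_left_mono) auto
  hence "exp u - 1 \<ge> exp u - exp u * (1 / (1 + u)) "
    by (simp add: mult_exp_exp)
  also have "exp u - exp u * (1 / (1 + u)) = exp u * (u / (1 + u))" using assms by (simp add: field_simps)
  finally have e2: "exp u - 1 \<ge> exp u * (u / (1 + u))" .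
  have pos: "u\<^sup>2 > 0" using assms by simp
  have "exp u * (u\<^sup>2 / 2) \<le> exp u * ((u / (1 + u)) * (u + u\<^sup>2 / 2))"
  proof (intro mult_left_mono)
    have "u * (u + u\<^sup>2 / 2) - u\<^sup>2 / 2 * (1 + u) = u\<^sup>2 / 2" by (simp add: field_simps power2_eq_square power3_eq_cube)
    hence "u\<^sup>2 / 2 * (1 + u) \<le> u * (u + u\<^sup>2 / 2)" using pos by linarith
    thus "u\<^sup>2 / 2 \<le> u / (1 + u) * (u + u\<^sup>2 / 2)" using assms by (simp add: field_simps)
  qed auto
  also have "\<dots> = (exp u * (u / (1 + u))) * (u + u\<^sup>2 / 2)" by simp
  also have "\<dots> \<le> (exp u - 1) * (exp u - 1)"
    using e1 e2 assms by (intro mult_mono) auto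
  finally have "exp u * (u\<^sup>2 / 2) \<le> (exp u - 1)\<^sup>2" by (simp add: power2_eq_square)
  moreover have "exp u - 1 > 0" using assms by simp
  ultimately show ?thesis using pos by (simp add: field_simps)
qed

text \<open>With \<open>s = 2 sinh (z / 2)\<close> the second quotient is \<open>1 / s^2\<close>.
  Since \<open>s\<close> is odd in \<open>z\<close>, \<open>s - z\<close> is of third order, so
  \<open>(s - z) (s + z) / (z^2 s^2)\<close> stays bounded: the double poles cancel.\<close>

lemma inverse_square_diff_bound_small:
  fixes z :: complex
  assumes "z \<noteq> 0" "norm z \<le> 1 / 4"
  shows "norm (1 / z\<^sup>2 - exp z / (exp z - 1)\<^sup>2) \<le> 3"
proof -
  define s where "s = exp (z / 2) - exp (- (z / 2))"
  have nz: "norm z > 0" using assms by simp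
  have T: "norm (exp w - (1 + w + w\<^sup>2 / 2)) \<le> norm z ^ 3 / 8" if "norm w = norm z / 2" for w :: complex
  proof -
    have "norm (exp w - (\<Sum>k\<le>2. w ^ k / fact k)) \<le> exp \<bar>Re w\<bar> * norm w ^ Suc 2 / fact 2"
      by (rule Taylor_exp)
    moreover have "(\<Sum>k\<le>2. w ^ k / fact k) = 1 + w + w\<^sup>2 / 2" by (simp add: numeral_2_eq_2)
    moreover have "exp \<bar>Re w\<bar> \<le> 2"
    proof -
      have "\<bar>Re w\<bar> \<le> 1 / 2" using abs_Re_le_cmod[of w] that assms by linarith
      hence "exp \<bar>Re w\<bar> \<le> exp (1 / 2)" by simp
      also have "exp (1 / 2 :: real) \<le> 2" by (rule exp_half_le2)
      finally show ?thesis by simp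
    qed
    hence "exp \<bar>Re w\<bar> * norm w ^ Suc 2 / fact 2 \<le> 2 * norm w ^ Suc 2 / fact 2"
      by (intro divide_right_mono mult_right_mono) auto
    moreover have "2 * norm w ^ Suc 2 / fact 2 = norm z ^ 3 / 8"
      by (simp add: that power3_eq_cube eval_nat_numeral)
    ultimately show ?thesis by simp
  qed
  have "s - z = (exp (z / 2) - (1 + z / 2 + (z / 2)\<^sup>2 / 2)) - (exp (- (z / 2)) - (1 + (- (z / 2)) + (- (z / 2))\<^sup>2 / 2))"
    by (simp add: s_def field_simps)
  also have "norm \<dots> \<le> norm z ^ 3 / 8 + norm z ^ 3 / 8"
    by (rule order.trans[OF norm_triangle_ineq4 add_mono]; rule T) (auto simp: norm_divide)
  finally have sz: "norm (s - z) \<le> norm z ^ 3 / 4" by simp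
  have cube: "norm z ^ 3 / 4 \<le> norm z / 2"
  proof -
    have "norm z ^ 3 \<le> norm z ^ 1" using assms by (intro power_decreasing) auto
    hence "norm z ^ 3 \<le> norm z" by simp
    thus ?thesis using nz by linarith
  qed
  have s_ge: "norm s \<ge> norm z / 2"
    using norm_triangle_ineq2[of z "z - s"] sz cube by (simp add: norm_minus_commute)
  have "norm (s + z) = norm ((s - z) + 2 * z)" by (simp add: add.commute)
  also have "\<dots> \<le> norm (s - z) + norm (2 * z)" by (rule norm_triangle_ineq)
  finally have s_le: "norm (s + z) \<le> 3 * norm z" using sz cube nz unfolding norm_mult norm_numeral by linarith
  have s0: "s \<noteq> 0" using s_ge nz by auto
  have "exp z - 1 = exp (z / 2) * s"
    by (simp add: s_def algebra_simps mult_exp_exp)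
  moreover have "exp z = (exp (z / 2))\<^sup>2" by (simp add: exp_double[symmetric])
  ultimately have E: "exp z / (exp z - 1)\<^sup>2 = 1 / s\<^sup>2" by (simp add: power_mult_distrib)
  have "1 / z\<^sup>2 - exp z / (exp z - 1)\<^sup>2 = (s - z) * (s + z) / (z\<^sup>2 * s\<^sup>2)"
    unfolding E using s0 assms(1) by (simp add: field_simps power2_eq_square)
  hence "norm (1 / z\<^sup>2 - exp z / (exp z - 1)\<^sup>2) = norm (s - z) * norm (s + z) / (norm z ^ 2 * norm s ^ 2)"
    by (simp add: norm_mult norm_divide norm_power)
  also have "\<dots> \<le> (norm z ^ 3 / 4) * (3 * norm z) / (norm z ^ 2 * (norm z / 2) ^ 2)"
    using sz s_le s_ge nz by (intro frac_le mult_mono mult_left_mono power_mono mult_nonneg_nonneg mult_pos_pos) auto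
  also have "\<dots> = 3" using nz by (simp add: field_simps eval_nat_numeral)
  finally show ?thesis .
qed

text \<open>The expression is bounded near 0 and of order \<open>u^(-2)\<close> for large
  \<open>u = Re z\<close>; a single power \<open>u^(-p)\<close> covers both if
  \<open>0 \<le> p \<le> 2\<close>. The later summation over \<open>k\<close> needs
  \<open>p > 1\<close>, and for \<open>u = 1 / M\<close> and \<open>\<theta>\<close> of order
  \<open>M^(-3/2)\<close> the resulting error bound vanishes only if \<open>p < 3 / 2\<close>;
  \<open>5 / 4\<close> is the midpoint.\<close>

lemma inverse_square_diff_bound:
  fixes z :: complex
  assumes "Re z > 0" "\<bar>Im z\<bar> \<le> Re z"
  shows "norm (1 / z\<^sup>2 - exp z / (exp z - 1)\<^sup>2) \<le> 24 * Re z powr (-5/4)"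
proof (cases "norm z \<le> 1 / 4")
  case True
  have "Re z \<le> 1" using True complex_Re_le_cmod[of z] by linarith
  hence "Re z powr 0 \<le> Re z powr (-5/4)" using assms by (intro powr_mono') auto
  moreover have "z \<noteq> 0" using assms by auto
  ultimately show ?thesis using inverse_square_diff_bound_small[OF _ True] assms by fastforce
next
  case False
  define u where "u = Re z"
  have u: "u > 0" using assms by (simp add: u_def)
  \<comment> \<open>In the sector the modulus is at most \<open>2 * Re z\<close>, so
    \<open>norm z > 1 / 4\<close> gives \<open>u \<ge> 1 / 8\<close>; this is the origin of the
    factor 8 in \<open>24 = 3 * 8\<close>.\<close>
  have u8: "u \<ge> 1 / 8" using False cmod_le[of z] assms by (simp add: u_def)
  have "norm (exp z / (exp z - 1)\<^sup>2) = exp u / norm (exp z - 1) ^ 2"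
    by (simp add: norm_divide norm_power norm_exp_eq_Re u_def)
  also have "\<dots> \<le> exp u / (exp u - 1) ^ 2"
  proof (intro divide_left_mono power_mono mult_pos_pos)
    show *: "exp u - 1 \<le> norm (exp z - 1)"
      using norm_triangle_ineq2[of "exp z" 1] by (simp add: norm_exp_eq_Re u_def)
    have "exp u - 1 > 0" using u by simp
    thus "0 < (exp u - 1)\<^sup>2" "0 < (cmod (exp z - 1))\<^sup>2" "0 \<le> exp u - 1" using * by auto
  qed auto
  also have "\<dots> \<le> 2 / u\<^sup>2" by (rule exp_quotient_le[OF u])
  finally have 1: "norm (exp z / (exp z - 1)\<^sup>2) \<le> 2 / u\<^sup>2" .
  have "norm (1 / z\<^sup>2) = 1 / norm z ^ 2" by (simp add: norm_divide norm_power)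
  also have "\<dots> \<le> 1 / u\<^sup>2"
    using complex_Re_le_cmod[of z] u by (intro divide_left_mono power_mono mult_pos_pos) (auto simp: u_def)
  finally have "norm (1 / z\<^sup>2 - exp z / (exp z - 1)\<^sup>2) \<le> 3 / u\<^sup>2"
    using 1 norm_triangle_ineq4[of "1 / z\<^sup>2" "exp z / (exp z - 1)\<^sup>2"] by simp
  also have "3 / u\<^sup>2 = 3 * u powr (-3/4) * u powr (-5/4)"
  proof -
    have "u powr (-3/4) * u powr (-5/4) = u powr (-2)" by (simp add: powr_add[symmetric])
    also have "\<dots> = 1 / u\<^sup>2" using u by (simp add: powr_minus powr_numeral divide_inverse)
    finally show ?thesis by (simp only: mult.assoc)
  qed
  also have "\<dots> \<le> 3 * 8 * u powr (-5/4)"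
  proof (intro mult_right_mono mult_left_mono)
    have "u powr (-3/4) \<le> (1/8) powr (-3/4)" using u8 by (intro powr_mono2') auto
    also have "\<dots> \<le> (1/8) powr (-1)" by (intro powr_mono') auto
    also have "\<dots> = (8::real)" by (simp add: powr_minus)
    finally show "u powr (-3/4) \<le> 8" .
  qed auto
  finally show ?thesis by (simp add: u_def)
qed

lemma exp_neq_1_Re_pos: "Re z > 0 \<Longrightarrow> exp z \<noteq> (1::complex)"
proof
  assume "Re z > 0" "exp z = 1"
  hence "exp (Re z) = 1" using norm_exp_eq_Re[of z] by simp
  thus False using \<open>Re z > 0\<close> by simp
qed

lemma remainder_diff_bound:
  fixes u y :: real
  assumes "u > 0" "\<bar>y\<bar> \<le> u"
  defines "h \<equiv> (\<lambda>z::complex. 1 / (exp z - 1) - 1 / z)"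
  shows "norm (h (Complex u y) - h (of_real u)) \<le> 24 * u powr (-5/4) * \<bar>y\<bar>"
proof -
  let ?S = "closed_segment (of_real u) (Complex u y)"
  have S: "Re z = u \<and> \<bar>Im z\<bar> \<le> u" if zS: "z \<in> ?S" for z
  proof -
    obtain a where a: "0 \<le> a" "a \<le> 1" "z = (1 - a) *\<^sub>R of_real u + a *\<^sub>R Complex u y"
      using zS by (auto simp: in_segment)
    have "\<bar>a * y\<bar> \<le> 1 * \<bar>y\<bar>" unfolding abs_mult using a by (intro mult_right_mono) auto
    moreover have "Re z = u" "Im z = a * y" unfolding a(3) by (simp_all add: algebra_simps)
    ultimately show ?thesis using assms by simp
  qed
  have "norm (h (Complex u y) - h (of_real u)) \<le> 24 * u powr (-5/4) * norm (Complex u y - of_real u)"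
  proof (rule field_differentiable_bound[of ?S h "\<lambda>z. 1 / z\<^sup>2 - exp z / (exp z - 1)\<^sup>2"])
    fix z assume z: "z \<in> ?S"
    have "Re z > 0" using S[OF z] assms by simp
    hence "z \<noteq> 0" "exp z \<noteq> 1" using exp_neq_1_Re_pos by auto
    thus "(h has_field_derivative 1 / z\<^sup>2 - exp z / (exp z - 1)\<^sup>2) (at z within ?S)"
      unfolding h_def by (auto intro!: derivative_eq_intros simp: power2_eq_square field_simps)
    show "norm (1 / z\<^sup>2 - exp z / (exp z - 1)\<^sup>2) \<le> 24 * u powr (-5/4)"
      using inverse_square_diff_bound[of z] S[OF z] assms by simp
  qed auto
  also have "Complex u y - of_real u = \<i> * of_real y" by (simp add: complex_eq_iff)
  finally show ?thesis by (simp add: norm_mult)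
qed

lemma summable_zeta_5_4: "summable (\<lambda>k. real (Suc k) powr (-5/4))"
  using summable_real_powr_iff[of "-5/4"] by (subst summable_Suc_iff) simp

definition zeta54 :: real where "zeta54 = (\<Sum>k. real (Suc k) powr (-5/4))"

text \<open>The main term comes from the pole \<open>1 / z\<close> of \<open>1 / (exp z - 1)\<close>, summed with \<open>\<zeta>(2)\<close>.\<close>

lemma partition_log_diff_bound:
  fixes u y :: real
  assumes "u > 0" "\<bar>y\<bar> \<le> u"
  defines "t \<equiv> Complex u y"
  shows "norm (partition_log t - partition_log (of_real u) - of_real (pi\<^sup>2 / 6) * (1 / t - 1 / of_real u))
      \<le> 24 * zeta54 * u powr (-5/4) * \<bar>y\<bar>"
proof -
  define h where "h = (\<lambda>z::complex. 1 / (exp z - 1) - 1 / z)"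
  define f where "f = (\<lambda>t k. 1 / (of_nat (Suc k) * (exp (of_nat (Suc k) * t) - 1)) :: complex)"
  have f_sums: "f t sums partition_log t" if "Re t > 0" for t
    unfolding f_def partition_log_def
    by (rule summable_sums[OF summable_norm_cancel[OF summable_partition_log[OF that]]])
  have sums: "f t sums partition_log t" "f (of_real u) sums partition_log (of_real u)"
    using assms by (intro f_sums, simp)+
  have zeta: "(\<lambda>k. of_real (1 / (real k + 1)\<^sup>2) * (1 / t - 1 / of_real u)) sums (of_real (pi\<^sup>2 / 6) * (1 / t - 1 / of_real u))"
    using inverse_squares_sums by (intro sums_mult2 sums_of_real) (simp add: add.commute)
  have t0: "t \<noteq> 0" using assms by (auto simp: complex_eq_iff)
  have term_eq: "f t k - f (of_real u) k - of_real (1 / (real k + 1)\<^sup>2) * (1 / t - 1 / of_real u)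
     = (h (of_nat (Suc k) * t) - h (of_nat (Suc k) * of_real u)) / of_nat (Suc k)" for k
  proof -
    have e: "exp (of_nat (Suc k) * t) \<noteq> 1" "exp (of_nat (Suc k) * of_real u) \<noteq> (1::complex)"
      using assms by (auto intro!: exp_neq_1_Re_pos simp del: of_nat_Suc)
    have r: "of_real (1 / (real k + 1)\<^sup>2) = (1 / (of_nat (Suc k))\<^sup>2 :: complex)" by (simp add: add.commute)
    have u0: "of_real u \<noteq> (0 :: complex)" using assms by simp
    have alg: "1 / (n * E) - 1 / (n * E') - 1 / n\<^sup>2 * (1 / t - 1 / v) = ((1 / E - 1 / (n * t)) - (1 / E' - 1 / (n * v))) / n"
      if "n \<noteq> 0" "E \<noteq> 0" "E' \<noteq> 0" "v \<noteq> 0" for n E E' v :: complex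
      using that t0 by (simp add: field_simps power2_eq_square)
    show ?thesis unfolding f_def h_def r using e u0
      by (intro alg) (auto simp del: of_nat_Suc)
  qed
  \<comment> \<open>The bound for \<open>h\<close> contributes a factor \<open>n = k + 1\<close>
    through the imaginary part \<open>n y\<close>; it cancels the division by \<open>n\<close> and
    leaves the summable \<open>n^(-5/4)\<close>.\<close>
  have bound: "norm ((h (of_nat (Suc k) * t) - h (of_nat (Suc k) * of_real u)) / of_nat (Suc k)) \<le>
      24 * u powr (-5/4) * \<bar>y\<bar> * real (Suc k) powr (-5/4)" for k
  proof -
    let ?n = "real (Suc k)"
    have nt: "of_nat (Suc k) * t = Complex (?n * u) (?n * y)" "of_nat (Suc k) * of_real u = (of_real (?n * u) :: complex)"
      by (auto simp: t_def complex_eq_iff)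
    have "norm (h (of_nat (Suc k) * t) - h (of_nat (Suc k) * of_real u)) \<le> 24 * (?n * u) powr (-5/4) * \<bar>?n * y\<bar>"
      unfolding nt h_def using assms(1,2) by (intro remainder_diff_bound) (auto simp: abs_mult simp del: of_nat_Suc)
    also have "\<dots> = ?n * (24 * u powr (-5/4) * \<bar>y\<bar> * ?n powr (-5/4))"
      using assms by (simp add: powr_mult abs_mult)
    finally show ?thesis by (simp add: norm_divide divide_le_eq mult.commute del: of_nat_Suc)
  qed
  have "(\<lambda>k. f t k - f (of_real u) k - of_real (1 / (real k + 1)\<^sup>2) * (1 / t - 1 / of_real u)) sums
      (partition_log t - partition_log (of_real u) - of_real (pi\<^sup>2 / 6) * (1 / t - 1 / of_real u))"
    by (intro sums_diff sums zeta)
  hence "partition_log t - partition_log (of_real u) - of_real (pi\<^sup>2 / 6) * (1 / t - 1 / of_real u)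
      = (\<Sum>k. (h (of_nat (Suc k) * t) - h (of_nat (Suc k) * of_real u)) / of_nat (Suc k))"
    unfolding term_eq by (simp add: sums_iff)
  also have "norm \<dots> \<le> (\<Sum>k. 24 * u powr (-5/4) * \<bar>y\<bar> * real (Suc k) powr (-5/4))"
    by (rule norm_suminf_le[OF bound]) (intro summable_mult summable_zeta_5_4)
  also have "\<dots> = 24 * zeta54 * u powr (-5/4) * \<bar>y\<bar>"
    unfolding zeta54_def by (subst suminf_mult[OF summable_zeta_5_4]) (simp add: mult_ac)
  finally show ?thesis .
qed

section \<open>The partition product near the point 1\<close>

text \<open>As a function of \<open>x\<close>, the error \<open>?P\<close> on
  \<open>[a, a + x]\<close> has derivative \<open>(g a - g (a + x) + x g' (a + x)) / 2\<close>. The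
  mean value theorem for \<open>?P\<close>, and then for \<open>g\<close>, turns it into
  \<open>z / 2\<close> times an increment of \<open>g'\<close>, which monotonicity bounds.\<close>

lemma trapezoid_convex_bound:
  fixes g g' G :: "real \<Rightarrow> real"
  assumes g: "\<And>x. a \<le> x \<Longrightarrow> x \<le> a + 1 \<Longrightarrow> (g has_real_derivative g' x) (at x)"
    and G: "\<And>x. a \<le> x \<Longrightarrow> x \<le> a + 1 \<Longrightarrow> (G has_real_derivative g x) (at x)"
    and mono: "\<And>x y. a \<le> x \<Longrightarrow> x \<le> y \<Longrightarrow> y \<le> a + 1 \<Longrightarrow> g' x \<le> g' y"
  shows "\<bar>(g a + g (a + 1)) / 2 - (G (a + 1) - G a)\<bar> \<le> g' (a + 1) - g' a"
proof -
  let ?P = "\<lambda>x. x * (g a + g (a + x)) / 2 - (G (a + x) - G a)"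
  let ?P' = "\<lambda>x. (g a - g (a + x) + x * g' (a + x)) / 2"
  have der: "(?P has_real_derivative ?P' x) (at x)" if "0 \<le> x" "x \<le> 1" for x
  proof -
    have s: "((\<lambda>x. g (a + x)) has_real_derivative g' (a + x)) (at x)"
      using DERIV_shift[of g "g' (a + x)" x a] g[of "a + x"] that by (simp add: add.commute)
    have S: "((\<lambda>x. G (a + x)) has_real_derivative g (a + x)) (at x)"
      using DERIV_shift[of G "g (a + x)" x a] G[of "a + x"] that by (simp add: add.commute)
    have "(?P has_real_derivative (1 * (g a + g (a + x)) + (0 + g' (a + x)) * x) / 2 - (g (a + x) - 0)) (at x)"
      by (intro DERIV_diff DERIV_cdivide DERIV_mult DERIV_add DERIV_const DERIV_ident s S)
    thus ?thesis by (rule DERIV_cong) (simp add: field_simps)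
  qed
  have "\<exists>z>0. z < 1 \<and> ?P 1 - ?P 0 = (1 - 0) * ?P' z"
    by (rule MVT2) (use der in auto)
  then obtain z where z: "0 < z" "z < 1" and Pz: "?P 1 - ?P 0 = ?P' z" by auto
  have "\<exists>w>a. w < a + z \<and> g (a + z) - g a = (a + z - a) * g' w"
    by (rule MVT2) (use z g in auto)
  then obtain w where w: "a < w" "w < a + z" and gw: "g (a + z) - g a = z * g' w" by auto
  have eq: "?P' z = z * (g' (a + z) - g' w) / 2" using gw by (simp add: algebra_simps)
  have "0 \<le> g' (a + z) - g' w" using mono[of w "a + z"] z w by simp
  moreover have "g' (a + z) - g' w \<le> g' (a + 1) - g' a"
    using mono[of "a + z" "a + 1"] mono[of a w] z w by simp
  ultimately have "\<bar>z * (g' (a + z) - g' w) / 2\<bar> \<le> 1 * (g' (a + 1) - g' a)"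
    using z mult_mono[of z 1 "g' (a + z) - g' w" "g' (a + 1) - g' a"] by (simp add: abs_mult)
  moreover have "(g a + g (a + 1)) / 2 - (G (a + 1) - G a) = z * (g' (a + z) - g' w) / 2"
    using Pz unfolding eq by simp
  ultimately show ?thesis by (simp only: mult_1)
qed

text \<open>This is the dilogarithm at \<open>exp (- x)\<close>; the term \<open>k = 0\<close> vanishes because \<open>1 / 0 = 0\<close>.\<close>

definition dilog :: "real \<Rightarrow> real" where
  "dilog x = (\<Sum>k. exp (- x) ^ k / (real k)\<^sup>2)"

lemma summable_inverse_square: "summable (\<lambda>k. 1 / (real k)\<^sup>2)"
  using inverse_power_summable[of 2, where 'a = real] by (simp add: inverse_eq_divide)

lemma suminf_inverse_square: "(\<Sum>k. 1 / (real k)\<^sup>2) = pi\<^sup>2 / 6"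
proof -
  have "(\<lambda>k. 1 / (real (Suc k))\<^sup>2) sums (pi\<^sup>2 / 6)" using inverse_squares_sums by (simp add: add.commute)
  hence "(\<lambda>k. 1 / (real k)\<^sup>2) sums (pi\<^sup>2 / 6)" by (subst (asm) sums_Suc_iff) simp
  thus ?thesis by (simp add: sums_iff)
qed

lemma dilog_tendsto_0: "(dilog \<longlongrightarrow> pi\<^sup>2 / 6) (at_right 0)"
proof -
  have "((\<lambda>x. \<Sum>k. exp (- x) ^ k / (real k)\<^sup>2) \<longlongrightarrow> (\<Sum>k. 1 ^ k / (real k)\<^sup>2)) (at_right (0::real))"
  proof (rule tannerys_theorem[THEN conjunct2, THEN conjunct2])
    have "((\<lambda>x::real. exp (- x)) \<longlongrightarrow> exp (- 0)) (at_right 0)" by (intro tendsto_intros)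
    from tendsto_mult[OF tendsto_power[OF this] tendsto_const]
    show "((\<lambda>x::real. exp (- x) ^ k / (real k)\<^sup>2) \<longlongrightarrow> 1 ^ k / (real k)\<^sup>2) (at_right 0)" for k
      unfolding divide_inverse by simp
    have "\<forall>\<^sub>F x in at_right (0::real). x > 0" by (rule eventually_at_right_less)
    hence "\<forall>\<^sub>F x in at_right (0::real). \<forall>k. norm (exp (- x) ^ k / (real k)\<^sup>2) \<le> 1 / (real k)\<^sup>2"
      by eventually_elim (auto intro!: divide_right_mono power_le_one)
    thus "\<forall>\<^sub>F (k, x) in sequentially \<times>\<^sub>F at_right (0::real). norm (exp (- x) ^ k / (real k)\<^sup>2) \<le> 1 / (real k)\<^sup>2"
      unfolding eventually_prod_filter
      by (intro exI[of _ "\<lambda>_. True"] exI[of _ "\<lambda>x. \<forall>k. norm (exp (- x) ^ k / (real k)\<^sup>2) \<le> 1 / (real k)\<^sup>2"]) auto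
  qed (auto intro: summable_inverse_square)
  thus ?thesis by (simp add: dilog_def[abs_def] suminf_inverse_square)
qed

lemma dilog_bound: "x \<ge> 0 \<Longrightarrow> \<bar>dilog x\<bar> \<le> exp (- x) * (pi\<^sup>2 / 6)"
proof -
  assume x: "x \<ge> 0"
  \<comment> \<open>The term \<open>k = 0\<close> vanishes, so every remaining term has a factor
    \<open>exp (- x)\<close> to spare.\<close>
  have "norm (exp (- x) ^ k / (real k)\<^sup>2) \<le> exp (- x) * (1 / (real k)\<^sup>2)" for k
  proof (cases k)
    case (Suc j)
    have "exp (- x) * exp (- x) ^ j \<le> exp (- x) * 1" using x by (intro mult_left_mono power_le_one) auto
    thus ?thesis using Suc by (simp add: divide_right_mono)
  qed simp
  hence "norm (dilog x) \<le> (\<Sum>k. exp (- x) * (1 / (real k)\<^sup>2))"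
    unfolding dilog_def by (rule norm_suminf_le) (intro summable_mult summable_inverse_square)
  also have "\<dots> = exp (- x) * (pi\<^sup>2 / 6)"
    by (subst suminf_mult[OF summable_inverse_square]) (simp add: suminf_inverse_square)
  finally show ?thesis by simp
qed

text \<open>What makes \<open>dilog\<close> useful here: \<open>- dilog (x * t) / t\<close> is an
  antiderivative in \<open>x\<close> of \<open>- ln (1 - exp (- x t))\<close>.\<close>

lemma dilog_has_derivative:
  assumes "x > 0"
  shows "(dilog has_real_derivative ln (1 - exp (- x))) (at x)"
proof -
  define c where "c = (\<lambda>k::nat. 1 / (real k)\<^sup>2)"
  define v where "v = exp (- x)"
  have v: "0 < v" "v < 1" using assms by (auto simp: v_def)
  have "((\<lambda>v. \<Sum>k. c k * v ^ k) has_real_derivative (\<Sum>k. diffs c k * v ^ k)) (at v)"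
    by (rule termdiffs_strong[where K = 1]) (use v summable_inverse_square in \<open>auto simp: c_def\<close>)
  moreover have "(\<Sum>k. diffs c k * v ^ k) = - ln (1 - v) / v"
  proof -
    have "(\<lambda>n. - ((- (- v)) ^ n) / of_nat n) sums ln (1 + (- v))" using v by (intro ln_series') auto
    hence "(\<lambda>n. v ^ n / of_nat n) sums - ln (1 - v)" using sums_minus by fastforce
    hence "(\<lambda>n. v ^ Suc n / of_nat (Suc n)) sums - ln (1 - v)" by (subst sums_Suc_iff) simp
    hence "(\<lambda>n. v ^ Suc n / of_nat (Suc n) / v) sums (- ln (1 - v) / v)" by (rule sums_divide)
    moreover have "v ^ Suc n / of_nat (Suc n) / v = diffs c n * v ^ n" for n
      using v by (simp add: c_def diffs_def power2_eq_square del: of_nat_Suc)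
    ultimately show ?thesis by (simp add: sums_iff)
  qed
  ultimately have "((\<lambda>v. \<Sum>k. c k * v ^ k) has_real_derivative - ln (1 - v) / v) (at (exp (- x)))"
    by (simp add: v_def)
  hence "((\<lambda>x. (\<Sum>k. c k * exp (- x) ^ k)) has_real_derivative (- ln (1 - v) / v) * (- exp (- x))) (at x)"
    by (rule DERIV_chain2) (auto intro!: derivative_eq_intros)
  thus ?thesis using v by (simp add: dilog_def[abs_def] c_def v_def)
qed

text \<open>The error in the expansion \<open>dilog x = pi^2 / 6 - x + x ln x + O(x^2)\<close> at 0.
  Its derivative is \<open>ln ((1 - exp (- x)) / x)\<close>, which lies between \<open>- x\<close>
  and 0.\<close>

definition dilog_remainder :: "real \<Rightarrow> real" where
  "dilog_remainder x = dilog x - pi\<^sup>2 / 6 + x - x * ln x"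

lemma ln_one_minus_exp_bounds:
  fixes u :: real
  assumes "u > 0"
  shows "- u \<le> ln (1 - exp (- u)) - ln u" "ln (1 - exp (- u)) - ln u \<le> 0"
proof -
  have pos: "1 - exp (- u) > 0" using assms by simp
  have "1 - exp (- u) \<le> u" using exp_ge_add_one_self[of "- u"] by simp
  thus "ln (1 - exp (- u)) - ln u \<le> 0" using pos by simp
  have "u + 1 \<le> exp u" using exp_ge_add_one_self[of u] by linarith
  hence "exp (- u) * u \<le> exp (- u) * (exp u - 1)" by (intro mult_left_mono) auto
  also have "\<dots> = 1 - exp (- u)" by (simp add: algebra_simps mult_exp_exp)
  finally have "ln (exp (- u) * u) \<le> ln (1 - exp (- u))" using assms pos by simp
  thus "- u \<le> ln (1 - exp (- u)) - ln u" using assms by (simp add: ln_mult)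
qed

text \<open>Mean value theorem on \<open>[s, x]\<close>, with \<open>s\<close> tending to 0 from the
  right: the derivative is at most \<open>x\<close> in modulus there, and the remainder itself tends
  to 0.\<close>

lemma dilog_remainder_bound:
  assumes "x > 0"
  shows "\<bar>dilog_remainder x\<bar> \<le> x\<^sup>2"
proof -
  have der: "(dilog_remainder has_real_derivative ln (1 - exp (- u)) - ln u) (at u)" if "u > 0" for u
    unfolding dilog_remainder_def
    by (rule derivative_eq_intros dilog_has_derivative that refl)+ (use that in simp)
  have "((\<lambda>u::real. u - u * ln u) \<longlongrightarrow> 0) (at_right 0)" by real_asymp
  from tendsto_add[OF tendsto_diff[OF dilog_tendsto_0 tendsto_const[of "pi\<^sup>2 / 6"]] this]
  have lim: "(dilog_remainder \<longlongrightarrow> 0) (at_right 0)"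
    by (simp add: dilog_remainder_def[abs_def] add_diff_eq)
  have "\<bar>dilog_remainder x - dilog_remainder s\<bar> \<le> x\<^sup>2" if s: "0 < s" "s < x" for s
  proof -
    have "\<exists>z>s. z < x \<and> dilog_remainder x - dilog_remainder s = (x - s) * (ln (1 - exp (- z)) - ln z)"
      by (rule MVT2) (use der s in auto)
    then obtain z where z: "s < z" "z < x"
      and eq: "dilog_remainder x - dilog_remainder s = (x - s) * (ln (1 - exp (- z)) - ln z)" by auto
    have "\<bar>ln (1 - exp (- z)) - ln z\<bar> \<le> x" using ln_one_minus_exp_bounds[of z] z s by auto
    hence "\<bar>x - s\<bar> * \<bar>ln (1 - exp (- z)) - ln z\<bar> \<le> x * x" using s by (intro mult_mono) auto
    thus ?thesis unfolding eq by (simp add: abs_mult power2_eq_square)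
  qed
  hence "\<forall>\<^sub>F s in at_right 0. \<bar>dilog_remainder x - dilog_remainder s\<bar> \<le> x\<^sup>2"
    unfolding eventually_at_right_field using assms by blast
  moreover have "((\<lambda>s. \<bar>dilog_remainder x - dilog_remainder s\<bar>) \<longlongrightarrow> \<bar>dilog_remainder x - 0\<bar>) (at_right 0)"
    by (intro tendsto_intros lim)
  ultimately show ?thesis using tendsto_upperbound by fastforce
qed

text \<open>The trapezoidal error of \<open>- ln\<close> on \<open>[i + 1, i + 2]\<close>, which is the limit of \<open>trapezoid_term t i\<close> as \<open>t \<rightarrow> 0\<close>.\<close>

definition stirling_term :: "nat \<Rightarrow> real" where
  "stirling_term i = - (ln (real (Suc i)) + ln (real (Suc (Suc i)))) / 2
     - (1 + real (Suc i) * ln (real (Suc i)) - real (Suc (Suc i)) * ln (real (Suc (Suc i))))"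

text \<open>Telescoping: the partial sums compare \<open>ln ((n + 1)!)\<close> with its Stirling
  approximation, so the infinite sum amounts to Stirling's constant.\<close>

lemma sum_stirling_term:
  "(\<Sum>i<n. stirling_term i) = 1 - (ln (fact (Suc n)) - (real (Suc n) + 1 / 2) * ln (real (Suc n)) + real (Suc n))"
proof (induction n)
  case 0 show ?case by simp
next
  case (Suc n)
  have "ln (fact (Suc (Suc n))) = ln (real (Suc (Suc n))) + ln (fact (Suc n) :: real)"
    by (subst fact_Suc) (simp add: ln_mult del: fact_Suc of_nat_Suc)
  thus ?case using Suc by (simp add: stirling_term_def field_simps del: fact_Suc)
qed

text \<open>Put \<open>a n = ln (n!) - (n + 1/2) ln n + n\<close>. Summability provides a limit
  \<open>A\<close> of \<open>a\<close>, and then \<open>2 a(n) - a(2 n)\<close> tends to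
  \<open>A\<close> as well. That combination is the logarithm of the Gamma series at
  \<open>1 / 2\<close> up to elementary terms, so \<open>A\<close> follows from
  \<open>Gamma (1/2) = sqrt pi\<close>, a form of Wallis's product.\<close>

lemma suminf_stirling_term:
  assumes "summable stirling_term"
  shows "(\<Sum>i. stirling_term i) = 1 - ln (2 * pi) / 2"
proof -
  define a where "a = (\<lambda>n. ln (fact n) - (real n + 1 / 2) * ln (real n) + real n)"
  define s where "s = (\<Sum>i. stirling_term i)"
  have "(\<lambda>n. \<Sum>i<n. stirling_term i) \<longlonglongrightarrow> s"
    using summable_LIMSEQ[OF assms] by (simp add: s_def)
  hence "(\<lambda>n. 1 - (\<Sum>i<n. stirling_term i)) \<longlonglongrightarrow> 1 - s" by (intro tendsto_intros)
  moreover have "1 - (\<Sum>i<n. stirling_term i) = a (Suc n)" for n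
    unfolding sum_stirling_term a_def by linarith
  ultimately have "(\<lambda>n. a (Suc n)) \<longlonglongrightarrow> 1 - s" by simp
  hence a: "a \<longlonglongrightarrow> 1 - s" by (rule LIMSEQ_imp_Suc)
  moreover have "filterlim (\<lambda>n::nat. 2 * n) at_top sequentially" by (rule filterlim_subseq) (auto simp: strict_mono_def)
  ultimately have a2: "(\<lambda>n. a (2 * n)) \<longlonglongrightarrow> 1 - s" by (rule filterlim_compose)
  have "(\<lambda>n. ln (Gamma_series (1 / 2 :: real) n)) \<longlonglongrightarrow> ln (sqrt pi)"
    using Gamma_series_LIMSEQ[of "1 / 2 :: real"] by (intro tendsto_ln) (auto simp: Gamma_one_half_real)
  moreover have "(\<lambda>n. ln ((real n + 1 / 2) / real n) + ln 2 / 2) \<longlonglongrightarrow> 0 + ln 2 / 2"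
    by (intro tendsto_add tendsto_const) real_asymp
  ultimately have "(\<lambda>n. ln (Gamma_series (1 / 2 :: real) n) + (ln ((real n + 1 / 2) / real n) + ln 2 / 2)) \<longlonglongrightarrow> ln (sqrt pi) + (0 + ln 2 / 2)"
    by (rule tendsto_add)
  moreover have "\<forall>\<^sub>F n in sequentially. ln (Gamma_series (1 / 2 :: real) n) + (ln ((real n + 1 / 2) / real n) + ln 2 / 2) = 2 * a n - a (2 * n)"
    using eventually_gt_at_top[of 0]
  proof eventually_elim
    case (elim n)
    have poch: "pochhammer (1 / 2) n = fact (2 * n) / (2 ^ (2 * n) * fact n :: real)"
      using fact_double[of n, where 'a = real] by (simp add: field_simps)
    have "Gamma_series (1 / 2 :: real) n = fact n * exp (ln (real n) / 2) * (2 ^ (2 * n) * fact n) / (fact (2 * n) * (real n + 1 / 2))"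
      unfolding Gamma_series_def by (simp add: pochhammer_Suc poch add.commute)
    also have "ln \<dots> = ln (fact n) + ln (real n) / 2 + (real (2 * n) * ln 2 + ln (fact n)) - (ln (fact (2 * n)) + ln (real n + 1 / 2))"
    proof -
      have "real n + 1 / 2 > 0" by simp
      thus ?thesis by (subst ln_div) (auto simp: ln_mult ln_realpow)
    qed
    finally have *: "ln (Gamma_series (1 / 2 :: real) n) = ln (fact n) + ln (real n) / 2 + (real (2 * n) * ln 2 + ln (fact n)) - (ln (fact (2 * n)) + ln (real n + 1 / 2))" .
    have **: "ln ((real n + 1 / 2) / real n) = ln (real n + 1 / 2) - ln (real n)"
      using elim by (subst ln_div) auto
    have ***: "ln (real (2 * n)) = ln 2 + ln (real n)" using elim by (simp add: ln_mult)
    show ?case unfolding * ** a_def *** by (simp add: algebra_simps)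
  qed
  ultimately have "(\<lambda>n. 2 * a n - a (2 * n)) \<longlonglongrightarrow> ln (sqrt pi) + (0 + ln 2 / 2)"
    by (rule Lim_transform_eventually)
  moreover have "(\<lambda>n. 2 * a n - a (2 * n)) \<longlonglongrightarrow> 2 * (1 - s) - (1 - s)"
    by (intro tendsto_intros a a2)
  ultimately have "2 * (1 - s) - (1 - s) = ln (sqrt pi) + (0 + ln 2 / 2)"
    using LIMSEQ_unique by blast
  thus ?thesis by (simp add: s_def ln_sqrt ln_mult field_simps)
qed

text \<open>The trapezoidal error of \<open>- ln (1 - exp (- x t))\<close> on
  \<open>[i + 1, i + 2]\<close>, with the integral expressed by \<open>dilog\<close>. Starting at 1
  keeps away from the logarithmic singularity at 0.\<close>

definition trapezoid_term :: "real \<Rightarrow> nat \<Rightarrow> real" where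
  "trapezoid_term t i = - (ln (1 - exp (- (real (Suc i) * t))) + ln (1 - exp (- (real (Suc (Suc i)) * t)))) / 2
     - (dilog (real (Suc i) * t) - dilog (real (Suc (Suc i)) * t)) / t"

text \<open>The second derivative of \<open>- ln (1 - exp (- x t))\<close> is
  \<open>t^2 exp (x t) / (exp (x t) - 1)^2\<close>, at most \<open>2 / x^2\<close> by
  \<open>exp_quotient_le\<close>. No \<open>t\<close> is left, so the bound can serve as a majorant
  while \<open>t\<close> tends to 0.\<close>

lemma trapezoid_term_bound:
  assumes t: "t > 0"
  shows "\<bar>trapezoid_term t i\<bar> \<le> 2 / (real (Suc i))\<^sup>2"
proof -
  define a where "a = real (Suc i)"
  have a: "a > 0" by (simp add: a_def)
  define g where "g = (\<lambda>x. - ln (1 - exp (- (x * t))))"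
  define g' where "g' = (\<lambda>x. - t / (exp (x * t) - 1))"
  define G where "G = (\<lambda>x. - dilog (x * t) / t)"
  have pos: "x * t > 0" "exp (x * t) > 1" if "x \<ge> a" for x using that a t by auto
  have g'_der: "(g' has_real_derivative t\<^sup>2 * (exp (x * t) / (exp (x * t) - 1)\<^sup>2)) (at x)" if "x \<ge> a" for x
    unfolding g'_def using pos[OF that] by (auto intro!: derivative_eq_intros simp: power2_eq_square)
  have g'_diff: "0 \<le> g' y - g' x \<and> g' y - g' x \<le> (y - x) * (2 / a\<^sup>2)" if "a \<le> x" "x \<le> y" for x y
  proof (cases "x = y")
    case False
    have "\<exists>z>x. z < y \<and> g' y - g' x = (y - x) * (t\<^sup>2 * (exp (z * t) / (exp (z * t) - 1)\<^sup>2))"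
      by (rule MVT2) (use that False g'_der in auto)
    then obtain z where z: "x < z" "z < y" and eq: "g' y - g' x = (y - x) * (t\<^sup>2 * (exp (z * t) / (exp (z * t) - 1)\<^sup>2))" by auto
    have "t\<^sup>2 * (exp (z * t) / (exp (z * t) - 1)\<^sup>2) \<le> t\<^sup>2 * (2 / (z * t)\<^sup>2)"
      using pos[of z] z that by (intro mult_left_mono exp_quotient_le) auto
    also have "\<dots> = 2 / z\<^sup>2" using t by (simp add: power_mult_distrib)
    also have "\<dots> \<le> 2 / a\<^sup>2" using z that a by (intro divide_left_mono power_mono mult_pos_pos) auto
    finally have "t\<^sup>2 * (exp (z * t) / (exp (z * t) - 1)\<^sup>2) \<le> 2 / a\<^sup>2" .
    hence "(y - x) * (t\<^sup>2 * (exp (z * t) / (exp (z * t) - 1)\<^sup>2)) \<le> (y - x) * (2 / a\<^sup>2)"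
      using that by (intro mult_left_mono) auto
    thus ?thesis unfolding eq using that by simp
  qed simp
  have "\<bar>(g a + g (a + 1)) / 2 - (G (a + 1) - G a)\<bar> \<le> g' (a + 1) - g' a"
  proof (rule trapezoid_convex_bound)
    fix x assume x: "a \<le> x" "x \<le> a + 1"
    have "1 - exp (- (x * t)) > 0" using pos[OF x(1)] by simp
    hence "(g has_real_derivative - (exp (- (x * t)) * t / (1 - exp (- (x * t))))) (at x)"
      unfolding g_def by (auto intro!: derivative_eq_intros)
    also have "exp (- (x * t)) * t / (1 - exp (- (x * t))) = t / (exp (x * t) - 1)"
      using pos[OF x(1)] by (simp add: exp_minus field_simps)
    finally show "(g has_real_derivative g' x) (at x)" by (simp add: g'_def)
    have "((\<lambda>x. dilog (x * t)) has_real_derivative ln (1 - exp (- (x * t))) * t) (at x)"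
      by (rule DERIV_chain2[where g = "\<lambda>x. x * t", OF dilog_has_derivative[OF pos(1)[OF x(1)]]]) (auto intro!: derivative_eq_intros)
    from DERIV_cdivide[OF DERIV_minus[OF this], of t] show "(G has_real_derivative g x) (at x)"
      using t by (simp add: G_def g_def)
  next
    fix x y assume "a \<le> x" "x \<le> y" "y \<le> a + 1"
    thus "g' x \<le> g' y" using g'_diff[of x y] by simp
  qed
  also have "g' (a + 1) - g' a \<le> 2 / a\<^sup>2" using g'_diff[of a "a + 1"] by simp
  also have "(g a + g (a + 1)) / 2 - (G (a + 1) - G a) = trapezoid_term t i"
    by (simp add: g_def G_def trapezoid_term_def a_def diff_divide_distrib add.commute)
  finally show ?thesis by (simp add: a_def)
qed

text \<open>In the difference of the two dilogarithms divided by \<open>t\<close> the singular terms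
  \<open>pi^2 / (6 t)\<close> cancel, and the remaining \<open>ln t\<close> cancels the one from the
  mean of the logarithms because the interval has length 1.\<close>

lemma trapezoid_term_tendsto: "((\<lambda>t. trapezoid_term t i) \<longlongrightarrow> stirling_term i) (at_right 0)"
proof -
  define a b where "a = real (Suc i)" and "b = real (Suc (Suc i))"
  have ab: "a > 0" "b > 0" and ab1: "b - a = 1" by (auto simp: a_def b_def)
  have "norm (trapezoid_term t i - stirling_term i) \<le> ((a + b) / 2 + a\<^sup>2 + b\<^sup>2) * t" if t: "t > 0" for t
  proof -
    define \<delta> where "\<delta> = (\<lambda>x. ln (1 - exp (- (x * t))) - (ln x + ln t))"
    have \<delta>: "\<bar>\<delta> x\<bar> \<le> x * t" if "x > 0" for x
      using ln_one_minus_exp_bounds[of "x * t"] that t by (simp add: \<delta>_def ln_mult)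
    have R: "\<bar>dilog_remainder (x * t) / t\<bar> \<le> x\<^sup>2 * t" if "x > 0" for x
      using dilog_remainder_bound[of "x * t"] that t by (simp add: abs_divide field_simps power2_eq_square)
    have dl: "dilog (x * t) = dilog_remainder (x * t) + pi\<^sup>2 / 6 - x * t + x * t * (ln x + ln t)" if "x > 0" for x
      using that t by (simp add: dilog_remainder_def ln_mult)
    have "(dilog (a * t) - dilog (b * t)) / t =
       dilog_remainder (a * t) / t - dilog_remainder (b * t) / t + (b - a) + a * ln a - b * ln b - (b - a) * ln t"
      unfolding dl[OF ab(1)] dl[OF ab(2)] using t by (simp add: field_simps)
    hence d: "(dilog (a * t) - dilog (b * t)) / t = dilog_remainder (a * t) / t - dilog_remainder (b * t) / t + 1 + a * ln a - b * ln b - ln t"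
      by (simp add: ab1)
    have "trapezoid_term t i - stirling_term i = - (\<delta> a + \<delta> b) / 2 - (dilog_remainder (a * t) / t - dilog_remainder (b * t) / t)"
      unfolding trapezoid_term_def stirling_term_def a_def[symmetric] b_def[symmetric] d \<delta>_def by (simp add: field_simps)
    moreover have "\<bar>- (p + q) / 2 - (r - s)\<bar> \<le> (\<bar>p\<bar> + \<bar>q\<bar>) / 2 + (\<bar>r\<bar> + \<bar>s\<bar>)" for p q r s :: real by (auto simp: abs_if field_simps)
    ultimately have "\<bar>trapezoid_term t i - stirling_term i\<bar> \<le> (\<bar>\<delta> a\<bar> + \<bar>\<delta> b\<bar>) / 2 + (\<bar>dilog_remainder (a * t) / t\<bar> + \<bar>dilog_remainder (b * t) / t\<bar>)"
      by metis
    also have "\<dots> \<le> (a * t + b * t) / 2 + (a\<^sup>2 * t + b\<^sup>2 * t)"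
      using \<delta> R ab by (intro add_mono divide_right_mono) auto
    finally show ?thesis by (simp add: field_simps)
  qed
  hence ev: "\<forall>\<^sub>F t in at_right 0. norm (trapezoid_term t i - stirling_term i) \<le> ((a + b) / 2 + a\<^sup>2 + b\<^sup>2) * t"
    by (intro eventually_mono[OF eventually_at_right_less]) auto
  have "((\<lambda>t. ((a + b) / 2 + a\<^sup>2 + b\<^sup>2) * t) \<longlongrightarrow> ((a + b) / 2 + a\<^sup>2 + b\<^sup>2) * 0) (at_right 0)"
    by (intro tendsto_intros)
  hence "((\<lambda>t. trapezoid_term t i - stirling_term i) \<longlongrightarrow> 0) (at_right 0)"
    by (intro Lim_null_comparison[OF ev]) simp
  thus ?thesis by (simp add: LIM_zero_iff)
qed

lemma suminf_trapezoid_term_tendsto: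
  "((\<lambda>t. \<Sum>i. trapezoid_term t i) \<longlongrightarrow> 1 - ln (2 * pi) / 2) (at_right 0)"
proof -
  have sm: "summable (\<lambda>i. 2 / (real (Suc i))\<^sup>2)"
    using summable_mult[OF summable_inverse_square, of 2] by (subst summable_Suc_iff) simp
  have "\<forall>\<^sub>F t in at_right 0. \<forall>i. norm (trapezoid_term t i) \<le> 2 / (real (Suc i))\<^sup>2"
    by (rule eventually_mono[OF eventually_at_right_less[of 0]]) (use trapezoid_term_bound in \<open>simp del: of_nat_Suc\<close>)
  hence "\<forall>\<^sub>F (i, t) in sequentially \<times>\<^sub>F at_right 0. norm (trapezoid_term t i) \<le> 2 / (real (Suc i))\<^sup>2"
    unfolding eventually_prod_filter
    by (intro exI[of _ "\<lambda>_. True"] exI[of _ "\<lambda>t. \<forall>i. norm (trapezoid_term t i) \<le> 2 / (real (Suc i))\<^sup>2"]) auto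
  \<comment> \<open>Tannery's theorem yields not only the limit but also the absolute summability of
    \<open>stirling_term\<close>, which the evaluation of its sum assumes.\<close>
  from tannerys_theorem[OF trapezoid_term_tendsto this sm trivial_limit_at_right_real]
  have *: "summable (\<lambda>i. norm (stirling_term i))" "((\<lambda>t. \<Sum>i. trapezoid_term t i) \<longlongrightarrow> (\<Sum>i. stirling_term i)) (at_right 0)"
    by auto
  thus ?thesis using suminf_stirling_term[OF summable_norm_cancel] by simp
qed

text \<open>The trapezoidal sums add up to the full series minus half its first term, and the
  integrals to the integral from 1 to infinity, \<open>dilog t / t\<close>.\<close>

lemma suminf_trapezoid_term:
  assumes t: "t > 0" and L: "(\<lambda>j. - ln (1 - exp (- (real (Suc j) * t)))) sums L"
  shows "(\<Sum>i. trapezoid_term t i) = L + ln (1 - exp (- t)) / 2 - dilog t / t"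
proof -
  define g where "g = (\<lambda>j. - ln (1 - exp (- (real (Suc j) * t))))"
  define d where "d = (\<lambda>j. dilog (real (Suc j) * t) / t)"
  have step: "trapezoid_term t i = (g i + g (Suc i)) / 2 - (d i - d (Suc i))" for i
    unfolding trapezoid_term_def g_def d_def diff_divide_distrib by simp
  have partial: "(\<Sum>i<n. trapezoid_term t i) = (\<Sum>j<n. g j) - g 0 / 2 + g n / 2 - (d 0 - d n)" for n
  proof (induction n)
    case (Suc n)
    show ?case unfolding sum.lessThan_Suc Suc unfolding step by (simp add: field_simps)
  qed simp
  have "g \<longlonglongrightarrow> 0" using L unfolding g_def[symmetric] by (intro summable_LIMSEQ_zero sums_summable)
  moreover have "d \<longlonglongrightarrow> 0"
    unfolding d_def
  proof (rule Lim_null_comparison)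
    show "\<forall>\<^sub>F n in sequentially. norm (dilog (real (Suc n) * t) / t) \<le> exp (- (real (Suc n) * t)) * (pi\<^sup>2 / 6) / t"
    proof (intro always_eventually allI)
      fix n
      have "\<bar>dilog (real (Suc n) * t)\<bar> / t \<le> exp (- (real (Suc n) * t)) * (pi\<^sup>2 / 6) / t"
        using t by (intro divide_right_mono dilog_bound) auto
      thus "norm (dilog (real (Suc n) * t) / t) \<le> exp (- (real (Suc n) * t)) * (pi\<^sup>2 / 6) / t"
        using t by (simp only: real_norm_def abs_divide abs_of_pos)
    qed
    show "(\<lambda>n. exp (- (real (Suc n) * t)) * (pi\<^sup>2 / 6) / t) \<longlonglongrightarrow> 0" using t by real_asymp
  qed
  moreover have "(\<lambda>n. \<Sum>j<n. g j) \<longlonglongrightarrow> L" using L by (simp add: sums_def g_def)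
  ultimately have "(\<lambda>n. (\<Sum>j<n. g j) - g 0 / 2 + g n / 2 - (d 0 - d n)) \<longlonglongrightarrow> L - g 0 / 2 + 0 / 2 - (d 0 - 0)"
    by (intro tendsto_intros) auto
  hence "trapezoid_term t sums (L - g 0 / 2 - d 0)" unfolding sums_def partial by simp
  hence "(\<Sum>i. trapezoid_term t i) = L - g 0 / 2 - d 0" by (rule sums_unique[symmetric])
  thus ?thesis by (simp add: g_def d_def)
qed

text \<open>The sums over \<open>j\<close> and \<open>k\<close> are not exchanged directly: the real
  partial products converge to the exponential of the sum over \<open>k\<close>, and their
  logarithms are the partial sums over \<open>j\<close>.\<close>

lemma partition_log_real_sums:
  assumes t: "t > 0"
  shows "(\<lambda>j. - ln (1 - exp (- (real (Suc j) * t)))) sums Re (partition_log (of_real t))"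
    and "partition_log (of_real t) = of_real (Re (partition_log (of_real t)))"
proof -
  have of_nat: "(of_nat n :: complex) = of_real (real n)" for n by simp
  define L where "L = (\<Sum>k. 1 / (real (Suc k) * (exp (real (Suc k) * t) - 1)))"
  have term_eq: "1 / (of_nat (Suc k) * (exp (of_nat (Suc k) * of_real t) - 1)) = (of_real (1 / (real (Suc k) * (exp (real (Suc k) * t) - 1))) :: complex)" for k
  proof -
    have "exp (of_nat (Suc k) * of_real t) = (of_real (exp (real (Suc k) * t)) :: complex)"
      by (simp only: of_nat of_real_mult[symmetric] exp_of_real)
    thus ?thesis by (simp only: of_nat of_real_mult of_real_diff of_real_divide of_real_1)
  qed
  have "summable (\<lambda>k. norm (of_real (1 / (real (Suc k) * (exp (real (Suc k) * t) - 1))) :: complex))"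
    using summable_partition_log[of "of_real t"] t unfolding term_eq by simp
  hence "summable (\<lambda>k. 1 / (real (Suc k) * (exp (real (Suc k) * t) - 1)))"
    unfolding norm_of_real by (rule summable_rabs_cancel)
  hence "of_real L = (\<Sum>k. of_real (1 / (real (Suc k) * (exp (real (Suc k) * t) - 1))) :: complex)"
    unfolding L_def by (rule suminf_of_real)
  hence L: "partition_log (of_real t) = of_real L"
    unfolding partition_log_def term_eq by (rule sym)
  thus "partition_log (of_real t) = of_real (Re (partition_log (of_real t)))" by simp
  define P where "P = (\<lambda>J. \<Prod>j<J. inverse (1 - exp (- (real (Suc j) * t))))"
  have pp: "partition_product J (exp (- of_real t)) = of_real (P J)" for J
    unfolding partition_product_def P_def of_real_prod
  proof (intro prod.cong refl)
    fix j
    have "exp (- of_real t) ^ Suc j = (of_real (exp (- (real (Suc j) * t))) :: complex)"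
    proof -
      have "exp (- t) ^ Suc j = exp (- (real (Suc j) * t))"
        by (simp only: exp_of_nat_mult[symmetric] mult_minus_right)
      hence "of_real (exp (- t)) ^ Suc j = (of_real (exp (- (real (Suc j) * t))) :: complex)"
        by (metis of_real_power)
      thus ?thesis by (metis exp_of_real of_real_minus)
    qed
    thus "inverse (1 - exp (- of_real t) ^ Suc j) = (of_real (inverse (1 - exp (- (real (Suc j) * t)))) :: complex)"
      by (simp only: of_real_inverse of_real_diff of_real_1)
  qed
  have "(\<lambda>J. of_real (P J) :: complex) \<longlonglongrightarrow> of_real (exp L)"
    using partition_product_tendsto[of "of_real t"] t unfolding pp L by (simp add: exp_of_real)
  hence "P \<longlonglongrightarrow> exp L" by (simp only: tendsto_of_real_iff)
  hence "(\<lambda>J. ln (P J)) \<longlonglongrightarrow> L" using tendsto_ln[of P "exp L"] by simp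
  moreover have "ln (P J) = (\<Sum>j<J. - ln (1 - exp (- (real (Suc j) * t))))" for J
  proof -
    have "1 - exp (- (real (Suc j) * t)) > 0" for j using t by simp
    thus ?thesis unfolding P_def by (subst ln_prod) (auto simp: ln_inverse simp del: of_nat_Suc)
  qed
  ultimately show "(\<lambda>j. - ln (1 - exp (- (real (Suc j) * t)))) sums Re (partition_log (of_real t))"
    unfolding sums_def L by simp
qed

text \<open>The leading part, at real \<open>t\<close>, of the modular transformation of the eta
  function. The integral from 1 to infinity supplies \<open>pi^2 / (6 t)\<close>, and Stirling's
  constant supplies the \<open>2 pi\<close>.\<close>

lemma partition_log_real_asymptotic:
  "((\<lambda>t. Re (partition_log (of_real t)) - (pi\<^sup>2 / (6 * t) + ln (t / (2 * pi)) / 2)) \<longlongrightarrow> 0) (at_right 0)"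
proof -
  let ?f = "\<lambda>t. (\<Sum>i. trapezoid_term t i) - (1 - ln (2 * pi) / 2) - (ln (1 - exp (- t)) - ln t) / 2 + dilog_remainder t / t"
  have R: "((\<lambda>t. dilog_remainder t / t) \<longlongrightarrow> 0) (at_right 0)"
  proof (rule Lim_null_comparison)
    show "\<forall>\<^sub>F t in at_right 0. norm (dilog_remainder t / t) \<le> t"
      by (rule eventually_mono[OF eventually_at_right_less[of 0]])
         (use dilog_remainder_bound in \<open>simp add: abs_divide divide_le_eq power2_eq_square\<close>)
  qed (auto intro!: tendsto_eq_intros)
  have "((\<lambda>t. ?f t) \<longlongrightarrow>
     (1 - ln (2 * pi) / 2) - (1 - ln (2 * pi) / 2) - 0 / 2 + 0) (at_right 0)"
  proof (intro tendsto_intros suminf_trapezoid_term_tendsto R)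
    show "((\<lambda>t::real. ln (1 - exp (- t)) - ln t) \<longlongrightarrow> 0) (at_right 0)" by real_asymp
  qed auto
  hence lim: "((\<lambda>t. ?f t) \<longlongrightarrow> 0) (at_right 0)"
    by simp
  have "\<forall>\<^sub>F t in at_right 0. ?f t
     = Re (partition_log (of_real t)) - (pi\<^sup>2 / (6 * t) + ln (t / (2 * pi)) / 2)"
  proof (rule eventually_mono[OF eventually_at_right_less[of 0]])
    fix t :: real assume t: "0 < t"
    have "ln (t / (2 * pi)) = ln t - ln (2 * pi)" using t by (subst ln_div) auto
    moreover have "dilog t / t = dilog_remainder t / t + pi\<^sup>2 / (6 * t) - 1 + ln t"
      using t by (simp add: dilog_remainder_def field_simps)
    ultimately show "?f t
       = Re (partition_log (of_real t)) - (pi\<^sup>2 / (6 * t) + ln (t / (2 * pi)) / 2)"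
      unfolding suminf_trapezoid_term[OF t partition_log_real_sums(1)[OF t]] by (simp add: field_simps)
  qed
  from Lim_transform_eventually[OF lim this] show ?thesis .
qed

section \<open>Domination on the circle\<close>

lemma sin_ge_half:
  fixes x :: real
  assumes "0 \<le> x" "x \<le> pi / 2"
  shows "x / 2 \<le> sin x"
proof -
  have "pi \<le> 3.2" by (rule order.trans[OF pi_approx(2)]) simp
  hence x: "x \<le> 1.6" using assms by simp
  have "\<bar>sin x - (\<Sum>m<3. sin_coeff m * x ^ m)\<bar> \<le> inverse (fact 3) * \<bar>x\<bar> ^ 3" by (rule Maclaurin_sin_bound)
  moreover have "(\<Sum>m<3. sin_coeff m * x ^ m) = x" by (simp add: numeral_3_eq_3 sin_coeff_def)
  moreover have "inverse (fact 3) * \<bar>x\<bar> ^ 3 = x * x\<^sup>2 / 6" using assms by (simp add: fact_numeral power3_eq_cube power2_eq_square)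
  ultimately have "x - sin x \<le> x * x\<^sup>2 / 6" by linarith
  also have "\<dots> \<le> x * 3 / 6"
  proof -
    have "x\<^sup>2 \<le> 1.6\<^sup>2" using assms x by (intro power_mono) auto
    hence "x\<^sup>2 \<le> 3" by (simp add: power2_eq_square)
    thus ?thesis using assms by (intro divide_right_mono mult_left_mono) auto
  qed
  finally show ?thesis by simp
qed

lemma abs_sin_ge_half:
  fixes x :: real
  assumes "\<bar>x\<bar> \<le> pi / 2"
  shows "\<bar>x\<bar> / 2 \<le> \<bar>sin x\<bar>"
  using sin_ge_half[of "\<bar>x\<bar>"] assms by (auto simp: abs_if split: if_splits)

text \<open>The Dirichlet kernel: multiplied by \<open>2 sin (\<theta> / 2)\<close>, the sum
  telescopes.\<close>

lemma sum_cos_bound: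
  fixes \<theta> :: real
  shows "\<bar>sin (\<theta> / 2)\<bar> * \<bar>\<Sum>j<n. cos (real (Suc j) * \<theta>)\<bar> \<le> 1"
proof -
  have "2 * sin (\<theta> / 2) * (\<Sum>j<n. cos (real (Suc j) * \<theta>)) = sin ((real n + 1 / 2) * \<theta>) - sin (\<theta> / 2)"
  proof (induction n)
    case (Suc n)
    have "2 * sin (\<theta> / 2) * cos (real (Suc n) * \<theta>) = sin (\<theta> / 2 + real (Suc n) * \<theta>) + sin (\<theta> / 2 - real (Suc n) * \<theta>)"
      by (simp only: sin_add sin_diff)
    also have "\<theta> / 2 + real (Suc n) * \<theta> = (real (Suc n) + 1 / 2) * \<theta>" by (simp add: algebra_simps)
    also have "sin (\<theta> / 2 - real (Suc n) * \<theta>) = - sin ((real n + 1 / 2) * \<theta>)"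
      by (simp add: algebra_simps flip: sin_minus)
    finally show ?case unfolding sum.lessThan_Suc distrib_left Suc by simp
  qed simp
  moreover have "2 * (\<bar>p\<bar> * \<bar>q\<bar>) = \<bar>2 * p * q\<bar>" for p q :: real by (simp add: abs_mult)
  ultimately have "2 * (\<bar>sin (\<theta> / 2)\<bar> * \<bar>\<Sum>j<n. cos (real (Suc j) * \<theta>)\<bar>) = \<bar>sin ((real n + 1 / 2) * \<theta>) - sin (\<theta> / 2)\<bar>"
    by (simp only:)
  also have "\<dots> \<le> \<bar>sin ((real n + 1 / 2) * \<theta>)\<bar> + \<bar>sin (\<theta> / 2)\<bar>" by (rule abs_triangle_ineq4)
  also have "\<dots> \<le> 1 + 1" by (intro add_mono abs_sin_le_one)
  finally show ?thesis by simp
qed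

text \<open>Divided by \<open>(1 - \<rho>)^2\<close>, the right side is one factor
  \<open>1 + y j\<close> of \<open>prod_ge_one_plus\<close>, so moduli of products can be compared
  exactly.\<close>

lemma norm_one_minus_polar:
  fixes \<rho> \<phi> :: real
  shows "norm (1 - of_real \<rho> * exp (\<i> * of_real \<phi>)) ^ 2 = (1 - \<rho>)\<^sup>2 + 4 * \<rho> * (sin (\<phi> / 2))\<^sup>2"
proof -
  have c: "cos \<phi> = 1 - 2 * (sin (\<phi> / 2))\<^sup>2" using cos_double_sin[of "\<phi> / 2"] by simp
  have "norm (1 - of_real \<rho> * exp (\<i> * of_real \<phi>)) ^ 2 = (1 - \<rho> * cos \<phi>)\<^sup>2 + (\<rho> * sin \<phi>)\<^sup>2"
    by (simp add: cmod_power2 Re_exp Im_exp)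
  moreover have "(1 - \<rho> * C)\<^sup>2 + (\<rho> * S)\<^sup>2 = 1 - 2 * \<rho> * C + \<rho>\<^sup>2 * (S\<^sup>2 + C\<^sup>2)" for C S :: real
    by (simp add: power2_eq_square algebra_simps)
  hence "(1 - \<rho> * cos \<phi>)\<^sup>2 + (\<rho> * sin \<phi>)\<^sup>2 = 1 - 2 * \<rho> * cos \<phi> + \<rho>\<^sup>2 * ((sin \<phi>)\<^sup>2 + (cos \<phi>)\<^sup>2)" .
  moreover have "1 - 2 * \<rho> * cos \<phi> + \<rho>\<^sup>2 * ((sin \<phi>)\<^sup>2 + (cos \<phi>)\<^sup>2) = (1 - \<rho>)\<^sup>2 + 4 * \<rho> * (sin (\<phi> / 2))\<^sup>2"
    by (subst sin_cos_squared_add, subst c) (simp add: power2_eq_square algebra_simps)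
  ultimately show ?thesis by simp
qed

text \<open>Cubing \<open>1 + y / 3 \<le> exp (y / 3)\<close>. A third power is what the range of
  large \<open>\<theta>\<close> has to supply, since \<open>M^3 \<theta>^2\<close> is at most
  \<open>pi^2 M^3\<close>.\<close>

lemma exp_ge_cube:
  fixes y :: real
  assumes "y \<ge> 0"
  shows "1 + y ^ 3 / 27 \<le> exp y"
proof -
  define u where "u = y / 3"
  have "(1 + u) ^ 3 = 1 + 3 * u + 3 * u\<^sup>2 + u ^ 3" by (simp add: power3_eq_cube power2_eq_square algebra_simps)
  moreover have "u ^ 3 = y ^ 3 / 27" by (simp add: u_def power_divide)
  ultimately have "1 + y ^ 3 / 27 \<le> (1 + y / 3) ^ 3" using assms by (simp add: u_def)
  also have "\<dots> \<le> exp (y / 3) ^ 3" using assms by (intro power_mono exp_ge_add_one_self) auto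
  also have "\<dots> = exp y" by (simp flip: exp_of_nat_mult)
  finally show ?thesis .
qed

text \<open>For \<open>\<bar>\<theta>\<bar> \<le> \<pi> / M\<close> the first \<open>M\<close> factors are all of size \<open>1 + c M^2 \<theta>^2\<close>; for larger \<open>\<theta>\<close> the mean of
  \<open>sin^2\<close> over \<open>4 M\<close> factors is bounded below, which makes the product exponentially large.\<close>

lemma prod_ge_one_plus:
  fixes M :: nat and \<theta> :: real
  assumes M: "M \<ge> 1" and \<theta>: "\<bar>\<theta>\<bar> \<le> pi"
  defines "r \<equiv> exp (- (1 / real M))"
  defines "y \<equiv> \<lambda>j. 4 * r ^ Suc j * (sin (real (Suc j) * \<theta> / 2))\<^sup>2 / (1 - r ^ Suc j)\<^sup>2"
  shows "1 + min (exp (-1) / 4) ((8 / 3 * exp (-4)) ^ 3 / (27 * pi\<^sup>2)) * real M ^ 3 * \<theta>\<^sup>2 \<le> (\<Prod>j<4 * M. 1 + y j)"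
proof -
  define a where "a = 8 / 3 * exp (-4 :: real)"
  have M0: "real M > 0" using M by simp
  have rj: "r ^ j = exp (- (real j / real M))" for j
    by (simp add: r_def flip: exp_of_nat_mult)
  have r_lt: "r ^ Suc j < 1" for j unfolding rj using M0 by simp
  have r_pos: "r ^ Suc j > 0" for j by (simp add: r_def)
  have y0: "y j \<ge> 0" for j using r_pos[of j] by (simp add: y_def)
  show ?thesis
  proof (cases "\<bar>\<theta>\<bar> \<le> pi / real M")
    case True
    \<comment> \<open>The index cancels: \<open>sin^2\<close> is at least
      \<open>m^2 \<theta>^2 / 16\<close> and \<open>1 - r^m\<close> is at most \<open>m / M\<close>,
      so every factor with \<open>m \<le> M\<close> has the same lower bound.\<close>
    have y_ge: "y j \<ge> exp (-1) / 4 * real M ^ 2 * \<theta>\<^sup>2" if "j < M" for j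
    proof -
      define m where "m = real (Suc j)"
      have m: "0 < m" "m \<le> real M" using that by (auto simp: m_def)
      have "\<bar>m * \<theta> / 2\<bar> \<le> pi / 2"
      proof -
        have "m * \<bar>\<theta>\<bar> \<le> real M * (pi / real M)" using m True by (intro mult_mono) auto
        thus ?thesis using m M0 by (simp add: abs_mult)
      qed
      hence "\<bar>m * \<theta> / 2\<bar> / 2 \<le> \<bar>sin (m * \<theta> / 2)\<bar>" by (rule abs_sin_ge_half)
      hence "(\<bar>m * \<theta> / 2\<bar> / 2)\<^sup>2 \<le> \<bar>sin (m * \<theta> / 2)\<bar>\<^sup>2" by (intro power_mono) auto
      hence s: "m\<^sup>2 * \<theta>\<^sup>2 / 16 \<le> (sin (m * \<theta> / 2))\<^sup>2" by (simp add: power_divide power_mult_distrib)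
      have r1: "exp (-1) \<le> r ^ Suc j" unfolding rj using m M0 by (simp add: m_def)
      have r2: "1 - r ^ Suc j \<le> m / real M"
        using exp_ge_add_one_self[of "- (m / real M)"] unfolding rj m_def by linarith
      have "exp (-1) / 4 * real M ^ 2 * \<theta>\<^sup>2 = 4 * exp (-1) * (m\<^sup>2 * \<theta>\<^sup>2 / 16) / (m / real M)\<^sup>2"
        using m M0 by (simp add: field_simps)
      also have "\<dots> \<le> 4 * r ^ Suc j * (sin (m * \<theta> / 2))\<^sup>2 / (1 - r ^ Suc j)\<^sup>2"
        using s r1 r2 r_lt[of j] r_pos[of j] by (intro frac_le mult_mono power_mono mult_nonneg_nonneg zero_less_power) auto
      finally show ?thesis by (simp add: y_def m_def)
    qed
    have "1 + exp (-1) / 4 * real M ^ 3 * \<theta>\<^sup>2 = 1 + real M * (exp (-1) / 4 * real M ^ 2 * \<theta>\<^sup>2)"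
      by (simp add: power3_eq_cube power2_eq_square)
    \<comment> \<open>Bernoulli's inequality for \<open>M\<close> equal factors raises
      \<open>M^2\<close> to \<open>M^3\<close>; here \<open>M\<close> acts as a number of
      factors.\<close>
    also have "\<dots> \<le> (1 + exp (-1) / 4 * real M ^ 2 * \<theta>\<^sup>2) ^ M"
      by (rule Bernoulli_inequality) (rule order.trans[of _ 0]; simp)
    also have "\<dots> = (\<Prod>j<M. 1 + exp (-1) / 4 * real M ^ 2 * \<theta>\<^sup>2)" by simp
    also have "\<dots> \<le> (\<Prod>j<M. 1 + y j)" using y_ge by (intro prod_mono) (auto simp: add_nonneg_nonneg)
    also have "\<dots> \<le> (\<Prod>j<4 * M. 1 + y j)"
    proof (rule prod_mono2)
      show "1 \<le> 1 + y j" for j using y0[of j] by simp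
      show "0 \<le> 1 + y j" for j using y0[of j] by simp
    qed auto
    finally have "1 + exp (-1) / 4 * real M ^ 3 * \<theta>\<^sup>2 \<le> (\<Prod>j<4 * M. 1 + y j)" .
    moreover have "min (exp (-1) / 4) ((8 / 3 * exp (-4)) ^ 3 / (27 * pi\<^sup>2)) * (real M ^ 3 * \<theta>\<^sup>2) \<le> exp (-1) / 4 * (real M ^ 3 * \<theta>\<^sup>2)"
      by (intro mult_right_mono) auto
    ultimately show ?thesis by (simp add: mult.assoc)
  next
    case False
    define S where "S = (\<Sum>j<4 * M. cos (real (Suc j) * \<theta>))"
    \<comment> \<open>Here \<open>\<bar>\<theta>\<bar> > pi / M\<close> bounds the cosine sum by
      \<open>4 M / 3\<close>. With \<open>4 M\<close> terms this is a third of the trivial bound,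
      which leaves \<open>(4 M - 4 M / 3) / 2 = 4 M / 3\<close> for the sum of the
      \<open>sin^2\<close>.\<close>
    have "pi / (4 * real M) \<le> \<bar>sin (\<theta> / 2)\<bar>"
      using abs_sin_ge_half[of "\<theta> / 2"] \<theta> False by simp
    moreover have "3 / (4 * real M) \<le> pi / (4 * real M)" using pi_gt3 by (intro divide_right_mono) auto
    ultimately have "3 / (4 * real M) * \<bar>S\<bar> \<le> \<bar>sin (\<theta> / 2)\<bar> * \<bar>S\<bar>" by (intro mult_right_mono) auto
    also have "\<dots> \<le> 1" unfolding S_def by (rule sum_cos_bound)
    finally have S: "S \<le> 4 * real M / 3" using M0 by (simp add: field_simps)
    have "(\<Sum>j<4 * M. (sin (real (Suc j) * \<theta> / 2))\<^sup>2) = (\<Sum>j<4 * M. (1 - cos (real (Suc j) * \<theta>)) / 2)"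
    proof (intro sum.cong refl)
      fix j show "(sin (real (Suc j) * \<theta> / 2))\<^sup>2 = (1 - cos (real (Suc j) * \<theta>)) / 2"
        using cos_double_sin[of "real (Suc j) * \<theta> / 2"] by (simp add: mult.commute)
    qed
    also have "\<dots> = (4 * real M - S) / 2"
      by (simp add: S_def sum_subtractf flip: sum_divide_distrib)
    finally have sum_sin: "(\<Sum>j<4 * M. (sin (real (Suc j) * \<theta> / 2))\<^sup>2) \<ge> 4 / 3 * real M" using S by simp
    \<comment> \<open>For \<open>j < 4 * M\<close> the power of \<open>r\<close> is at least
      \<open>exp (-4)\<close>. The coefficient 2 instead of 4 in the exponent pays for passing to
      the exponential: the exponent is at most \<open>1 / 2\<close>, where
      \<open>exp z \<le> 1 + 2 z\<close>.\<close>
    have y_ge: "exp (2 * exp (-4) * (sin (real (Suc j) * \<theta> / 2))\<^sup>2) \<le> 1 + y j" if "j < 4 * M" for j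
    proof -
      define s where "s = (sin (real (Suc j) * \<theta> / 2))\<^sup>2"
      have s: "0 \<le> s" "s \<le> 1" by (auto simp: s_def abs_square_le_1)
      have e: "exp (-4 :: real) \<le> 1 / 4"
        using exp_ge_add_one_self[of "4::real"] by (simp add: exp_minus field_simps)
      have "2 * exp (-4) * s \<le> 2 * (1 / 4) * 1" using e s by (intro mult_mono) auto
      hence "exp (2 * exp (-4) * s) \<le> 1 + 2 * (2 * exp (-4) * s)"
        using s by (intro real_exp_bound_lemma) auto
      also have "1 + 2 * (2 * exp (-4) * s) \<le> 1 + 4 * r ^ Suc j * s / (1 - r ^ Suc j)\<^sup>2"
      proof -
        have j: "real (Suc j) \<le> 4 * real M" using that by linarith
        have "exp (-4) \<le> r ^ Suc j" unfolding rj using j M0 by (simp add: divide_le_eq del: of_nat_Suc)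
        hence "4 * exp (-4) * s / 1 \<le> 4 * r ^ Suc j * s / (1 - r ^ Suc j)\<^sup>2"
          using s r_lt[of j] r_pos[of j] by (intro frac_le mult_mono mult_right_mono zero_less_power power_le_one) auto
        thus ?thesis by simp
      qed
      finally show ?thesis by (simp add: y_def s_def)
    qed
    have "a * real M \<ge> 0" by (simp add: a_def)
    hence "1 + (a * real M) ^ 3 / 27 \<le> exp (a * real M)" by (rule exp_ge_cube)
    also have "a * real M = 2 * exp (-4) * (4 / 3 * real M)" by (simp add: a_def)
    also have "exp (2 * exp (-4) * (4 / 3 * real M)) \<le> exp (2 * exp (-4) * (\<Sum>j<4 * M. (sin (real (Suc j) * \<theta> / 2))\<^sup>2))"
      using sum_sin by simp
    also have "\<dots> = (\<Prod>j<4 * M. exp (2 * exp (-4) * (sin (real (Suc j) * \<theta> / 2))\<^sup>2))"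
      by (simp add: sum_distrib_left exp_sum)
    also have "\<dots> \<le> (\<Prod>j<4 * M. 1 + y j)" using y_ge by (intro prod_mono) auto
    finally have "1 + (2 * exp (-4) * (4 / 3 * real M)) ^ 3 / 27 \<le> (\<Prod>j<4 * M. 1 + y j)" .
    moreover have "(8 / 3 * exp (-4)) ^ 3 / (27 * pi\<^sup>2) * real M ^ 3 * \<theta>\<^sup>2 \<le> (2 * exp (-4) * (4 / 3 * real M)) ^ 3 / 27"
    proof -
      have "\<theta>\<^sup>2 \<le> pi\<^sup>2" using \<theta> by (simp add: abs_le_square_iff[symmetric])
      hence "(8 / 3 * exp (-4)) ^ 3 / (27 * pi\<^sup>2) * real M ^ 3 * \<theta>\<^sup>2 \<le> (8 / 3 * exp (-4)) ^ 3 / (27 * pi\<^sup>2) * real M ^ 3 * pi\<^sup>2"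
        by (intro mult_left_mono) auto
      also have "\<dots> = (8 / 3 * exp (-4)) ^ 3 * real M ^ 3 / 27" by simp
      also have "\<dots> = (8 / 3 * exp (-4) * real M) ^ 3 / 27" by (simp only: power_mult_distrib)
      also have "8 / 3 * exp (-4) * real M = 2 * exp (-4) * (4 / 3 * real M)" by simp
      finally show ?thesis .
    qed
    moreover have "min (exp (-1) / 4) ((8 / 3 * exp (-4)) ^ 3 / (27 * pi\<^sup>2)) * real M ^ 3 * \<theta>\<^sup>2 \<le> (8 / 3 * exp (-4)) ^ 3 / (27 * pi\<^sup>2) * real M ^ 3 * \<theta>\<^sup>2"
      by (intro mult_right_mono) auto
    ultimately show ?thesis by linarith
  qed
qed

lemma norm_inverse_polar:
  fixes \<rho> \<phi> :: real
  assumes "0 < \<rho>" "\<rho> < 1"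
  shows "norm (inverse (1 - of_real \<rho> * exp (\<i> * of_real \<phi>))) ^ 2 * (1 + 4 * \<rho> * (sin (\<phi> / 2))\<^sup>2 / (1 - \<rho>)\<^sup>2) = (inverse (1 - \<rho>))\<^sup>2"
proof -
  define X where "X = 4 * \<rho> * (sin (\<phi> / 2))\<^sup>2"
  have X: "X \<ge> 0" using assms by (simp add: X_def)
  have p: "(1 - \<rho>)\<^sup>2 > 0" using assms by simp
  have "norm (inverse (1 - of_real \<rho> * exp (\<i> * of_real \<phi>))) ^ 2 = inverse ((1 - \<rho>)\<^sup>2 + X)"
    by (simp add: norm_inverse power_inverse norm_one_minus_polar X_def)
  moreover have "inverse (P + X) * (1 + X / P) = inverse P" if "P > 0" for P
    using that X by (simp add: field_simps add_nonneg_pos)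
  ultimately show ?thesis using p by (simp add: X_def power_inverse)
qed

lemma partition_product_polar:
  "partition_product J (of_real r * exp (\<i> * of_real \<theta>)) = (\<Prod>j<J. inverse (1 - of_real (r ^ Suc j) * exp (\<i> * of_real (real (Suc j) * \<theta>))))"
  unfolding partition_product_def
proof (intro prod.cong refl)
  fix j
  have "exp (\<i> * of_real \<theta>) ^ Suc j = exp (\<i> * of_real (real (Suc j) * \<theta>))"
    unfolding exp_of_nat_mult[symmetric] by (simp add: mult_ac)
  thus "inverse (1 - (of_real r * exp (\<i> * of_real \<theta>)) ^ Suc j) = inverse (1 - of_real (r ^ Suc j) * exp (\<i> * of_real (real (Suc j) * \<theta>)))"
    by (simp only: power_mult_distrib of_real_power)
qed

definition real_product :: "nat \<Rightarrow> real \<Rightarrow> real" where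
  "real_product J r = (\<Prod>j<J. inverse (1 - r ^ Suc j))"

lemma real_product_nonneg: "0 < r \<Longrightarrow> r < 1 \<Longrightarrow> real_product J r \<ge> 0"
  unfolding real_product_def by (intro prod_nonneg) (auto intro!: power_le_one mult_le_one)

lemma partition_product_of_real: "partition_product J (of_real r) = of_real (real_product J r)"
  by (simp add: partition_product_def real_product_def)

lemma norm_partition_product_square:
  assumes "0 < r" "r < 1"
  shows "norm (partition_product J (of_real r * exp (\<i> * of_real \<theta>))) ^ 2 *
     (\<Prod>j<J. 1 + 4 * r ^ Suc j * (sin (real (Suc j) * \<theta> / 2))\<^sup>2 / (1 - r ^ Suc j)\<^sup>2) = (real_product J r)\<^sup>2"
proof -
  let ?y = "\<lambda>j. 4 * r ^ Suc j * (sin (real (Suc j) * \<theta> / 2))\<^sup>2 / (1 - r ^ Suc j)\<^sup>2"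
  have lt: "r ^ Suc j < 1" for j
    using assms power_less_one_iff[of r "Suc j"] by (simp only: less_imp_le simp_thms zero_less_Suc)
  have "norm (partition_product J (of_real r * exp (\<i> * of_real \<theta>))) ^ 2 *
     (\<Prod>j<J. 1 + ?y j) =
     (\<Prod>j<J. norm (inverse (1 - of_real (r ^ Suc j) * exp (\<i> * of_real (real (Suc j) * \<theta>)))) ^ 2 *
       (1 + ?y j))"
    unfolding partition_product_polar prod_norm[symmetric] prod_power_distrib[symmetric] prod.distrib ..
  also have "\<dots> = (\<Prod>j<J. (inverse (1 - r ^ Suc j))\<^sup>2)"
    by (intro prod.cong refl norm_inverse_polar lt) (use assms in auto)
  also have "\<dots> = (real_product J r)\<^sup>2" by (simp only: real_product_def prod_power_distrib)
  finally show ?thesis .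
qed

lemma norm_partition_product_le:
  assumes "0 < r" "r < 1"
  shows "norm (partition_product J (of_real r * exp (\<i> * of_real \<theta>))) \<le> real_product J r"
proof -
  let ?w = "of_real r * exp (\<i> * of_real \<theta>)"
  let ?P = "\<Prod>j<J. 1 + 4 * r ^ Suc j * (sin (real (Suc j) * \<theta> / 2))\<^sup>2 / (1 - r ^ Suc j)\<^sup>2"
  have "1 \<le> ?P" using assms by (intro prod_ge_1) auto
  hence "norm (partition_product J (?w)) ^ 2 * 1 \<le> norm (partition_product J (?w)) ^ 2 * ?P"
    by (intro mult_left_mono) auto
  hence "norm (partition_product J (?w)) ^ 2 \<le> (real_product J r)\<^sup>2"
    unfolding norm_partition_product_square[OF assms] by simp
  thus ?thesis by (rule power2_le_imp_le) (rule real_product_nonneg[OF assms])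
qed

text \<open>The two entries belong to the two ranges of \<open>\<theta>\<close> in
  \<open>prod_ge_one_plus\<close>.\<close>

definition dom_const :: real where
  "dom_const = min (exp (-1) / 4) ((8 / 3 * exp (-4)) ^ 3 / (27 * pi\<^sup>2))"

lemma dom_const_pos: "dom_const > 0"
  by (simp add: dom_const_def)

lemma norm_partition_product_dominated:
  fixes M :: nat and \<theta> :: real
  assumes M: "M \<ge> 1" and \<theta>: "\<bar>\<theta>\<bar> \<le> pi" and J: "J \<ge> 4 * M"
  defines "r \<equiv> exp (- (1 / real M))"
  shows "norm (partition_product J (of_real r * exp (\<i> * of_real \<theta>))) ^ 2 * (1 + dom_const * real M ^ 3 * \<theta>\<^sup>2) \<le> (real_product J r)\<^sup>2"
proof -
  let ?c = "dom_const * real M ^ 3 * \<theta>\<^sup>2"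
  have r: "0 < r" "r < 1" using M by (auto simp: r_def)
  let ?y = "\<lambda>j. 1 + 4 * r ^ Suc j * (sin (real (Suc j) * \<theta> / 2))\<^sup>2 / (1 - r ^ Suc j)\<^sup>2"
  have "1 + ?c \<le> (\<Prod>j<4 * M. ?y j)"
    unfolding dom_const_def r_def by (rule prod_ge_one_plus[OF M \<theta>])
  also have "\<dots> \<le> (\<Prod>j<J. ?y j)"
    using r J by (intro prod_mono2) (auto simp: add_nonneg_nonneg)
  finally have "norm (partition_product J (of_real r * exp (\<i> * of_real \<theta>))) ^ 2 * (1 + ?c)
     \<le> norm (partition_product J (of_real r * exp (\<i> * of_real \<theta>))) ^ 2 * (\<Prod>j<J. ?y j)"
    by (intro mult_left_mono) auto
  thus ?thesis unfolding norm_partition_product_square[OF r] .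
qed

lemma integrable_cauchy_kernel:
  assumes "c > 0"
  shows "integrable lborel (\<lambda>x::real. 1 / (1 + c * x\<^sup>2))"
proof -
  have "set_integrable lborel {0<..} (\<lambda>x::real. 1 / (1 + x\<^sup>2))"
    using integrable_I0i_1_div_plus_square interval_integrable_to_infinity_eq[of lborel 0 "\<lambda>x. 1 / (1 + x\<^sup>2)"]
    by (simp add: zero_ereal_def)
  hence "integrable lborel (\<lambda>x::real. indicator {0<..} x *\<^sub>R (1 / (1 + x\<^sup>2)))"
    by (simp add: set_integrable_def)
  hence "integrable lborel (\<lambda>x::real. indicator {0..} x *\<^sub>R (1 / (1 + x\<^sup>2)))"
    by (rule integrable_discrete_difference[where X = "{0}", THEN iffD1, rotated 4]) (auto simp: indicator_def)
  then obtain I where "has_bochner_integral lborel (\<lambda>x::real. indicator {0..} x *\<^sub>R (1 / (1 + x\<^sup>2))) I"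
    by (auto simp: has_bochner_integral_iff)
  hence "has_bochner_integral lborel (\<lambda>x::real. 1 / (1 + x\<^sup>2)) (I + I)"
    using has_bochner_integral_even_function[of "\<lambda>x. 1 / (1 + x\<^sup>2)" I] by simp
  hence "integrable lborel (\<lambda>x::real. 1 / (1 + x\<^sup>2))" by (simp add: has_bochner_integral_iff)
  from lborel_integrable_real_affine[OF this, of "sqrt c" 0] show ?thesis
    using assms by (simp add: power_mult_distrib)
qed

section \<open>The combined product and the normalised Cauchy integrand\<close>

definition triple_log :: "complex \<Rightarrow> complex" where
  "triple_log t = 2 * partition_log t + partition_log (2 * t)"

definition triple_product :: "nat \<Rightarrow> complex \<Rightarrow> complex" where
  "triple_product J z = partition_product J z ^ 2 * partition_product J (z\<^sup>2)"

lemma triple_product_tendsto: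
  assumes "Re t > 0"
  shows "(\<lambda>J. triple_product J (exp (- t))) \<longlonglongrightarrow> exp (triple_log t)"
proof -
  have "exp (- t) ^ 2 = exp (- (2 * t))" by (simp flip: exp_double)
  moreover have "(\<lambda>J. partition_product J (exp (- t)) ^ 2 * partition_product J (exp (- (2 * t)))) \<longlonglongrightarrow>
      exp (partition_log t) ^ 2 * exp (partition_log (2 * t))"
    using assms by (intro tendsto_intros partition_product_tendsto) auto
  moreover have "exp (partition_log t) ^ 2 * exp (partition_log (2 * t)) = exp (triple_log t)"
    by (simp add: triple_log_def exp_add flip: exp_double)
  ultimately show ?thesis by (simp add: triple_product_def)
qed

lemma triple_product_of_real:
  "triple_product J (of_real r) = of_real (real_product J r ^ 2 * real_product J (r\<^sup>2))"
  by (simp add: triple_product_def partition_product_of_real flip: of_real_power)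

lemma polar_square: "(of_real r * exp (\<i> * of_real \<theta>))\<^sup>2 = of_real (r\<^sup>2) * exp (\<i> * of_real (2 * \<theta>))"
  by (simp add: power_mult_distrib mult.left_commute flip: exp_double)

lemma norm_triple_product_le:
  assumes "0 < r" "r < 1"
  shows "norm (triple_product J (of_real r * exp (\<i> * of_real \<theta>))) \<le> real_product J r ^ 2 * real_product J (r\<^sup>2)"
proof -
  have "r\<^sup>2 < 1" using assms by (simp add: power_less_one_iff)
  thus ?thesis unfolding triple_product_def norm_mult norm_power polar_square
    using assms by (intro mult_mono power_mono norm_partition_product_le) auto
qed

text \<open>All decay comes from the squared factor, whose squared modulus carries
  \<open>1 + dom_const M^3 \<theta>^2\<close> without a root; the factor at \<open>z^2\<close> is
  merely bounded by its value on the positive axis.\<close>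

lemma norm_triple_product_dominated:
  fixes M :: nat and \<theta> :: real
  assumes M: "M \<ge> 1" and \<theta>: "\<bar>\<theta>\<bar> \<le> pi" and J: "J \<ge> 4 * M"
  defines "r \<equiv> exp (- (1 / real M))"
  shows "norm (triple_product J (of_real r * exp (\<i> * of_real \<theta>))) * (1 + dom_const * real M ^ 3 * \<theta>\<^sup>2)
     \<le> real_product J r ^ 2 * real_product J (r\<^sup>2)"
proof -
  have r: "0 < r" "r < 1" using M by (auto simp: r_def)
  hence r2: "0 < r\<^sup>2" "r\<^sup>2 < 1" by (auto simp: power_less_one_iff)
  have "(norm (partition_product J (of_real r * exp (\<i> * of_real \<theta>))) ^ 2 * (1 + dom_const * real M ^ 3 * \<theta>\<^sup>2)) *
      norm (partition_product J (of_real (r\<^sup>2) * exp (\<i> * of_real (2 * \<theta>)))) \<le> (real_product J r)\<^sup>2 * real_product J (r\<^sup>2)"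
    using norm_partition_product_dominated[OF M \<theta> J, folded r_def] norm_partition_product_le[OF r2, of J "2 * \<theta>"]
    by (intro mult_mono) auto
  thus ?thesis unfolding triple_product_def norm_mult norm_power polar_square by (simp add: mult_ac)
qed

text \<open>The origin of the minus sign in \<open>Complex u (- \<theta>)\<close>: the point of
  argument \<open>\<theta>\<close> on the circle is \<open>exp (- t)\<close> with
  \<open>t = u - i \<theta>\<close>.\<close>

lemma polar_exp: "of_real (exp (- u)) * exp (\<i> * of_real \<theta>) = exp (- Complex u (- \<theta>))"
proof -
  have "- Complex u (- \<theta>) = of_real (- u) + \<i> * of_real \<theta>" by (simp add: complex_eq_iff)
  thus ?thesis by (simp only: exp_add exp_of_real)
qed

lemma eq_mult_if_inverse: "x * y = z \<Longrightarrow> y * c = 1 \<Longrightarrow> x = z * c" for x y z c :: "'a :: monoid_mult"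
  by (metis mult.assoc mult_1_right)

text \<open>Dividing by the value of the product at \<open>\<theta> = 0\<close> leaves only a
  difference of \<open>triple_log\<close>, for which the pole term suffices; \<open>M^(-3/2)\<close>
  is the width of the peak.\<close>

definition integrand :: "nat \<Rightarrow> nat \<Rightarrow> real \<Rightarrow> complex" where
  "integrand M n x = (let \<theta> = real M powr (-3/2) * x in
     indicator {-pi..pi} \<theta> *\<^sub>R (exp (triple_log (Complex (1 / real M) (- \<theta>)) - triple_log (of_real (1 / real M))) * exp (- (\<i> * of_nat n * of_real \<theta>))))"

context
  fixes M :: nat
  assumes M: "M \<ge> 1"
begin

lemma norm_exp_triple_log_dominated:
  assumes \<theta>: "\<bar>\<theta>\<bar> \<le> pi"
  shows "norm (exp (triple_log (Complex (1 / real M) (- \<theta>)))) * (1 + dom_const * real M ^ 3 * \<theta>\<^sup>2)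
     \<le> norm (exp (triple_log (of_real (1 / real M))))"
proof (rule LIMSEQ_le)
  let ?c = "dom_const * real M ^ 3 * \<theta>\<^sup>2"
  let ?u = "1 / real M"
  have u: "?u > 0" using M by simp
  show "(\<lambda>J. norm (triple_product J (exp (- Complex ?u (- \<theta>)))) * (1 + ?c)) \<longlonglongrightarrow>
    norm (exp (triple_log (Complex (1 / real M) (- \<theta>)))) * (1 + ?c)"
    using u by (intro tendsto_intros triple_product_tendsto) simp
  show "(\<lambda>J. norm (triple_product J (exp (- of_real ?u)))) \<longlonglongrightarrow> norm (exp (triple_log (of_real (1 / real M))))"
    using u by (intro tendsto_intros triple_product_tendsto) simp
  have r: "0 < exp (- ?u)" "exp (- ?u) < 1" "(exp (- ?u))\<^sup>2 < 1" using u by (auto simp: power_less_one_iff)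
  have "norm (triple_product J (exp (- Complex ?u (- \<theta>)))) * (1 + ?c)
      \<le> norm (triple_product J (exp (- of_real ?u)))" if "J \<ge> 4 * M" for J
  proof -
    have "exp (- of_real ?u) = (of_real (exp (- ?u)) :: complex)" by (simp only: of_real_minus[symmetric] exp_of_real)
    hence "norm (triple_product J (exp (- of_real ?u))) = real_product J (exp (- ?u)) ^ 2 * real_product J ((exp (- ?u))\<^sup>2)"
      using real_product_nonneg[of "(exp (- ?u))\<^sup>2" J] r
      by (simp only: triple_product_of_real norm_of_real) (simp add: abs_mult)
    thus ?thesis using norm_triple_product_dominated[OF M \<theta> that] unfolding polar_exp by simp
  qed
  thus "\<exists>N. \<forall>J\<ge>N. norm (triple_product J (exp (- Complex ?u (- \<theta>)))) * (1 + ?c)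
      \<le> norm (triple_product J (exp (- of_real ?u)))" by blast
qed

lemma borel_measurable_triple_log [measurable]:
  "(\<lambda>\<theta>. exp (triple_log (Complex (1 / real M) (- \<theta>)))) \<in> borel_measurable borel"
proof (rule borel_measurable_LIMSEQ_metric)
  show "(\<lambda>\<theta>. triple_product J (of_real (exp (- (1 / real M))) * exp (\<i> * of_real \<theta>))) \<in> borel_measurable borel" for J
    unfolding triple_product_def partition_product_def by measurable
  show "(\<lambda>J. triple_product J (of_real (exp (- (1 / real M))) * exp (\<i> * of_real \<theta>))) \<longlonglongrightarrow> exp (triple_log (Complex (1 / real M) (- \<theta>)))" for \<theta>
    unfolding polar_exp using M by (intro triple_product_tendsto) simp
qed

text \<open>The coefficient of the truncated product does not depend on \<open>J\<close> once
  \<open>J \<ge> n\<close>, and the products are bounded by their convergent values at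
  \<open>\<theta> = 0\<close>, so dominated convergence passes to the infinite product.\<close>

lemma integral_num_triples:
  "(\<integral>\<theta>. indicator {-pi..pi} \<theta> *\<^sub>R (exp (triple_log (Complex (1 / real M) (- \<theta>))) * exp (- (\<i> * of_nat n * of_real \<theta>))) \<partial>lborel)
     = 2 * of_real pi * of_nat (num_triples n) * of_real (exp (- (real n / real M)))"
proof -
  let ?e = "\<lambda>\<theta>. exp (- (\<i> * of_nat n * of_real \<theta>)) :: complex"
  let ?u = "1 / real M"
  define r where "r = exp (- ?u)"
  have r: "0 < r" "r < 1" using M by (auto simp: r_def)
  define s where "s = (\<lambda>J \<theta>. indicator {-pi..pi} \<theta> *\<^sub>R (triple_product J (of_real r * exp (\<i> * of_real \<theta>)) * ?e \<theta>))"
  have lim: "(\<lambda>J. triple_product J (of_real r * exp (\<i> * of_real \<theta>))) \<longlonglongrightarrow> exp (triple_log (Complex ?u (- \<theta>)))" for \<theta>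
    unfolding r_def polar_exp using M by (intro triple_product_tendsto) simp
  have "(\<lambda>J. triple_product J (of_real r)) \<longlonglongrightarrow> exp (triple_log (Complex ?u (- 0)))"
    using lim[of 0] by simp
  hence "convergent (\<lambda>J. triple_product J (of_real r))" by (rule convergentI)
  hence "Bseq (\<lambda>J. triple_product J (of_real r))" by (rule convergent_imp_Bseq)
  then obtain C where C: "\<And>J. norm (triple_product J (of_real r)) \<le> C" by (auto simp: Bseq_def)
  have "norm (triple_product J (of_real r * exp (\<i> * of_real \<theta>))) \<le> C" for J \<theta>
  proof -
    have "norm (triple_product J (of_real r * exp (\<i> * of_real \<theta>))) \<le> real_product J r ^ 2 * real_product J (r\<^sup>2)"
      by (rule norm_triple_product_le[OF r])
    also have "\<dots> \<le> norm (triple_product J (of_real r))"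
      unfolding triple_product_of_real norm_of_real by (rule abs_ge_self)
    finally show ?thesis using C[of J] by linarith
  qed
  hence bound: "norm (s J \<theta>) \<le> indicator {-pi..pi} \<theta> *\<^sub>R C" for J \<theta>
    unfolding s_def by (auto simp: norm_mult indicator_def)
  have "(\<lambda>J. \<integral>\<theta>. s J \<theta> \<partial>lborel) \<longlonglongrightarrow>
     (\<integral>\<theta>. indicator {-pi..pi} \<theta> *\<^sub>R (exp (triple_log (Complex ?u (- \<theta>))) * ?e \<theta>) \<partial>lborel)"
  proof (rule integral_dominated_convergence[where w = "\<lambda>\<theta>. indicator {-pi..pi} \<theta> *\<^sub>R C"])
    show "s J \<in> borel_measurable lborel" for J
      unfolding s_def triple_product_def partition_product_def by measurable
    show "integrable lborel (\<lambda>\<theta>. indicator {-pi..pi} \<theta> *\<^sub>R C)"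
      by (rule borel_integrable_compact) auto
    show "AE \<theta> in lborel. (\<lambda>J. s J \<theta>) \<longlonglongrightarrow>
      indicator {-pi..pi} \<theta> *\<^sub>R (exp (triple_log (Complex ?u (- \<theta>))) * ?e \<theta>)"
      unfolding s_def by (intro AE_I2 tendsto_intros lim)
    show "AE \<theta> in lborel. norm (s J \<theta>) \<le> indicator {-pi..pi} \<theta> *\<^sub>R C" for J
      using bound by (intro AE_I2)
  qed measurable
  moreover have "(\<integral>\<theta>. s J \<theta> \<partial>lborel) = 2 * of_real pi * of_nat (num_triples n) * of_real (exp (- (real n / real M)))" if "J \<ge> n" for J
  proof -
    have "r ^ n = exp (- (real n / real M))" by (simp add: r_def flip: exp_of_nat_mult)
    thus ?thesis unfolding s_def triple_product_def
      by (subst integral_card_triples[OF r]) (simp add: num_triples_def triples_cong[OF that])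
  qed
  hence "(\<lambda>J. \<integral>\<theta>. s J \<theta> \<partial>lborel) \<longlonglongrightarrow> 2 * of_real pi * of_nat (num_triples n) * of_real (exp (- (real n / real M)))"
    by (intro tendsto_eventually eventually_sequentiallyI[of n])
  ultimately show ?thesis by (rule LIMSEQ_unique)
qed

lemma borel_measurable_integrand [measurable]: "integrand M n \<in> borel_measurable lborel"
proof -
  define h where "h = real M powr (-3/2)"
  define E where "E = inverse (exp (triple_log (of_real (1 / real M))))"
  let ?f = "\<lambda>x. indicator {-pi..pi} (h * x) *\<^sub>R
     ((exp (triple_log (Complex (1 / real M) (- (h * x)))) * E) * exp (- (\<i> * of_nat n * of_real (h * x))))"
  have "integrand M n = (\<lambda>x. ?f x)"
    by (rule ext) (simp only: integrand_def Let_def h_def exp_diff E_def divide_inverse)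
  moreover have [measurable]: "(\<lambda>x. exp (triple_log (Complex (1 / real M) (- (h * x))))) \<in> borel_measurable lborel"
    using measurable_compose[OF _ borel_measurable_triple_log, of "\<lambda>x. h * x" lborel] by simp
  have "(\<lambda>x. ?f x) \<in> borel_measurable lborel"
    by measurable
  ultimately show ?thesis by (simp only:)
qed

lemma norm_integrand_le: "norm (integrand M n x) \<le> 1 / (1 + dom_const * x\<^sup>2)"
proof -
  define \<theta> where "\<theta> = real M powr (-3/2) * x"
  let ?b = "norm (exp (triple_log (of_real (1 / real M))))"
  let ?a = "norm (exp (triple_log (Complex (1 / real M) (- \<theta>))))"
  have den: "1 + dom_const * x\<^sup>2 > 0" using dom_const_pos by (simp add: add_pos_nonneg)
  show ?thesis
  proof (cases "\<bar>\<theta>\<bar> \<le> pi")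
    case True
    have "(real M powr (-3/2)) ^ 2 = real M powr (-3)"
      by (simp flip: powr_numeral powr_realpow add: power2_eq_square powr_add[symmetric])
    also have "\<dots> = inverse (real M ^ 3)" using M by (simp add: powr_minus powr_numeral)
    finally have "real M ^ 3 * \<theta>\<^sup>2 = x\<^sup>2" using M by (simp add: \<theta>_def power_mult_distrib)
    hence "?a * (1 + dom_const * x\<^sup>2) \<le> ?b"
      using norm_exp_triple_log_dominated[OF True] by (simp add: mult.assoc)
    hence "?a / ?b \<le> 1 / (1 + dom_const * x\<^sup>2)"
      using den by (simp add: field_simps del: norm_exp_eq_Re)
    moreover have "norm (integrand M n x) = ?a / ?b"
    proof -
      have "indicator {-pi..pi} \<theta> = (1 :: real)" using True by (auto simp: indicator_def abs_le_iff)
      thus ?thesis unfolding integrand_def Let_def \<theta>_def[symmetric] by (simp add: norm_mult exp_diff norm_divide)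
    qed
    ultimately show ?thesis by simp
  next
    case False
    hence "indicator {-pi..pi} \<theta> = (0 :: real)" by (auto simp: indicator_def abs_le_iff)
    hence "integrand M n x = 0" unfolding integrand_def Let_def \<theta>_def[symmetric] by simp
    thus ?thesis using den by simp
  qed
qed

lemma num_triples_eq_integral:
  "of_nat (num_triples n) = of_real (exp (real n / real M) * real M powr (-3/2) / (2 * pi)) *
     exp (triple_log (of_real (1 / real M))) * (\<integral>x. integrand M n x \<partial>lborel)"
proof -
  define h where "h = real M powr (-3/2)"
  define E where "E = exp (triple_log (of_real (1 / real M)))"
  have h: "h > 0" using M by (simp add: h_def)
  have E: "E \<noteq> 0" by (simp add: E_def)
  have "2 * of_real pi * of_nat (num_triples n) * of_real (exp (- (real n / real M))) =
    \<bar>h\<bar> *\<^sub>R (\<integral>x. indicator {-pi..pi} (0 + h * x) *\<^sub>R (exp (triple_log (Complex (1 / real M) (- (0 + h * x)))) * exp (- (\<i> * of_nat n * of_real (0 + h * x)))) \<partial>lborel)"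
    unfolding integral_num_triples[symmetric] using h by (intro lborel_integral_real_affine) simp
  also have "(\<lambda>x. indicator {-pi..pi} (0 + h * x) *\<^sub>R (exp (triple_log (Complex (1 / real M) (- (0 + h * x)))) * exp (- (\<i> * of_nat n * of_real (0 + h * x)))))
     = (\<lambda>x. E * integrand M n x)"
    unfolding integrand_def Let_def h_def[symmetric] E_def by (simp add: fun_eq_iff exp_diff)
  also have "(\<integral>x. E * integrand M n x \<partial>lborel) = E * (\<integral>x. integrand M n x \<partial>lborel)" by simp
  finally have "2 * of_real pi * of_nat (num_triples n) * of_real (exp (- (real n / real M))) = of_real h * (E * (\<integral>x. integrand M n x \<partial>lborel))"
    using h by (simp add: scaleR_conv_of_real)
  hence "of_nat (num_triples n) * (2 * of_real pi * of_real (exp (- (real n / real M)))) = of_real h * (E * (\<integral>x. integrand M n x \<partial>lborel))"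
    by (simp add: mult_ac)
  moreover have "2 * of_real pi * of_real (exp (- (real n / real M))) * of_real (exp (real n / real M) / (2 * pi)) = (1 :: complex)"
  proof -
    have "2 * pi * exp (- (real n / real M)) * (exp (real n / real M) / (2 * pi)) = 1" by (simp add: exp_minus)
    hence "complex_of_real (2 * pi * exp (- (real n / real M)) * (exp (real n / real M) / (2 * pi))) = 1"
      by (simp only: of_real_1)
    thus ?thesis by (simp only: of_real_mult of_real_numeral)
  qed
  ultimately have "of_nat (num_triples n) = of_real h * (E * (\<integral>x. integrand M n x \<partial>lborel)) * of_real (exp (real n / real M) / (2 * pi))"
    by (rule eq_mult_if_inverse)
  thus ?thesis by (simp add: E_def h_def)
qed

end

section \<open>Asymptotics of the number of triples\<close>

definition triples_main :: "nat \<Rightarrow> real" where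
  "triples_main n = 5 / 48 * (exp (steady_const * sqrt (real n)) / real n powr (3 / 2))"

text \<open>The coefficient of \<open>1 / t\<close> in the main part of \<open>triple_log t\<close>:
  \<open>2 (pi^2 / 6)\<close> from the squared factor and \<open>pi^2 / 12\<close> from the argument
  \<open>2 * t\<close>.\<close>

definition growth :: real where "growth = 5 * pi\<^sup>2 / 12"

lemma growth_pos: "growth > 0" by (simp add: growth_def)

lemma steady_const_eq: "steady_const = 2 * sqrt growth"
  by (simp add: steady_const_def growth_def real_sqrt_mult real_sqrt_divide)

lemma zeta54_nonneg: "zeta54 \<ge> 0"
  unfolding zeta54_def by (intro suminf_nonneg summable_zeta_5_4) auto

lemma triple_log_diff_bound:
  fixes u \<theta> :: real
  assumes u: "u > 0" and \<theta>: "\<bar>\<theta>\<bar> \<le> u"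
  defines "t \<equiv> Complex u (- \<theta>)"
  shows "norm (triple_log t - triple_log (of_real u) - of_real growth * (1 / t - 1 / of_real u))
     \<le> 96 * zeta54 * u powr (-5/4) * \<bar>\<theta>\<bar>"
proof -
  define C where "C = 24 * zeta54"
  have C: "C \<ge> 0" using zeta54_nonneg by (simp add: C_def)
  define D1 where "D1 = partition_log t - partition_log (of_real u) - of_real (pi\<^sup>2 / 6) * (1 / t - 1 / of_real u)"
  define D2 where "D2 = partition_log (2 * t) - partition_log (2 * of_real u) - of_real (pi\<^sup>2 / 6) * (1 / (2 * t) - 1 / (2 * of_real u))"
  have D1: "norm D1 \<le> C * u powr (-5/4) * \<bar>\<theta>\<bar>"
    using partition_log_diff_bound[of u "-\<theta>"] u \<theta> by (simp add: D1_def t_def C_def)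
  have t2: "Complex (2 * u) (2 * - \<theta>) = 2 * t" by (simp add: t_def complex_eq_iff)
  have "norm D2 \<le> C * (2 * u) powr (-5/4) * \<bar>2 * - \<theta>\<bar>"
    using partition_log_diff_bound[of "2 * u" "2 * - \<theta>", unfolded t2] u \<theta> by (simp add: D2_def C_def)
  also have "\<dots> \<le> C * u powr (-5/4) * \<bar>2 * - \<theta>\<bar>"
    using u C by (intro mult_right_mono mult_left_mono powr_mono2') auto
  finally have D2: "norm D2 \<le> C * u powr (-5/4) * (2 * \<bar>\<theta>\<bar>)" by (simp add: abs_mult)
  have t0: "t \<noteq> 0" using u by (auto simp: t_def complex_eq_iff)
  have g: "of_real growth = of_real (pi\<^sup>2 / 6) * (5 / 2 :: complex)" by (simp add: growth_def)
  have "triple_log t - triple_log (of_real u) - of_real growth * (1 / t - 1 / of_real u) = 2 * D1 + D2"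
  proof -
    have "2 * (a - b - p * (x - y)) + (c - d - p * (x / 2 - y / 2)) = 2 * a + c - (2 * b + d) - p * (5 / 2) * (x - y)"
      for a b c d p x y :: complex by (simp add: field_simps)
    from this[of "partition_log t" "partition_log (of_real u)" "of_real (pi\<^sup>2 / 6)" "1 / t" "1 / of_real u" "partition_log (2 * t)" "partition_log (2 * of_real u)"]
    show ?thesis unfolding D1_def D2_def triple_log_def g by (simp add: divide_divide_eq_left mult.commute)
  qed
  also have "norm \<dots> \<le> 2 * norm D1 + norm D2"
    using norm_triangle_ineq[of "2 * D1" D2] by (simp add: norm_mult)
  \<comment> \<open>\<open>96 = 24 (2 + 2)\<close>: twice the error at \<open>t\<close>, and the
    error at \<open>2 * t\<close>, where the imaginary part is doubled.\<close>
  also have "\<dots> \<le> 2 * (C * u powr (-5/4) * \<bar>\<theta>\<bar>) + C * u powr (-5/4) * (2 * \<bar>\<theta>\<bar>)"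
    using D1 D2 by (intro add_mono mult_left_mono) auto
  finally show ?thesis by (simp add: C_def mult_ac)
qed

text \<open>The exponent \<open>growth / t + n t\<close> is least at
  \<open>t = sqrt (growth / n)\<close>; its reciprocal is replaced by the next larger integer, which
  is also positive for \<open>n = 0\<close>.\<close>

definition saddle :: "nat \<Rightarrow> nat" where
  "saddle n = Suc (nat \<lfloor>sqrt (real n / growth)\<rfloor>)"

lemma saddle_bounds: "sqrt (real n / growth) \<le> real (saddle n)" "real (saddle n) \<le> sqrt (real n / growth) + 1"
proof -
  have "sqrt (real n / growth) \<ge> 0" using growth_pos by simp
  hence "real (nat \<lfloor>sqrt (real n / growth)\<rfloor>) = of_int \<lfloor>sqrt (real n / growth)\<rfloor>" by (intro of_nat_nat) simp
  hence "real (saddle n) = of_int \<lfloor>sqrt (real n / growth)\<rfloor> + 1" by (simp add: saddle_def)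
  thus "sqrt (real n / growth) \<le> real (saddle n)" "real (saddle n) \<le> sqrt (real n / growth) + 1" by linarith+
qed

lemma saddle_ge_1: "saddle n \<ge> 1" by (simp add: saddle_def)

lemma filterlim_sqrt_growth: "filterlim (\<lambda>n. sqrt (real n / growth)) at_top sequentially"
  using growth_pos by real_asymp

lemma filterlim_saddle: "filterlim (\<lambda>n. real (saddle n)) at_top sequentially"
  by (rule filterlim_at_top_mono[OF filterlim_sqrt_growth]) (use saddle_bounds in auto)

text \<open>Rounding leaves a linear phase \<open>(growth M^2 - n) \<theta>\<close>. With a
  coefficient of order \<open>M\<close> and \<open>\<theta>\<close> of order
  \<open>M^(-3/2)\<close>, it vanishes in the limit.\<close>

lemma saddle_defect: "\<bar>growth * real (saddle n) ^ 2 - real n\<bar> \<le> 2 * growth * real (saddle n)"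
proof -
  define s m where "s = sqrt (real n / growth)" and "m = real (saddle n)"
  have s: "0 \<le> s" "s \<le> m" "m \<le> s + 1" using saddle_bounds[of n] growth_pos by (auto simp: s_def m_def)
  have n: "real n = growth * s\<^sup>2" using growth_pos by (simp add: s_def)
  have "(m - s) * (m + s) \<le> 1 * (2 * m)" using s by (intro mult_mono) auto
  hence "m\<^sup>2 - s\<^sup>2 \<le> 2 * m" by (simp add: power2_eq_square algebra_simps)
  moreover have "s\<^sup>2 \<le> m\<^sup>2" using s by (intro power_mono) auto
  ultimately have "\<bar>m\<^sup>2 - s\<^sup>2\<bar> \<le> 2 * m" by simp
  hence "growth * \<bar>m\<^sup>2 - s\<^sup>2\<bar> \<le> growth * (2 * m)" using growth_pos by (intro mult_left_mono) auto
  moreover have "\<bar>growth * m\<^sup>2 - real n\<bar> = growth * \<bar>m\<^sup>2 - s\<^sup>2\<bar>"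
    unfolding n using growth_pos by (simp add: abs_mult flip: right_diff_distrib)
  ultimately show ?thesis by (simp add: m_def)
qed

text \<open>With \<open>y = M \<theta> = x / sqrt M\<close>,
  \<open>1 / t - M = i M y - M y^2 / (1 - i y)\<close> exactly. The linear part combines with
  \<open>- i n \<theta>\<close> to the rounding defect, and \<open>M y^2 = x^2\<close> produces the
  Gaussian.\<close>

lemma integrand_tendsto:
  "(\<lambda>n. integrand (saddle n) n x) \<longlonglongrightarrow> of_real (exp (- growth * x\<^sup>2))"
proof -
  define m where "m = (\<lambda>n. real (saddle n))"
  define \<theta> where "\<theta> = (\<lambda>n. m n powr (-3/2) * x)"
  define y where "y = (\<lambda>n. m n powr (-1/2) * x)"
  define t where "t = (\<lambda>n. Complex (1 / m n) (- \<theta> n))"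
  define E where "E = (\<lambda>n. triple_log (t n) - triple_log (of_real (1 / m n)) - \<i> * of_nat n * of_real (\<theta> n))"
  define R where "R = (\<lambda>n. triple_log (t n) - triple_log (of_real (1 / m n)) - of_real growth * (1 / t n - 1 / of_real (1 / m n)))"
  have m: "filterlim m at_top sequentially" unfolding m_def by (rule filterlim_saddle)
  have m1: "m n \<ge> 1" for n using saddle_ge_1[of n] by (simp add: m_def)
  have m0: "m n > 0" for n using m1[of n] by linarith
  have y\<theta>: "\<theta> n = y n / m n" for n
  proof -
    have "m n powr (-3/2) = m n powr (-1/2) * m n powr (-1)" by (subst powr_add[symmetric]) simp
    also have "m n powr (-1) = 1 / m n" using m0[of n] by (simp add: powr_minus_divide)
    finally show ?thesis unfolding \<theta>_def y_def by simp
  qed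
  have my2: "m n * (y n)\<^sup>2 = x\<^sup>2" for n
  proof -
    have "(m n powr (-1/2))\<^sup>2 = m n powr (-1)" by (simp add: power2_eq_square flip: powr_add)
    thus ?thesis using m0[of n] by (simp add: y_def power_mult_distrib powr_minus)
  qed
  have lim_m: "((\<lambda>n. m n powr e) \<longlonglongrightarrow> 0)" if "e < 0" for e
    using filterlim_compose[OF tendsto_neg_powr[OF that filterlim_ident] m] by simp
  have y: "y \<longlonglongrightarrow> 0" unfolding y_def using tendsto_mult[OF lim_m[of "-1/2"] tendsto_const[of x]] by simp
  have "(\<lambda>n. \<bar>y n\<bar>) \<longlonglongrightarrow> \<bar>0\<bar>" by (intro tendsto_intros y)
  hence ev: "\<forall>\<^sub>F n in sequentially. \<bar>y n\<bar> < 1" by (rule order_tendstoD) simp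
  have \<theta>_le: "\<bar>\<theta> n\<bar> \<le> 1 / m n" if "\<bar>y n\<bar> < 1" for n
    using that m0[of n] by (simp add: y\<theta> abs_divide divide_right_mono)
  have R: "R \<longlonglongrightarrow> 0"
  proof (rule Lim_null_comparison)
    show "\<forall>\<^sub>F n in sequentially. norm (R n) \<le> 96 * zeta54 * \<bar>x\<bar> * m n powr (-1/4)"
      using ev
    proof eventually_elim
      case (elim n)
      have "norm (R n) \<le> 96 * zeta54 * (1 / m n) powr (-5/4) * \<bar>\<theta> n\<bar>"
        unfolding R_def t_def using m0[of n] \<theta>_le[OF elim] by (intro triple_log_diff_bound) auto
      also have "(1 / m n) powr (-5/4) = m n powr (5/4)"
        using m0[of n] by (simp add: powr_divide powr_minus)
      also have "\<bar>\<theta> n\<bar> = m n powr (-3/2) * \<bar>x\<bar>" by (simp add: \<theta>_def abs_mult)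
      also have "96 * zeta54 * m n powr (5/4) * (m n powr (-3/2) * \<bar>x\<bar>) = 96 * zeta54 * \<bar>x\<bar> * (m n powr (5/4) * m n powr (-3/2))" by simp
      also have "m n powr (5/4) * m n powr (-3/2) = m n powr (-1/4)" by (subst powr_add[symmetric]) simp
      finally show ?case .
    qed
    show "(\<lambda>n. 96 * zeta54 * \<bar>x\<bar> * m n powr (-1/4)) \<longlonglongrightarrow> 0"
      using tendsto_mult[OF tendsto_const lim_m[of "-1/4"]] by simp
  qed
  have defect: "(\<lambda>n. (growth * m n ^ 2 - real n) * (m n powr (-3/2) * x)) \<longlonglongrightarrow> 0"
  proof (rule Lim_null_comparison)
    show "\<forall>\<^sub>F n in sequentially. norm ((growth * m n ^ 2 - real n) * (m n powr (-3/2) * x)) \<le> 2 * growth * \<bar>x\<bar> * m n powr (-1/2)"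
    proof (intro always_eventually allI)
      fix n
      have "norm ((growth * m n ^ 2 - real n) * (m n powr (-3/2) * x)) = \<bar>growth * m n ^ 2 - real n\<bar> * (m n powr (-3/2) * \<bar>x\<bar>)"
        by (simp add: abs_mult)
      also have "\<dots> \<le> 2 * growth * m n * (m n powr (-3/2) * \<bar>x\<bar>)"
        unfolding m_def by (intro mult_right_mono saddle_defect) auto
      also have "\<dots> = 2 * growth * \<bar>x\<bar> * (m n powr 1 * m n powr (-3/2))" using m0[of n] by simp
      also have "m n powr 1 * m n powr (-3/2) = m n powr (-1/2)" by (subst powr_add[symmetric]) simp
      finally show "norm ((growth * m n ^ 2 - real n) * (m n powr (-3/2) * x)) \<le> 2 * growth * \<bar>x\<bar> * m n powr (-1/2)" .
    qed
    show "(\<lambda>n. 2 * growth * \<bar>x\<bar> * m n powr (-1/2)) \<longlonglongrightarrow> 0"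
      using tendsto_mult[OF tendsto_const lim_m[of "-1/2"]] by simp
  qed
  have ne: "1 - \<i> * of_real a \<noteq> 0" for a :: real by (auto simp: complex_eq_iff)
  have E_eq: "E n = R n + (\<i> * of_real ((growth * m n ^ 2 - real n) * (m n powr (-3/2) * x)) - of_real (growth * x\<^sup>2) / (1 - \<i> * of_real (y n)))" for n
  proof -
    define Y mm where "Y = (of_real (y n) :: complex)" and "mm = (of_real (m n) :: complex)"
    have mm: "mm \<noteq> 0" using m0[of n] by (simp add: mm_def)
    have t_eq: "t n = (1 - \<i> * Y) / mm"
      unfolding t_def y\<theta> Y_def mm_def by (simp add: complex_eq_iff)
    have neY: "1 - \<i> * Y \<noteq> 0" unfolding Y_def by (rule ne)
    have inv: "1 / t n - 1 / of_real (1 / m n) = \<i> * mm * Y - mm * Y\<^sup>2 / (1 - \<i> * Y)"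
    proof -
      have "1 / of_real (1 / m n) = mm" by (simp add: mm_def)
      moreover have "mm / (1 - \<i> * Y) - mm = \<i> * mm * Y - mm * Y\<^sup>2 / (1 - \<i> * Y)"
        using neY by (simp add: field_simps power2_eq_square)
      ultimately show ?thesis by (simp add: t_eq)
    qed
    have mY2: "mm * Y\<^sup>2 = of_real (x\<^sup>2)" unfolding Y_def mm_def my2[of n, symmetric] by simp
    have th: "of_real (\<theta> n) = Y / mm" by (simp add: y\<theta> Y_def mm_def)
    have mp: "of_real (m n powr (-3/2) * x) = Y / mm" using th by (simp add: \<theta>_def)
    have "E n = R n + (of_real growth * (\<i> * mm * Y - mm * Y\<^sup>2 / (1 - \<i> * Y)) - \<i> * of_nat n * (Y / mm))"
      unfolding E_def R_def inv th by simp
    also have "of_real growth * (\<i> * mm * Y - mm * Y\<^sup>2 / (1 - \<i> * Y)) - \<i> * of_nat n * (Y / mm) =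
       \<i> * ((of_real growth * mm ^ 2 - of_nat n) * (Y / mm)) - of_real growth * (mm * Y\<^sup>2) / (1 - \<i> * Y)"
      using mm neY by (simp add: field_simps power2_eq_square)
    finally show ?thesis unfolding of_real_mult[of _ "m n powr (-3/2) * x"] mp mY2 by (simp add: mm_def Y_def)
  qed
  have "E \<longlonglongrightarrow> 0 + (\<i> * of_real 0 - of_real (growth * x\<^sup>2) / (1 - \<i> * of_real 0))"
    unfolding E_eq by (intro tendsto_intros R defect y ne)
  hence "(\<lambda>n. exp (E n)) \<longlonglongrightarrow> exp (- of_real (growth * x\<^sup>2))" by (intro tendsto_exp) simp
  moreover have "\<forall>\<^sub>F n in sequentially. exp (E n) = integrand (saddle n) n x"
    using ev
  proof eventually_elim
    case (elim n)
    have "1 / m n \<le> 1" using m1[of n] m0[of n] by (simp add: divide_le_eq)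
    hence "\<bar>\<theta> n\<bar> \<le> pi" using \<theta>_le[OF elim] pi_gt3 by linarith
    hence ind: "indicator {-pi..pi} (\<theta> n) = (1 :: real)" by (auto simp: indicator_def abs_le_iff)
    have "integrand (saddle n) n x = indicator {-pi..pi} (\<theta> n) *\<^sub>R
        (exp (triple_log (t n) - triple_log (of_real (1 / m n))) * exp (- (\<i> * of_nat n * of_real (\<theta> n))))"
      by (simp only: integrand_def Let_def m_def \<theta>_def t_def)
    also have "\<dots> = exp (E n)"
      by (simp only: ind scaleR_one mult_exp_exp E_def diff_conv_add_uminus)
    finally show ?case ..
  qed
  ultimately have "(\<lambda>n. integrand (saddle n) n x) \<longlonglongrightarrow> exp (- of_real (growth * x\<^sup>2))"
    by (rule Lim_transform_eventually)
  moreover have "exp (- of_real (growth * x\<^sup>2)) = (of_real (exp (- growth * x\<^sup>2)) :: complex)"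
    by (simp flip: exp_of_real)
  ultimately show ?thesis by (simp only:)
qed

lemma gaussian_integral:
  assumes "a > 0"
  shows "(\<integral>x. exp (- a * x\<^sup>2) \<partial>lborel) = sqrt (pi / a)"
proof -
  define \<sigma> where "\<sigma> = sqrt (1 / (2 * a))"
  have s: "\<sigma> > 0" "\<sigma>\<^sup>2 = 1 / (2 * a)" using assms by (auto simp: \<sigma>_def)
  have "exp (- a * x\<^sup>2) = sqrt (pi / a) * normal_density 0 \<sigma> x" for x
    using assms by (simp add: normal_density_def s(2))
  thus ?thesis using s(1) by simp
qed

lemma integral_integrand_tendsto:
  "(\<lambda>n. \<integral>x. integrand (saddle n) n x \<partial>lborel) \<longlonglongrightarrow> of_real (sqrt (pi / growth))"
proof -
  have "(\<lambda>n. \<integral>x. integrand (saddle n) n x \<partial>lborel) \<longlonglongrightarrow> (\<integral>x. of_real (exp (- growth * x\<^sup>2)) \<partial>lborel)"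
  proof (rule integral_dominated_convergence[where w = "\<lambda>x. 1 / (1 + dom_const * x\<^sup>2)"])
    show "integrand (saddle n) n \<in> borel_measurable lborel" for n
      by (rule borel_measurable_integrand[OF saddle_ge_1])
    show "integrable lborel (\<lambda>x. 1 / (1 + dom_const * x\<^sup>2))"
      by (rule integrable_cauchy_kernel[OF dom_const_pos])
    show "AE x in lborel. norm (integrand (saddle n) n x) \<le> 1 / (1 + dom_const * x\<^sup>2)" for n
      by (intro AE_I2 norm_integrand_le saddle_ge_1)
    show "AE x in lborel. (\<lambda>n. integrand (saddle n) n x) \<longlonglongrightarrow> of_real (exp (- growth * x\<^sup>2))"
      by (intro AE_I2 integrand_tendsto)
  qed measurable
  also have "(\<integral>x. complex_of_real (exp (- growth * x\<^sup>2)) \<partial>lborel) = of_real (sqrt (pi / growth))"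
    unfolding integral_complex_of_real gaussian_integral[OF growth_pos] ..
  finally show ?thesis .
qed

lemma num_triples_asymptotic: "(\<lambda>n. real (num_triples n) / triples_main n) \<longlonglongrightarrow> 1"
proof -
  let ?Z = "\<lambda>n. \<integral>x. integrand (saddle n) n x \<partial>lborel"
  define m where "m = (\<lambda>n. real (saddle n))"
  define s where "s = (\<lambda>n. sqrt (real n / growth))"
  define L where "L = (\<lambda>t. Re (partition_log (of_real t)))"
  define \<delta> where "\<delta> = (\<lambda>t. L t - (pi\<^sup>2 / (6 * t) + ln (t / (2 * pi)) / 2))"
  define I where "I = (\<lambda>n. Re (?Z n))"
  \<comment> \<open>\<open>K\<close> gathers the constants: \<open>48 / 5\<close> and
    \<open>growth^(3/2)\<close> from \<open>triples_main\<close>, one \<open>2 pi\<close> from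
    Cauchy's formula and \<open>2 pi sqrt pi\<close> from the values of
    \<open>partition_log\<close>. The Gaussian integral compensates it exactly.\<close>
  define K where "K = 48 / 5 * (growth * sqrt growth) / (4 * pi\<^sup>2 * sqrt pi)"
  let ?q = "\<lambda>n. exp (real n / m n) * m n powr (-3/2) / (2 * pi)"
  let ?d = "\<lambda>n. exp (2 * \<delta> (1 / m n) + \<delta> (2 / m n))"
  let ?R = "\<lambda>n. ?d n * exp (growth * ((m n - s n)\<^sup>2 / m n)) * (s n / m n) ^ 3 * K * I n"
  have m: "filterlim m at_top sequentially" unfolding m_def by (rule filterlim_saddle)
  have m1: "m n \<ge> 1" for n using saddle_ge_1[of n] by (simp add: m_def)
  have m0: "m n > 0" for n using m1[of n] by linarith
  have s_lim: "filterlim s at_top sequentially" unfolding s_def by (rule filterlim_sqrt_growth)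
  have sm: "s n \<le> m n" "m n \<le> s n + 1" for n using saddle_bounds[of n] by (auto simp: s_def m_def)
  have s0: "s n \<ge> 0" for n using growth_pos by (simp add: s_def)
  have ns: "real n = growth * (s n)\<^sup>2" for n using growth_pos by (simp add: s_def)
  have \<delta>: "(\<delta> \<longlongrightarrow> 0) (at_right 0)" unfolding \<delta>_def L_def by (rule partition_log_real_asymptotic)
  have u_lim: "filterlim (\<lambda>n. a / m n) (at_right 0) sequentially" if "a > 0" for a
  proof -
    have "((\<lambda>x. a / x) \<longlongrightarrow> 0) at_top" by (intro tendsto_divide_0[OF tendsto_const] filterlim_at_top_imp_at_infinity filterlim_ident)
    moreover have "\<forall>\<^sub>F x in at_top. a / x \<in> {0<..} \<and> a / x \<noteq> 0"
      by (rule eventually_mono[OF eventually_gt_at_top[of 0]]) (use that in auto)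
    ultimately have "filterlim (\<lambda>x. a / x) (at_right 0) at_top"
      unfolding filterlim_at by blast
    thus ?thesis using m by (rule filterlim_compose)
  qed
  have I: "I \<longlonglongrightarrow> sqrt (pi / growth)"
    using tendsto_Re[OF integral_integrand_tendsto] by (simp add: I_def)
  have logs: "exp (triple_log (of_real u)) = of_real (exp (2 * L u + L (2 * u)))" if "u > 0" for u
  proof -
    have "triple_log (of_real u) = 2 * of_real (L u) + of_real (L (2 * u))"
      unfolding triple_log_def L_def using partition_log_real_sums(2)[of u] partition_log_real_sums(2)[of "2 * u"] that by simp
    also have "\<dots> = of_real (2 * L u + L (2 * u))" by simp
    finally show ?thesis by (simp only: exp_of_real)
  qed
  have Q: "real (num_triples n) = ?q n * exp (2 * L (1 / m n) + L (2 / m n)) * I n" for n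
  proof -
    have "complex_of_real (real (num_triples n)) = of_real (?q n) *
       of_real (exp (2 * L (1 / m n) + L (2 * (1 / m n)))) * (?Z n)"
      using num_triples_eq_integral[OF saddle_ge_1, of n n] logs[of "1 / m n"] m0[of n]
      by (simp add: m_def del: of_real_mult of_real_divide)
    also have "\<dots> = of_real (?q n * exp (2 * L (1 / m n) + L (2 / m n))) * (?Z n)"
      by simp
    finally have "Re (complex_of_real (real (num_triples n))) = Re (of_real (?q n * exp (2 * L (1 / m n) + L (2 / m n))) * (?Z n))"
      by (rule arg_cong)
    moreover have "Re (of_real c * z) = c * Re z" for c z by simp
    ultimately show ?thesis unfolding I_def by (simp only: Re_complex_of_real)
  qed
  \<comment> \<open>The square roots from the real asymptotics multiply to \<open>m^(-3/2)\<close>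
    up to constants; with the width \<open>m^(-3/2)\<close> of the peak this gives
    \<open>m^(-3)\<close>, hence the order \<open>n^(-3/2)\<close>.\<close>
  have eL: "exp (2 * L (1 / m n) + L (2 / m n)) = ?d n * exp (growth * m n) / (2 * pi * m n * (sqrt pi * sqrt (m n)))" for n
  proof -
    have "2 * L (1 / m n) + L (2 / m n) = (2 * \<delta> (1 / m n) + \<delta> (2 / m n)) + growth * m n
        + (ln (1 / m n / (2 * pi)) + ln (2 / m n / (2 * pi)) / 2)"
      using m0[of n] by (simp add: \<delta>_def growth_def field_simps)
    also have "ln (1 / m n / (2 * pi)) = - ln (2 * pi * m n)"
      using m0[of n] by (simp add: ln_div ln_mult)
    also have "ln (2 / m n / (2 * pi)) / 2 = - ln (sqrt pi * sqrt (m n))"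
      using m0[of n] by (simp add: ln_div ln_mult ln_sqrt field_simps)
    finally have "exp (2 * L (1 / m n) + L (2 / m n)) = ?d n * exp (growth * m n) * (exp (- ln (2 * pi * m n)) * exp (- ln (sqrt pi * sqrt (m n))))"
      by (simp only: exp_add)
    also have "exp (- ln (2 * pi * m n)) = inverse (2 * pi * m n)" using m0[of n] by (simp add: exp_minus)
    also have "exp (- ln (sqrt pi * sqrt (m n))) = inverse (sqrt pi * sqrt (m n))" using m0[of n] by (simp add: exp_minus)
    finally show ?thesis by (simp only: divide_inverse inverse_mult_distrib)
  qed
  have ratio: "real (num_triples n) / triples_main n =
      ?R n"
    if "n > 0" for n
  proof -
    have sp: "s n > 0" using that growth_pos by (simp add: s_def)
    have main: "triples_main n = 5 / 48 * exp (2 * growth * s n) / (growth * sqrt growth * s n ^ 3)"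
    proof -
      have "steady_const * sqrt (real n) = 2 * growth * s n"
        using growth_pos by (simp add: steady_const_eq s_def real_sqrt_divide field_simps flip: real_sqrt_mult)
      moreover have "real n powr (3 / 2) = growth * sqrt growth * s n ^ 3"
      proof -
        have "real n powr (3 / 2) = real n powr 1 * real n powr (1 / 2)" by (subst powr_add[symmetric]) simp
        also have "\<dots> = growth * (s n)\<^sup>2 * (sqrt growth * s n)"
          using sp growth_pos by (simp add: powr_half_sqrt ns[of n] real_sqrt_mult)
        finally show ?thesis by (simp add: power2_eq_square power3_eq_cube)
      qed
      ultimately show ?thesis by (simp add: triples_main_def)
    qed
    \<comment> \<open>Completing the square: rounding the saddle point multiplies the main
      exponential by \<open>exp (growth (m - s)^2 / m)\<close>, and
      \<open>\<bar>m - s\<bar> \<le> 1\<close>.\<close>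
    have e: "exp (real n / m n) * exp (growth * m n) = exp (growth * ((m n - s n)\<^sup>2 / m n)) * exp (2 * growth * s n)"
    proof -
      have "real n / m n + growth * m n = growth * ((m n - s n)\<^sup>2 / m n) + 2 * growth * s n"
        unfolding ns using m0[of n] by (simp add: field_simps power2_eq_square)
      thus ?thesis by (simp flip: exp_add)
    qed
    have p: "m n powr (-3/2) = 1 / (m n * sqrt (m n))"
    proof -
      have "m n powr (3/2) = m n powr 1 * m n powr (1/2)" by (subst powr_add[symmetric]) simp
      also have "\<dots> = m n * sqrt (m n)" using m0[of n] by (simp add: powr_half_sqrt)
      finally have *: "m n powr (3/2) = m n * sqrt (m n)" .
      have "m n powr (-3/2) = inverse (m n powr (3/2))" by (subst powr_minus[symmetric]) simp
      thus ?thesis unfolding * by (simp only: divide_inverse mult_1_left)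
    qed
    have sq: "sqrt (m n) * sqrt (m n) = m n" using m0[of n] by simp
    have "real (num_triples n) = (exp (real n / m n) * exp (growth * m n)) * ?d n * I n / (4 * pi\<^sup>2 * sqrt pi * (m n * m n * (sqrt (m n) * sqrt (m n))))"
      unfolding Q eL p using m0[of n] by (simp add: field_simps power2_eq_square)
    also have "\<dots> = exp (growth * ((m n - s n)\<^sup>2 / m n)) * exp (2 * growth * s n) * ?d n * I n / (4 * pi\<^sup>2 * sqrt pi * (m n ^ 3))"
      unfolding e sq by (simp add: power3_eq_cube)
    finally show ?thesis
      unfolding main K_def using sp m0[of n] growth_pos by (simp add: field_simps)
  qed
  have "(\<lambda>n. (m n - s n)\<^sup>2 / m n) \<longlonglongrightarrow> 0"
  proof (rule Lim_null_comparison)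
    show "\<forall>\<^sub>F n in sequentially. norm ((m n - s n)\<^sup>2 / m n) \<le> inverse (m n)"
    proof (intro always_eventually allI)
      fix n
      have "(m n - s n)\<^sup>2 \<le> 1" using sm[of n] by (intro power_le_one) auto
      thus "norm ((m n - s n)\<^sup>2 / m n) \<le> inverse (m n)" using m0[of n] by (simp add: field_simps)
    qed
    show "(\<lambda>n. inverse (m n)) \<longlonglongrightarrow> 0" using m by (rule tendsto_inverse_0_at_top)
  qed
  moreover have "(\<lambda>n. s n / m n) \<longlonglongrightarrow> 1"
  proof (rule tendsto_sandwich)
    show "\<forall>\<^sub>F n in sequentially. 1 - inverse (m n) \<le> s n / m n"
    proof (intro always_eventually allI)
      fix n
      have "(m n - 1) / m n \<le> s n / m n" using sm[of n] m0[of n] by (intro divide_right_mono) auto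
      thus "1 - inverse (m n) \<le> s n / m n" using m0[of n] by (simp add: diff_divide_distrib inverse_eq_divide)
    qed
    show "\<forall>\<^sub>F n in sequentially. s n / m n \<le> 1"
      using sm m0 by (intro always_eventually allI) (simp add: divide_le_eq)
    show "(\<lambda>n. 1 - inverse (m n)) \<longlonglongrightarrow> 1"
      using tendsto_diff[OF tendsto_const tendsto_inverse_0_at_top[OF m], of 1] by simp
  qed auto
  moreover have "(\<lambda>n. \<delta> (1 / m n)) \<longlonglongrightarrow> 0" "(\<lambda>n. \<delta> (2 / m n)) \<longlonglongrightarrow> 0"
    by (rule filterlim_compose[OF \<delta> u_lim]; simp)+
  ultimately have "(\<lambda>n. ?R n)
      \<longlonglongrightarrow> exp (2 * 0 + 0) * exp (growth * 0) * 1 ^ 3 * K * sqrt (pi / growth)"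
    by (intro tendsto_intros I)
  also have "exp (2 * 0 + 0) * exp (growth * 0) * 1 ^ 3 * K * sqrt (pi / growth) = 1"
  proof -
    have "K * sqrt (pi / growth) = 48 / 5 * growth / (4 * pi\<^sup>2)"
      using growth_pos by (simp add: K_def real_sqrt_divide)
    also have "\<dots> = 1" by (simp add: growth_def)
    finally show ?thesis by simp
  qed
  finally have "(\<lambda>n. ?R n) \<longlonglongrightarrow> 1" .
  moreover have "\<forall>\<^sub>F n in sequentially. ?R n = real (num_triples n) / triples_main n"
    using eventually_gt_at_top[of 0] by eventually_elim (simp only: ratio)
  ultimately show ?thesis by (rule Lim_transform_eventually)
qed

section \<open>Asymptotics of steady pairs\<close>

lemma triples_main_pos: "n > 0 \<Longrightarrow> triples_main n > 0"
  by (simp add: triples_main_def)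

lemma steady_const_pos: "steady_const > 0"
  by (simp add: steady_const_def)

definition share :: "nat \<Rightarrow> nat \<Rightarrow> real" where
  "share n k = real (num_steady_pairs (n + k) n) / real (num_triples n)"

definition logistic :: "real \<Rightarrow> real" where
  "logistic x = inverse (1 + exp (- x))"

lemma share_nonneg: "share n k \<ge> 0" and share_le_1: "share n k \<le> 1"
  using num_steady_pairs_le[of n k] by (auto simp: share_def divide_le_eq_1)

lemma share_mono: "k \<le> k' \<Longrightarrow> share n k \<le> share n k'"
  unfolding share_def by (intro divide_right_mono) (use num_steady_pairs_mono in auto)

lemma logistic_bounds: "0 < logistic x" "logistic x < 1"
  unfolding logistic_def by (auto intro: add_pos_pos simp: inverse_less_1_iff add_strict_increasing2)

lemma logistic_ge_half: "x \<ge> 0 \<Longrightarrow> logistic x \<ge> 1 / 2"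
  unfolding logistic_def by (simp add: field_simps add_pos_pos)

lemma isCont_logistic: "isCont logistic x"
proof -
  have "1 + exp (- x) \<noteq> 0" using exp_gt_zero[of "-x"] by linarith
  thus ?thesis unfolding logistic_def by (intro continuous_intros) auto
qed

lemma tendsto_logistic: "(f \<longlongrightarrow> x) F \<Longrightarrow> ((\<lambda>i. logistic (f i)) \<longlongrightarrow> logistic x) F"
  by (rule isCont_tendsto_compose[OF isCont_logistic])

lemma abs_product_minus_1_le:
  fixes a b :: real
  shows "\<bar>a * b - 1\<bar> \<le> \<bar>a - 1\<bar> * \<bar>b - 1\<bar> + \<bar>a - 1\<bar> + \<bar>b - 1\<bar>"
proof -
  define p where "p = (a - 1) * (b - 1)"
  have "a * b - 1 = p + (a - 1) + (b - 1)" by (simp add: p_def algebra_simps)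
  hence "\<bar>a * b - 1\<bar> \<le> \<bar>p\<bar> + \<bar>a - 1\<bar> + \<bar>b - 1\<bar>" by linarith
  thus ?thesis by (simp add: p_def abs_mult)
qed

lemma eventually_num_triples_pos: "\<forall>\<^sub>F n in sequentially. num_triples n > 0"
proof -
  have "\<forall>\<^sub>F n in sequentially. real (num_triples n) / triples_main n > 0"
    using num_triples_asymptotic by (rule order_tendstoD) simp
  thus ?thesis by eventually_elim (auto intro: Nat.gr0I)
qed

section \<open>Quotients of \<open>num_triples\<close> along sequences with \<open>K\<close> close
  to \<open>x sqrt N\<close>\<close>

context
  fixes N K :: "nat \<Rightarrow> nat" and x :: real
  assumes N: "filterlim N at_top sequentially" and K: "(\<lambda>i. real (K i) / sqrt (real (N i))) \<longlonglongrightarrow> x"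
begin

lemma ratio_K_N: "(\<lambda>i. real (K i) / real (N i)) \<longlonglongrightarrow> 0"
proof -
  have "(\<lambda>i. real (K i) / sqrt (real (N i)) * inverse (sqrt (real (N i)))) \<longlonglongrightarrow> x * 0"
    by (intro tendsto_mult K tendsto_inverse_0_at_top filterlim_compose[OF sqrt_at_top]
          filterlim_compose[OF filterlim_real_sequentially N])
  thus ?thesis
    by (simp add: field_simps flip: real_sqrt_mult)
qed

lemma eventually_N_pos: "\<forall>\<^sub>F i in sequentially. N i > 0"
  by (rule eventually_compose_filterlim[OF eventually_gt_at_top N])

lemma ratio_diff: "(\<lambda>i. real (N i - K i) / real (N i)) \<longlonglongrightarrow> 1"
  and eventually_K_less: "\<forall>\<^sub>F i in sequentially. K i < N i"
proof -
  have "\<forall>\<^sub>F i in sequentially. real (K i) / real (N i) < 1"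
    using ratio_K_N by (rule order_tendstoD) simp
  thus *: "\<forall>\<^sub>F i in sequentially. K i < N i"
    using eventually_N_pos by eventually_elim simp
  have "(\<lambda>i. 1 - real (K i) / real (N i)) \<longlonglongrightarrow> 1 - 0"
    by (intro tendsto_intros ratio_K_N)
  moreover have "\<forall>\<^sub>F i in sequentially. 1 - real (K i) / real (N i) = real (N i - K i) / real (N i)"
    using * by eventually_elim (simp add: of_nat_diff diff_divide_distrib)
  ultimately show "(\<lambda>i. real (N i - K i) / real (N i)) \<longlonglongrightarrow> 1"
    using Lim_transform_eventually by fastforce
qed

lemma filterlim_diff: "filterlim (\<lambda>i. N i - K i) at_top sequentially"
proof -
  have "filterlim (\<lambda>i. real (N i - K i) / real (N i) * real (N i)) at_top sequentially"
    by (rule filterlim_tendsto_pos_mult_at_top[OF ratio_diff])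
       (auto intro: filterlim_compose[OF filterlim_real_sequentially N])
  hence "filterlim (\<lambda>i. real (N i - K i)) at_top sequentially"
    by (rule filterlim_cong[THEN iffD1, rotated -1, OF _ refl refl])
       (use eventually_N_pos in \<open>eventually_elim, simp\<close>)
  thus ?thesis by (simp add: filterlim_sequentially_iff_filterlim_real)
qed

text \<open>The exponents differ by
  \<open>c (sqrt (N - K) - sqrt N) = - c K / (sqrt N + sqrt (N - K))\<close>; the two roots are
  asymptotically equal, which explains the 2 in \<open>x / 2\<close>.\<close>

lemma num_triples_ratio:
  "(\<lambda>i. real (num_triples (N i - K i)) / real (num_triples (N i))) \<longlonglongrightarrow> exp (- (steady_const * x / 2))"
proof -
  let ?m = "\<lambda>i. triples_main (N i - K i) / triples_main (N i)"
  let ?q = "\<lambda>i. exp (- (steady_const * (real (K i) / sqrt (real (N i))) / (1 + sqrt (real (N i - K i) / real (N i))))) * inverse ((real (N i - K i) / real (N i)) powr (3 / 2))"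
  let ?r = "\<lambda>n. real (num_triples n) / triples_main n"
  have main: "(\<lambda>i. ?q i) \<longlonglongrightarrow>
      exp (- (steady_const * x / (1 + sqrt 1))) * inverse (1 powr (3 / 2))"
    by (intro tendsto_intros K ratio_diff) auto
  have "(\<lambda>i. triples_main (N i - K i) / triples_main (N i)) \<longlonglongrightarrow> exp (- (steady_const * x / 2))"
  proof (rule Lim_transform_eventually)
    show "(\<lambda>i. ?q i) \<longlonglongrightarrow> exp (- (steady_const * x / 2))"
      using main by simp
    show "\<forall>\<^sub>F i in sequentially. ?q i = triples_main (N i - K i) / triples_main (N i)"
      using eventually_K_less
    proof eventually_elim
      case (elim i)
      define a b where "a = sqrt (real (N i))" and "b = sqrt (real (N i - K i))"
      have pos: "a > 0" "b > 0" using elim by (auto simp: a_def b_def)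
      have "real (K i) = a\<^sup>2 - b\<^sup>2" using elim by (simp add: a_def b_def of_nat_diff)
      hence "real (K i) / a / (1 + b / a) = (a\<^sup>2 - b\<^sup>2) / (a + b)"
        using pos by (simp add: field_simps)
      also have "\<dots> = a - b"
        using pos by (simp add: field_simps power2_eq_square)
      finally have "steady_const * (real (K i) / a) / (1 + b / a) = steady_const * (a - b)"
        by (metis times_divide_eq_right)
      hence "- (steady_const * (real (K i) / a) / (1 + b / a)) = steady_const * b - steady_const * a"
        by (simp add: algebra_simps)
      moreover have "sqrt (real (N i - K i) / real (N i)) = b / a"
        by (simp add: a_def b_def real_sqrt_divide)
      moreover have "(real (N i - K i) / real (N i)) powr (3 / 2) = real (N i - K i) powr (3 / 2) / real (N i) powr (3 / 2)"
        by (simp add: powr_divide)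
      ultimately show ?case
        unfolding triples_main_def a_def[symmetric] b_def[symmetric]
        by (simp only: exp_diff) (simp del: of_nat_diff)
    qed
  qed
  hence "(\<lambda>i. ?r (N i - K i) / ?r (N i) * ?m i) \<longlonglongrightarrow>
      1 / 1 * exp (- (steady_const * x / 2))"
    by (intro tendsto_mult tendsto_divide filterlim_compose[OF num_triples_asymptotic] N filterlim_diff) auto
  moreover have "\<forall>\<^sub>F i in sequentially. ?r (N i - K i) / ?r (N i) * ?m i =
       real (num_triples (N i - K i)) / real (num_triples (N i))"
      using eventually_K_less
    proof eventually_elim
      case (elim i)
      have "triples_main (N i) > 0" "triples_main (N i - K i) > 0" using elim by (auto intro: triples_main_pos)
      thus ?case by (simp add: field_simps)
    qed
  ultimately show ?thesis using Lim_transform_eventually by fastforce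
qed

end

text \<open>As \<open>n = (n - Suc k) + Suc k\<close>, the second count of the recurrence is the
  numerator of \<open>share (n - Suc k) (Suc k)\<close>.\<close>

lemma share_recurrence:
  assumes "k < n" "num_triples n > 0" "num_triples (n - Suc k) > 0"
  shows "share n k = 1 - share (n - Suc k) (Suc k) * (real (num_triples (n - Suc k)) / real (num_triples n))"
proof -
  have "real (num_steady_pairs (n + k) n) + real (num_steady_pairs n (n - Suc k)) = real (num_triples n)"
    using num_steady_pairs_recurrence[OF assms(1)] by linarith
  thus ?thesis using assms by (simp add: share_def field_simps)
qed

text \<open>The hypotheses pass to \<open>N - Suc K\<close> and \<open>Suc K\<close> with the same
  \<open>x\<close>, so the recurrence can be iterated any fixed number of times.\<close>

lemma next_step:
  assumes N: "filterlim N at_top sequentially" and K: "(\<lambda>i. real (K i) / sqrt (real (N i))) \<longlonglongrightarrow> x"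
    and N'_def: "\<And>i. N' i = N i - Suc (K i)"
  shows "filterlim N' at_top sequentially"
    and "(\<lambda>i. real (Suc (K i)) / sqrt (real (N' i))) \<longlonglongrightarrow> x"
    and "(\<lambda>i. real (num_triples (N' i)) / real (num_triples (N i))) \<longlonglongrightarrow> exp (- (steady_const * x / 2))"
    and "\<forall>\<^sub>F i in sequentially. share (N i) (K i) =
           1 - share (N' i) (Suc (K i)) * (real (num_triples (N' i)) / real (num_triples (N i)))"
proof -
  have "(\<lambda>i. real (K i) / sqrt (real (N i)) + inverse (sqrt (real (N i)))) \<longlonglongrightarrow> x + 0"
    by (intro tendsto_add K tendsto_inverse_0_at_top filterlim_compose[OF sqrt_at_top]
          filterlim_compose[OF filterlim_real_sequentially N])
  hence K1: "(\<lambda>i. real (Suc (K i)) / sqrt (real (N i))) \<longlonglongrightarrow> x"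
    by (simp add: field_simps add_divide_distrib)
  note [simp] = N'_def[abs_def]
  show N': "filterlim N' at_top sequentially" using filterlim_diff[OF N K1] by simp
  have "(\<lambda>i. real (Suc (K i)) / sqrt (real (N i)) / sqrt (real (N' i) / real (N i))) \<longlonglongrightarrow> x / sqrt 1"
    using ratio_diff[OF N K1] by (intro tendsto_divide K1 tendsto_real_sqrt) auto
  moreover have "\<forall>\<^sub>F i in sequentially. real (Suc (K i)) / sqrt (real (N i)) / sqrt (real (N' i) / real (N i))
      = real (Suc (K i)) / sqrt (real (N' i))"
    using eventually_N_pos[OF N K] by eventually_elim (simp add: real_sqrt_divide)
  ultimately show "(\<lambda>i. real (Suc (K i)) / sqrt (real (N' i))) \<longlonglongrightarrow> x"
    using Lim_transform_eventually by fastforce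
  show "(\<lambda>i. real (num_triples (N' i)) / real (num_triples (N i))) \<longlonglongrightarrow> exp (- (steady_const * x / 2))"
    using num_triples_ratio[OF N K1] by simp
  have "\<forall>\<^sub>F i in sequentially. num_triples (N i) > 0" "\<forall>\<^sub>F i in sequentially. num_triples (N' i) > 0"
    using eventually_num_triples_pos N N' by (auto simp: filterlim_iff)
  thus "\<forall>\<^sub>F i in sequentially. share (N i) (K i) =
           1 - share (N' i) (Suc (K i)) * (real (num_triples (N' i)) / real (num_triples (N i)))"
    using eventually_K_less[OF N K]
    by eventually_elim (simp add: share_recurrence)
qed

text \<open>The limit \<open>s\<close> solves \<open>s = 1 - s q\<close>, and each use of the recurrence contracts the error by the factor \<open>q < 1\<close>.\<close>

lemma share_near_logistic:
  fixes x :: real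
  assumes x: "x > 0"
  defines "q \<equiv> exp (- (steady_const * x / 2))"
  assumes "filterlim N at_top sequentially" "(\<lambda>i. real (K i) / sqrt (real (N i))) \<longlonglongrightarrow> x" "\<epsilon> > 0"
  shows "\<forall>\<^sub>F i in sequentially. \<bar>share (N i) (K i) - logistic (steady_const * x / 2)\<bar> < q ^ R + \<epsilon>"
  using assms(3-)
proof (induction R arbitrary: N K \<epsilon>)
  case 0
  have "\<bar>share n k - logistic y\<bar> \<le> 1" for n k y
    using share_nonneg[of n k] share_le_1[of n k] logistic_bounds[of y] by linarith
  thus ?case using \<open>\<epsilon> > 0\<close> by (simp add: add_strict_increasing2 le_less_trans[of _ 1])
next
  case (Suc R)
  let ?s = "logistic (steady_const * x / 2)"
  define N' where "N' = (\<lambda>i. N i - Suc (K i))"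
  note nxt = next_step[OF Suc.prems(1,2) fun_cong[OF N'_def]]
  let ?r = "\<lambda>i. real (num_triples (N' i)) / real (num_triples (N i))"
  have q: "0 < q" "q < 1" using x steady_const_pos by (auto simp: q_def)
  have s: "?s = 1 - ?s * q"
    unfolding logistic_def q_def using exp_gt_zero[of "- (steady_const * x / 2)"]
    by (simp add: field_simps del: exp_gt_zero) 
  have IH: "\<forall>\<^sub>F i in sequentially. \<bar>share (N' i) (Suc (K i)) - ?s\<bar> < q ^ R + \<epsilon>"
    using Suc.IH[OF nxt(1,2) \<open>\<epsilon> > 0\<close>] .
  have r: "?r \<longlonglongrightarrow> q" using nxt(3) by (simp add: q_def)
  have "(\<lambda>i. (q ^ R + \<epsilon>) * ?r i + \<bar>?r i - q\<bar>) \<longlonglongrightarrow> (q ^ R + \<epsilon>) * q + \<bar>q - q\<bar>"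
    by (intro tendsto_intros r)
  moreover have "(q ^ R + \<epsilon>) * q + \<bar>q - q\<bar> < q ^ Suc R + \<epsilon>"
    using q \<open>\<epsilon> > 0\<close> by (simp add: algebra_simps)
  ultimately have "\<forall>\<^sub>F i in sequentially. (q ^ R + \<epsilon>) * ?r i + \<bar>?r i - q\<bar> < q ^ Suc R + \<epsilon>"
    by (rule order_tendstoD)
  thus ?case using nxt(4) IH
  proof eventually_elim
    case (elim i)
    let ?t = "share (N' i) (Suc (K i))"
    \<comment> \<open>Subtracting the fixed point equation separates the old error, multiplied by
      the quotient, from the error of the quotient itself.\<close>
    have "share (N i) (K i) - ?s = (?s - ?t) * ?r i + ?s * (q - ?r i)"
      unfolding elim(2) by (subst (1) s) (simp add: algebra_simps)
    hence "\<bar>share (N i) (K i) - ?s\<bar> \<le> \<bar>(?s - ?t) * ?r i\<bar> + \<bar>?s * (q - ?r i)\<bar>"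
      by (simp only: abs_triangle_ineq)
    also have "\<dots> = \<bar>?t - ?s\<bar> * ?r i + ?s * \<bar>?r i - q\<bar>"
      using logistic_bounds[of "steady_const * x / 2"] by (simp add: abs_mult abs_minus_commute)
    also have "\<dots> \<le> (q ^ R + \<epsilon>) * ?r i + 1 * \<bar>?r i - q\<bar>"
      using elim(3) logistic_bounds[of "steady_const * x / 2"] by (intro add_mono mult_right_mono) auto
    finally show ?case using elim(1) by simp
  qed
qed

lemma share_tendsto_pos:
  assumes x: "x > 0" and N: "filterlim N at_top sequentially" and K: "(\<lambda>i. real (K i) / sqrt (real (N i))) \<longlonglongrightarrow> x"
  shows "(\<lambda>i. share (N i) (K i)) \<longlonglongrightarrow> logistic (steady_const * x / 2)"
proof (rule tendstoI)
  fix \<epsilon> :: real assume "\<epsilon> > 0"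
  have "exp (- (steady_const * x / 2)) < 1" using x steady_const_pos by simp
  then obtain R where "exp (- (steady_const * x / 2)) ^ R < \<epsilon> / 2"
    using real_arch_pow_inv[of "\<epsilon> / 2"] \<open>\<epsilon> > 0\<close> by (meson half_gt_zero)
  thus "\<forall>\<^sub>F i in sequentially. dist (share (N i) (K i)) (logistic (steady_const * x / 2)) < \<epsilon>"
    using share_near_logistic[OF x N K, of "\<epsilon> / 2" R] \<open>\<epsilon> > 0\<close>
    by (auto elim!: eventually_mono simp: dist_real_def)
qed

section \<open>Boundary cases by monotonicity in \<open>k\<close>\<close>

lemma floor_scale:
  assumes N: "filterlim N at_top sequentially" and "x \<ge> 0"
  shows "(\<lambda>i. real (nat \<lfloor>x * sqrt (real (N i))\<rfloor>) / sqrt (real (N i))) \<longlonglongrightarrow> x"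
proof (rule tendsto_sandwich)
  let ?y = "\<lambda>i. x * sqrt (real (N i))"
  let ?r = "\<lambda>i. real (nat \<lfloor>?y i\<rfloor>) / sqrt (real (N i))"
  have lim: "(\<lambda>i. inverse (sqrt (real (N i)))) \<longlonglongrightarrow> 0"
    by (intro tendsto_inverse_0_at_top filterlim_compose[OF sqrt_at_top] filterlim_compose[OF filterlim_real_sequentially N])
  show "(\<lambda>i. x - inverse (sqrt (real (N i)))) \<longlonglongrightarrow> x" using tendsto_diff[OF tendsto_const lim] by simp
  have pos: "\<forall>\<^sub>F i in sequentially. N i > 0" by (rule eventually_compose_filterlim[OF eventually_gt_at_top N])
  have fl: "real (nat \<lfloor>?y i\<rfloor>) = of_int \<lfloor>?y i\<rfloor>" for i
    using \<open>x \<ge> 0\<close> by (intro of_nat_nat) simp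
  show "\<forall>\<^sub>F i in sequentially. x - inverse (sqrt (real (N i))) \<le> ?r i"
    using pos
  proof eventually_elim
    case (elim i)
    have "(?y i - 1) / sqrt (real (N i)) \<le> of_int \<lfloor>?y i\<rfloor> / sqrt (real (N i))"
      by (intro divide_right_mono; linarith?) auto
    moreover have "(?y i - 1) / sqrt (real (N i)) = x - inverse (sqrt (real (N i)))"
      using elim by (simp add: diff_divide_distrib inverse_eq_divide)
    ultimately show ?case by (simp only: fl)
  qed
  show "\<forall>\<^sub>F i in sequentially. ?r i \<le> x"
    using pos
  proof eventually_elim
    case (elim i)
    have "of_int \<lfloor>?y i\<rfloor> \<le> ?y i" by linarith
    thus ?case using elim by (simp only: fl) (simp add: field_simps)
  qed
qed auto

lemma share_tendsto_floor:
  assumes "filterlim N at_top sequentially" "x > 0"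
  shows "(\<lambda>i. share (N i) (nat \<lfloor>x * sqrt (real (N i))\<rfloor>)) \<longlonglongrightarrow> logistic (steady_const * x / 2)"
  using assms by (intro share_tendsto_pos floor_scale) auto

text \<open>At \<open>x = 0\<close> the contraction factor is 1 and iteration gains nothing.
  Monotonicity compares with a small fixed \<open>x > 0\<close>, whose limit is close to
  \<open>1 / 2\<close>, but only from above.\<close>

lemma share_upper_0:
  assumes N: "filterlim N at_top sequentially" and K: "(\<lambda>i. real (K i) / sqrt (real (N i))) \<longlonglongrightarrow> 0" and "\<epsilon> > 0"
  shows "\<forall>\<^sub>F i in sequentially. share (N i) (K i) < 1 / 2 + \<epsilon>"
proof -
  have "((\<lambda>x. logistic (steady_const * x / 2)) \<longlongrightarrow> logistic (steady_const * 0 / 2)) (at_right 0)"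
    by (intro tendsto_logistic tendsto_intros) auto
  moreover have "logistic (steady_const * 0 / 2) < 1 / 2 + \<epsilon>" using \<open>\<epsilon> > 0\<close> by (simp add: logistic_def)
  ultimately have "\<forall>\<^sub>F x in at_right 0. logistic (steady_const * x / 2) < 1 / 2 + \<epsilon>" by (rule order_tendstoD)
  moreover have "\<forall>\<^sub>F x::real in at_right 0. x > 0" by (simp add: eventually_at_right_less)
  ultimately have "\<forall>\<^sub>F x in at_right 0. logistic (steady_const * x / 2) < 1 / 2 + \<epsilon> \<and> x > 0" by eventually_elim simp
  then obtain x where x: "logistic (steady_const * x / 2) < 1 / 2 + \<epsilon>" "x > 0"
    using eventually_happens'[OF trivial_limit_at_right_real] by blast
  have "\<forall>\<^sub>F i in sequentially. share (N i) (nat \<lfloor>x * sqrt (real (N i))\<rfloor>) < 1 / 2 + \<epsilon>"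
    using share_tendsto_floor[OF N x(2)] x(1) by (rule order_tendstoD)
  moreover have "\<forall>\<^sub>F i in sequentially. real (K i) / sqrt (real (N i)) < x" using K x(2) by (rule order_tendstoD)
  ultimately show ?thesis using eventually_N_pos[OF N K]
  proof eventually_elim
    case (elim i)
    have "real (K i) \<le> x * sqrt (real (N i))" using elim by (simp add: field_simps)
    hence "K i \<le> nat \<lfloor>x * sqrt (real (N i))\<rfloor>" by (simp add: le_nat_floor)
    thus ?case using share_mono[of "K i" _ "N i"] elim(1) by (meson le_less_trans)
  qed
qed

text \<open>The recurrence turns the upper bound, applied to the next pair, into a lower bound: the
  quotient tends to 1, so the share is at least about \<open>1 - 1 / 2\<close>.\<close>

lemma share_tendsto_0:
  assumes N: "filterlim N at_top sequentially" and K: "(\<lambda>i. real (K i) / sqrt (real (N i))) \<longlonglongrightarrow> 0"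
  shows "(\<lambda>i. share (N i) (K i)) \<longlonglongrightarrow> 1 / 2"
proof (rule order_tendstoI)
  fix a :: real assume "a > 1 / 2"
  thus "\<forall>\<^sub>F i in sequentially. share (N i) (K i) < a" using share_upper_0[OF N K, of "a - 1 / 2"] by simp
next
  fix a :: real assume a: "a < 1 / 2"
  define N' where "N' = (\<lambda>i. N i - Suc (K i))"
  note nxt = next_step[OF N K fun_cong[OF N'_def]]
  let ?r = "\<lambda>i. real (num_triples (N' i)) / real (num_triples (N i))"
  define \<epsilon> where "\<epsilon> = (1 / 2 - a) / 2"
  have \<epsilon>: "\<epsilon> > 0" using a by (simp add: \<epsilon>_def)
  have "(\<lambda>i. 1 - (1 / 2 + \<epsilon>) * ?r i) \<longlonglongrightarrow> 1 - (1 / 2 + \<epsilon>) * exp (- (steady_const * 0 / 2))"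
    by (intro tendsto_intros nxt(3))
  moreover have "1 - (1 / 2 + \<epsilon>) * exp (- (steady_const * 0 / 2)) > a" using a by (simp add: \<epsilon>_def field_simps)
  ultimately have "\<forall>\<^sub>F i in sequentially. 1 - (1 / 2 + \<epsilon>) * ?r i > a" by (rule order_tendstoD)
  thus "\<forall>\<^sub>F i in sequentially. share (N i) (K i) > a"
    using share_upper_0[OF nxt(1,2) \<epsilon>] nxt(4)
  proof eventually_elim
    case (elim i)
    have "share (N' i) (Suc (K i)) * ?r i \<le> (1 / 2 + \<epsilon>) * ?r i"
      using elim(2) by (intro mult_right_mono) auto
    thus ?case using elim by linarith
  qed
qed

text \<open>Squeezed between 1 and the share at a fixed large \<open>x\<close>, which monotonicity
  places below.\<close>

lemma share_tendsto_at_top: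
  assumes N: "filterlim N at_top sequentially" and K: "filterlim (\<lambda>i. real (K i) / sqrt (real (N i))) at_top sequentially"
  shows "(\<lambda>i. share (N i) (K i)) \<longlonglongrightarrow> 1"
proof (rule order_tendstoI)
  fix a :: real assume "a > 1"
  thus "\<forall>\<^sub>F i in sequentially. share (N i) (K i) < a"
    using share_le_1 by (intro always_eventually allI) (meson le_less_trans)
next
  fix a :: real assume a: "a < 1"
  have "((\<lambda>x. logistic (steady_const * x / 2)) \<longlongrightarrow> 1) at_top"
    unfolding logistic_def using steady_const_pos by real_asymp
  hence "\<forall>\<^sub>F x in at_top. logistic (steady_const * x / 2) > a" using a by (rule order_tendstoD)
  hence "\<forall>\<^sub>F x in at_top. logistic (steady_const * x / 2) > a \<and> x > 0"
    using eventually_gt_at_top[of "0::real"] by eventually_elim simp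
  then obtain x where x: "logistic (steady_const * x / 2) > a" "x > 0"
    using eventually_happens'[OF trivial_limit_at_top_linorder] by blast
  have "\<forall>\<^sub>F i in sequentially. share (N i) (nat \<lfloor>x * sqrt (real (N i))\<rfloor>) > a"
    using share_tendsto_floor[OF N x(2)] x(1) by (rule order_tendstoD)
  moreover have "\<forall>\<^sub>F i in sequentially. real (K i) / sqrt (real (N i)) > x"
    using K by (auto simp: filterlim_at_top_dense)
  moreover have "\<forall>\<^sub>F i in sequentially. N i > 0" by (rule eventually_compose_filterlim[OF eventually_gt_at_top N])
  ultimately show "\<forall>\<^sub>F i in sequentially. share (N i) (K i) > a"
  proof eventually_elim
    case (elim i)
    have "x * sqrt (real (N i)) \<le> real (K i)" using elim by (simp add: field_simps)
    hence "nat \<lfloor>x * sqrt (real (N i))\<rfloor> \<le> K i" by linarith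
    thus ?case using share_mono[of _ "K i" "N i"] elim(1) by (meson less_le_trans)
  qed
qed

text \<open>A failure of uniformity gives a sequence of bad pairs. The extended reals are
  sequentially compact, so along a subsequence \<open>K / sqrt N\<close> converges in
  \<open>[0, \<infinity>]\<close>, and in each case \<open>share\<close> and \<open>logistic\<close>
  have the same limit.\<close>

lemma share_uniform:
  assumes "\<epsilon> > 0"
  shows "\<exists>n0. \<forall>n\<ge>n0. \<forall>k. \<bar>share n k - logistic (steady_const * real k / (2 * sqrt (real n)))\<bar> < \<epsilon>"
proof (rule ccontr)
  let ?bad = "\<lambda>n k. \<bar>share n k - logistic (steady_const * real k / (2 * sqrt (real n)))\<bar> \<ge> \<epsilon>"
  assume "\<not> ?thesis"
  hence "\<forall>i. \<exists>n k. n \<ge> i \<and> ?bad n k" by (metis not_less)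
  then obtain N0 K0 where NK: "\<And>i. N0 i \<ge> i" "\<And>i. ?bad (N0 i) (K0 i)" by metis
  have N0: "filterlim N0 at_top sequentially"
    by (rule filterlim_at_top_mono[OF filterlim_ident]) (use NK in auto)
  obtain l r where r: "strict_mono (r :: nat \<Rightarrow> nat)"
    and l: "((\<lambda>i. ereal (real (K0 i) / sqrt (real (N0 i)))) \<circ> r) \<longlonglongrightarrow> l"
    using compact_complete_linorder by blast
  define N K where "N = N0 \<circ> r" and "K = K0 \<circ> r"
  have N: "filterlim N at_top sequentially"
    unfolding N_def o_def by (rule filterlim_compose[OF N0 filterlim_subseq[OF r]])
  have bad: "?bad (N i) (K i)" for i using NK by (simp add: N_def K_def)
  have l': "(\<lambda>i. ereal (real (K i) / sqrt (real (N i)))) \<longlonglongrightarrow> l" using l by (simp add: o_def N_def K_def)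
  have arg: "steady_const * real k / (2 * sqrt (real n)) = steady_const * (real k / sqrt (real n)) / 2" for k n
    by simp
  have "\<exists>y. (\<lambda>i. share (N i) (K i)) \<longlonglongrightarrow> y \<and>
      (\<lambda>i. logistic (steady_const * (real (K i) / sqrt (real (N i))) / 2)) \<longlonglongrightarrow> y"
  proof (cases l)
    case (real x)
    hence K: "(\<lambda>i. real (K i) / sqrt (real (N i))) \<longlonglongrightarrow> x" using l' by simp
    have "(\<lambda>i. logistic (steady_const * (real (K i) / sqrt (real (N i))) / 2)) \<longlonglongrightarrow> logistic (steady_const * x / 2)"
      by (intro tendsto_logistic tendsto_intros K)  simp
    moreover have "(\<lambda>i. share (N i) (K i)) \<longlonglongrightarrow> logistic (steady_const * x / 2)"
    proof -
      have "x \<ge> 0" by (rule tendsto_lowerbound[OF K]) auto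
      thus ?thesis using share_tendsto_pos[OF _ N K] share_tendsto_0[OF N] K
        by (cases "x = 0") (auto simp: logistic_def)
    qed
    ultimately show ?thesis by blast
  next
    case PInf
    hence K: "filterlim (\<lambda>i. real (K i) / sqrt (real (N i))) at_top sequentially"
      using l' by (simp add: tendsto_PInfty_eq_at_top)
    have "((\<lambda>x. logistic (steady_const * x / 2)) \<longlongrightarrow> 1) at_top"
      unfolding logistic_def using steady_const_pos by real_asymp
    from filterlim_compose[OF this K] share_tendsto_at_top[OF N K] show ?thesis by blast
  next
    case MInf
    have "l \<ge> 0" by (rule tendsto_lowerbound[OF l']) auto
    thus ?thesis using MInf by simp
  qed
  then obtain y where "(\<lambda>i. share (N i) (K i)) \<longlonglongrightarrow> y"
      "(\<lambda>i. logistic (steady_const * (real (K i) / sqrt (real (N i))) / 2)) \<longlonglongrightarrow> y" by blast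
  hence "(\<lambda>i. \<bar>share (N i) (K i) - logistic (steady_const * (real (K i) / sqrt (real (N i))) / 2)\<bar>) \<longlonglongrightarrow> \<bar>y - y\<bar>"
    by (intro tendsto_intros)
  hence "\<epsilon> \<le> \<bar>y - y\<bar>" by (rule tendsto_lowerbound) (use bad[unfolded arg] in auto)
  thus False using \<open>\<epsilon> > 0\<close> by simp
qed

text \<open>\<open>logistic\<close> is at least \<open>1 / 2\<close> for non-negative arguments, so
  the uniform additive error of \<open>share\<close> is also a relative one. Symmetry reduces the
  claim to \<open>m \<ge> n\<close>.\<close>

lemma num_steady_pairs_asymptotic:
  assumes "\<epsilon> > 0"
  shows "\<exists>N. \<forall>m n. m > 0 \<and> n > 0 \<and> min m n \<ge> N \<longrightarrow>
     \<bar>real (num_steady_pairs m n) / steady_main_term m n - 1\<bar> \<le> \<epsilon>"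
proof -
  \<comment> \<open>The relative errors \<open>\<delta>\<close> and \<open>2 \<delta>\<close> of the
    two factors combine to \<open>2 \<delta>^2 + 3 \<delta>\<close>, at most
    \<open>5 \<delta>\<close> since \<open>\<delta> \<le> 1\<close>.\<close>
  define \<delta> where "\<delta> = min 1 (\<epsilon> / 5)"
  have \<delta>: "\<delta> > 0" "\<delta> \<le> 1" "5 * \<delta> \<le> \<epsilon>" using assms by (auto simp: \<delta>_def)
  obtain n1 where n1: "\<And>n k. n \<ge> n1 \<Longrightarrow>
      \<bar>share n k - logistic (steady_const * real k / (2 * sqrt (real n)))\<bar> < \<delta>"
    using share_uniform[OF \<delta>(1)] by blast
  have "\<forall>\<^sub>F n in sequentially. dist (real (num_triples n) / triples_main n) 1 < \<delta>"
    using num_triples_asymptotic \<delta>(1) by (rule tendstoD)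
  hence "\<forall>\<^sub>F n in sequentially. dist (real (num_triples n) / triples_main n) 1 < \<delta> \<and> num_triples n > 0"
    using eventually_num_triples_pos by eventually_elim simp
  then obtain n2 where n2: "\<And>n. n \<ge> n2 \<Longrightarrow> \<bar>real (num_triples n) / triples_main n - 1\<bar> < \<delta>"
      "\<And>n. n \<ge> n2 \<Longrightarrow> num_triples n > 0"
    by (auto simp: eventually_sequentially dist_real_def)
  have *: "\<bar>real (num_steady_pairs (n + k) n) / steady_main_term (n + k) n - 1\<bar> \<le> \<epsilon>"
    if "n > 0" "n \<ge> n1" "n \<ge> n2" for n k
  proof -
    let ?l = "logistic (steady_const * real k / (2 * sqrt (real n)))"
    let ?a = "real (num_triples n) / triples_main n"
    have l: "?l \<ge> 1 / 2" using steady_const_pos by (intro logistic_ge_half) simp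
    have "steady_main_term (n + k) n = triples_main n * ?l"
      by (simp add: steady_main_term_def triples_main_def logistic_def)
    moreover have "real (num_steady_pairs (n + k) n) = share n k * real (num_triples n)"
      using n2(2)[of n] that by (simp add: share_def)
    ultimately have eq: "real (num_steady_pairs (n + k) n) / steady_main_term (n + k) n = ?a * (share n k / ?l)"
      by simp
    have "\<bar>share n k / ?l - 1\<bar> = \<bar>share n k - ?l\<bar> / ?l"
      using l by (simp add: field_simps abs_if)
    also have "\<dots> \<le> \<delta> / (1 / 2)"
      using l n1[of n k] that \<delta> by (intro frac_le) auto
    finally have s: "\<bar>share n k / ?l - 1\<bar> \<le> 2 * \<delta>" by simp
    have a: "\<bar>?a - 1\<bar> \<le> \<delta>" using n2(1)[of n] that by simp
    have "\<bar>?a * (share n k / ?l) - 1\<bar> \<le> \<bar>?a - 1\<bar> * \<bar>share n k / ?l - 1\<bar> + \<bar>?a - 1\<bar> + \<bar>share n k / ?l - 1\<bar>"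
      by (rule abs_product_minus_1_le)
    also have "\<dots> \<le> \<delta> * (2 * \<delta>) + \<delta> + 2 * \<delta>"
      using a s by (intro add_mono mult_mono) auto
    also have "\<dots> \<le> 1 * (2 * \<delta>) + \<delta> + 2 * \<delta>" using \<delta> by (intro add_mono mult_right_mono) auto
    finally show ?thesis unfolding eq using \<delta> by linarith
  qed
  show ?thesis
  proof (intro exI[of _ "max n1 n2"] allI impI)
    fix m n :: nat assume mn: "m > 0 \<and> n > 0 \<and> min m n \<ge> max n1 n2"
    show "\<bar>real (num_steady_pairs m n) / steady_main_term m n - 1\<bar> \<le> \<epsilon>"
    proof (cases "m \<ge> n")
      case True
      thus ?thesis using *[of n "m - n"] mn by simp
    next
      case False
      have "steady_main_term m n = steady_main_term n m"
        by (simp add: steady_main_term_def min.commute abs_minus_commute)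
      thus ?thesis using *[of m "n - m"] mn False by (simp add: num_steady_pairs_commute[of m n])
    qed
  qed
qed

lemma num_steady_pairs_diagonal:
  "(\<lambda>n. real (num_steady_pairs n n)) \<sim>[at_top]
     (\<lambda>n. 5 / (2 ^ 5 * 3) * (exp (steady_const * sqrt (real n)) / real n powr (3 / 2)))"
proof (rule asymp_equivI')
  have main: "steady_main_term n n = 5 / (2 ^ 5 * 3) * (exp (steady_const * sqrt (real n)) / real n powr (3 / 2))" for n
    by (simp add: steady_main_term_def)
  have "(\<lambda>n. real (num_steady_pairs n n) / steady_main_term n n) \<longlonglongrightarrow> 1"
  proof (rule LIMSEQ_I)
    fix r :: real assume "r > 0"
    then obtain N where N: "\<And>m n. m > 0 \<and> n > 0 \<and> min m n \<ge> N \<Longrightarrow>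
        \<bar>real (num_steady_pairs m n) / steady_main_term m n - 1\<bar> \<le> r / 2"
      using num_steady_pairs_asymptotic[of "r / 2"] by (meson half_gt_zero)
    show "\<exists>N. \<forall>n\<ge>N. norm (real (num_steady_pairs n n) / steady_main_term n n - 1) < r"
    proof (intro exI[of _ "Suc N"] allI impI)
      fix n assume "n \<ge> Suc N"
      hence "\<bar>real (num_steady_pairs n n) / steady_main_term n n - 1\<bar> \<le> r / 2" by (intro N) auto
      thus "norm (real (num_steady_pairs n n) / steady_main_term n n - 1) < r" using \<open>r > 0\<close> by simp
    qed
  qed
  thus "(\<lambda>n. real (num_steady_pairs n n) / (5 / (2 ^ 5 * 3) * (exp (steady_const * sqrt (real n)) / real n powr (3 / 2)))) \<longlonglongrightarrow> 1"
    unfolding main .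
qed

theorem theorem1p3:
  shows "(\<forall>\<epsilon>>0::real. \<exists>N::nat. \<forall>m n :: nat. m > 0 \<and> n > 0 \<and> min m n \<ge> N \<longrightarrow>
            \<bar>real (num_steady_pairs m n) / steady_main_term m n - 1\<bar> \<le> \<epsilon>) \<and>
         (\<lambda>n. real (num_steady_pairs n n)) \<sim>[at_top]
            (\<lambda>n. 5 / (2 ^ 5 * 3) * (exp (steady_const * sqrt (real n)) / real n powr (3 / 2)))"
  using num_steady_pairs_asymptotic num_steady_pairs_diagonal by blast

end
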